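(* Let $X\subseteq\mathbb{R}^d$ be open and let $\psi:X\to X$ be smooth and bijective with $\det J\psi(x)\neq 0$ for all $x\in X$. Then the following are equivalent: (i) The composition operator $C_\psi$ is power bounded on $\mathscr{D}'(X)$. (ii) $\psi$ has stable orbits, and for every compact subset $K\subseteq X$ and every $n\in\mathbb{N}_0$ we have $$\forall\,1\le c\le d:\quad \sup_{m\in\mathbb{N}}\left\|(\psi^{-m})_c\right\|_{n,\psi^m(K)}<\infty.$$
   Context: Notation. $\mathbb{N}=\{1,2,\dots\}$, $\mathbb{N}_0=\mathbb{N}\cup\{0\}$. $J\psi(x)$ is the Jacobian matrix of $\psi$ at $x$; $\psi^m$ is the $m$-th iterate of $\psi$, $\psi^{-m}:=(\psi^{-1})^m$, and $(\psi^{-m})_c$, $1\le c\le d$, are the components of $\psi^{-m}:X\to X\subseteq\mathbb{R}^d$. $\mathscr{D}(X)$ is the space of compactly supported smooth (complex-valued) functions on $X$ with its standard locally convex (inductive limit) topology, and $\mathscr{D}'(X)$ is the space of distributions on $X$, equipped with the strong dual topology (uniform convergence on bounded subsets of $\mathscr{D}(X)$). For $K\subseteq X$ compact, $n\in\mathbb{N}_0$ and $f\in C^\infty(X)$, put $\|f\|_{n,K}:=\sup_{|\alpha|\le n,\,x\in K}|\partial^\alpha f(x)|$. Composition operator: for smooth $\psi:X\to X$ with $\det J\psi(x)\ne0$ for all $x\in X$, $C_\psi$ is the unique continuous linear operator on $\mathscr{D}'(X)$ extending $C(X)\ni f\mapsto f\circ\psi$. For bijective $\psi$ it is given by $\langle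 C_\psi(u),\varphi\rangle=\langle u,(\varphi/|\det J\psi|)\circ\psi^{-1}\rangle$ for $\varphi\in\mathscr{D}(X)$. Power bounded: a continuous linear operator $T$ on a locally convex space $E$ is power bounded if for every continuous seminorm $p$ on $E$ there is a continuous seminorm $q$ on $E$ such that $p(T^m(x))\le q(x)$ for all $m\in\mathbb{N}$ and $x\in E$. Stable orbits: a continuous map $\psi:X\to X$ has stable orbits if for every compact $K\subseteq X$ there is a compact $L\subseteq X$ with $\psi^m(K)\subseteq L$ for every $m\in\mathbb{N}$. *)

theory Defs
  imports "HOL-Analysis.Analysis"
begin

section \<open>Smooth functions\<close>

definition partial_deriv :: "'d::finite \<Rightarrow> (real^'d \<Rightarrow> 'b::real_normed_vector) \<Rightarrow> real^'d \<Rightarrow> 'b" where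
  "partial_deriv i f x = frechet_derivative f (at x) (axis i 1)"

text \<open>
  Higher partial derivatives are indexed by words of coordinate directions instead of multi-indices.
  For smooth functions the order of differentiation is irrelevant, so the words of length \<open>k\<close> yield
  exactly the derivatives \<open>\<partial>\<^sup>\<alpha> f\<close> with \<open>\<bar>\<alpha>\<bar> = k\<close>.
\<close>

primrec iter_partial :: "'d::finite list \<Rightarrow> (real^'d \<Rightarrow> 'b::real_normed_vector) \<Rightarrow> real^'d \<Rightarrow> 'b" where
  "iter_partial [] f = f"
| "iter_partial (i # \<alpha>) f = partial_deriv i (iter_partial \<alpha> f)"

text \<open>Meant for open \<open>X\<close>; values of \<open>f\<close> outside \<open>X\<close> are then irrelevant.\<close>

definition smooth_on :: "(real^'d::finite) set \<Rightarrow> (real^'d \<Rightarrow> 'b::real_normed_vector) \<Rightarrow> bool" where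
  "smooth_on X f \<longleftrightarrow> (\<forall>\<alpha>. \<forall>x\<in>X. iter_partial \<alpha> f differentiable at x)"

text \<open>
  \<open>\<parallel>f\<parallel>\<^bsub>n,K\<^esub>\<close>. Inserting \<open>0\<close> only matters for \<open>K = {}\<close>, where the supremum is over the empty set.
\<close>

definition Cn_norm :: "nat \<Rightarrow> (real^'d::finite) set \<Rightarrow> (real^'d \<Rightarrow> 'b::real_normed_vector) \<Rightarrow> real" where
  "Cn_norm n K f = Sup (insert 0 {norm (iter_partial \<alpha> f x) | \<alpha> x. length \<alpha> \<le> n \<and> x \<in> K})"

section \<open>Locally convex spaces of complex-valued functions\<close>

text \<open>
  Both test functions and distributions are complex-valued functions, with pointwise vector
  space operations. A locally convex space is given by its topology, whose \<^const>\<open>topspace\<close> is the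
  underlying vector space.
\<close>

definition seminorm_on :: "('b \<Rightarrow> complex) set \<Rightarrow> (('b \<Rightarrow> complex) \<Rightarrow> real) \<Rightarrow> bool" where
  "seminorm_on E p \<longleftrightarrow>
     (\<forall>f\<in>E. 0 \<le> p f) \<and>
     (\<forall>f\<in>E. \<forall>g\<in>E. p (\<lambda>x. f x + g x) \<le> p f + p g) \<and>
     (\<forall>c. \<forall>f\<in>E. p (\<lambda>x. c * f x) = cmod c * p f)"

definition seminorm_topology ::
    "('b \<Rightarrow> complex) set \<Rightarrow> (('b \<Rightarrow> complex) \<Rightarrow> real) set \<Rightarrow> ('b \<Rightarrow> complex) topology" where
  "seminorm_topology E P = topology_generated_by
     (insert E {{g\<in>E. p (\<lambda>x. g x - f x) < e} | p f e. p \<in> P \<and> f \<in> E \<and> 0 < e})"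

definition continuous_seminorm :: "('b \<Rightarrow> complex) topology \<Rightarrow> (('b \<Rightarrow> complex) \<Rightarrow> real) \<Rightarrow> bool" where
  "continuous_seminorm T p \<longleftrightarrow> seminorm_on (topspace T) p \<and> continuous_map T euclideanreal p"

definition von_Neumann_bounded :: "('b \<Rightarrow> complex) topology \<Rightarrow> ('b \<Rightarrow> complex) set \<Rightarrow> bool" where
  "von_Neumann_bounded T B \<longleftrightarrow> B \<subseteq> topspace T \<and>
     (\<forall>U. openin T U \<and> (\<lambda>_. 0) \<in> U \<longrightarrow>
        (\<exists>r>0. \<forall>t\<ge>r. \<forall>f\<in>B. (\<lambda>x. f x / complex_of_real t) \<in> U))"

definition continuous_linear_operator ::
    "('b \<Rightarrow> complex) topology \<Rightarrow> (('b \<Rightarrow> complex) \<Rightarrow> ('b \<Rightarrow> complex)) \<Rightarrow> bool" where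
  "continuous_linear_operator T A \<longleftrightarrow>
     continuous_map T T A \<and>
     (\<forall>f\<in>topspace T. \<forall>g\<in>topspace T. A (\<lambda>x. f x + g x) = (\<lambda>x. A f x + A g x)) \<and>
     (\<forall>c. \<forall>f\<in>topspace T. A (\<lambda>x. c * f x) = (\<lambda>x. c * A f x))"

definition power_bounded ::
    "('b \<Rightarrow> complex) topology \<Rightarrow> (('b \<Rightarrow> complex) \<Rightarrow> ('b \<Rightarrow> complex)) \<Rightarrow> bool" where
  "power_bounded T A \<longleftrightarrow> continuous_linear_operator T A \<and>
     (\<forall>p. continuous_seminorm T p \<longrightarrow>
        (\<exists>q. continuous_seminorm T q \<and> (\<forall>m\<ge>1. \<forall>f\<in>topspace T. p ((A ^^ m) f) \<le> q f)))"

section \<open>Test functions and distributions\<close>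

text \<open>Test functions on \<open>X\<close> are represented by their extension by \<open>0\<close> to the whole space.\<close>

definition test_functions_in :: "(real^'d::finite) set \<Rightarrow> (real^'d \<Rightarrow> complex) set" where
  "test_functions_in K = {\<phi>. smooth_on UNIV \<phi> \<and> closure {x. \<phi> x \<noteq> 0} \<subseteq> K}"

definition test_functions :: "(real^'d::finite) set \<Rightarrow> (real^'d \<Rightarrow> complex) set" where
  "test_functions X = (\<Union>K\<in>{K. compact K \<and> K \<subseteq> X}. test_functions_in K)"

definition test_topology_in :: "(real^'d::finite) set \<Rightarrow> (real^'d \<Rightarrow> complex) topology" where
  "test_topology_in K = seminorm_topology (test_functions_in K) {Cn_norm n K | n. True}"

text \<open>
  The inductive limit topology, i.e. the finest locally convex topology for which all inclusions of
  \<^term>\<open>test_functions_in K\<close> are continuous: it is generated by all seminorms whose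
  restrictions to these subspaces are continuous.
\<close>

definition test_topology :: "(real^'d::finite) set \<Rightarrow> (real^'d \<Rightarrow> complex) topology" where
  "test_topology X = seminorm_topology (test_functions X)
     {p. seminorm_on (test_functions X) p \<and>
         (\<forall>K. compact K \<and> K \<subseteq> X \<longrightarrow> continuous_map (test_topology_in K) euclideanreal p)}"

text \<open>
  Distributions are total functions in HOL, so they are required to vanish outside the space of
  test functions in order for equality to be equality of functionals.
\<close>

definition distributions :: "(real^'d::finite) set \<Rightarrow> ((real^'d \<Rightarrow> complex) \<Rightarrow> complex) set" where
  "distributions X = {u.
     (\<forall>\<phi>\<in>test_functions X. \<forall>\<eta>\<in>test_functions X. u (\<lambda>x. \<phi> x + \<eta> x) = u \<phi> + u \<eta>) \<and>
     (\<forall>c. \<forall>\<phi>\<in>test_functions X. u (\<lambda>x. c * \<phi> x) = c * u \<phi>) \<and>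
     continuous_map (test_topology X) euclidean u \<and>
     (\<forall>\<phi>. \<phi> \<notin> test_functions X \<longrightarrow> u \<phi> = 0)}"

definition strong_dual_topology ::
    "(real^'d::finite) set \<Rightarrow> ((real^'d \<Rightarrow> complex) \<Rightarrow> complex) topology" where
  "strong_dual_topology X = seminorm_topology (distributions X)
     {(\<lambda>u. SUP \<phi>\<in>B. cmod (u \<phi>)) | B. von_Neumann_bounded (test_topology X) B \<and> B \<noteq> {}}"

section \<open>Composition operators\<close>

text \<open>The test function \<open>(\<phi> / \<bar>det J\<psi>\<bar>) \<circ> \<psi>\<^sup>-\<^sup>1\<close> on \<open>X\<close>, extended by \<open>0\<close>; for bijective \<open>\<psi> : X \<rightarrow> X\<close>.\<close>

definition composition_transpose ::
    "(real^'d::finite) set \<Rightarrow> (real^'d \<Rightarrow> real^'d) \<Rightarrow> (real^'d \<Rightarrow> complex) \<Rightarrow> real^'d \<Rightarrow> complex" where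
  "composition_transpose X \<psi> \<phi> y =
     (if y \<in> X
      then let x = inv_into X \<psi> y in \<phi> x / complex_of_real \<bar>det (jacobian \<psi> (at x))\<bar>
      else 0)"

text \<open>
  For bijective \<open>\<psi>\<close> the unique continuous linear extension of \<open>f \<mapsto> f \<circ> \<psi>\<close> to distributions is given
  by \<open>\<langle>C\<^sub>\<psi> u, \<phi>\<rangle> = \<langle>u, (\<phi> / \<bar>det J\<psi>\<bar>) \<circ> \<psi>\<^sup>-\<^sup>1\<rangle>\<close>.
\<close>

definition composition_operator ::
    "(real^'d::finite) set \<Rightarrow> (real^'d \<Rightarrow> real^'d) \<Rightarrow>
     ((real^'d \<Rightarrow> complex) \<Rightarrow> complex) \<Rightarrow> (real^'d \<Rightarrow> complex) \<Rightarrow> complex" where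
  "composition_operator X \<psi> u \<phi> =
     (if \<phi> \<in> test_functions X then u (composition_transpose X \<psi> \<phi>) else 0)"

definition stable_orbits :: "'a::topological_space set \<Rightarrow> ('a \<Rightarrow> 'a) \<Rightarrow> bool" where
  "stable_orbits X \<psi> \<longleftrightarrow>
     (\<forall>K. compact K \<and> K \<subseteq> X \<longrightarrow> (\<exists>L. compact L \<and> L \<subseteq> X \<and> (\<forall>m\<ge>1. (\<psi> ^^ m) ` K \<subseteq> L)))"

text \<open>
  Up to the identification of \<open>f\<close> with the functional \<open>\<phi> \<mapsto> \<integral>\<^sub>X f \<phi>\<close>, the operator extends
  \<open>f \<mapsto> f \<circ> \<psi>\<close> on continuous functions. (The change of variables formula of the library requires
  a well-ordered index type.)
\<close>

lemma composition_transpose_integral: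
  fixes X :: "(real^'d::{finite,wellorder}) set"
    and f \<phi> :: "real^'d::_ \<Rightarrow> complex" and \<psi> :: "real^'d::_ \<Rightarrow> real^'d::_"
  assumes "open X" "smooth_on X \<psi>" "bij_betw \<psi> X X"
    and det: "\<And>x. x \<in> X \<Longrightarrow> det (jacobian \<psi> (at x)) \<noteq> 0"
    and f: "continuous_on X f" and \<phi>: "\<phi> \<in> test_functions X"
  shows "integral X (\<lambda>y. f y * composition_transpose X \<psi> \<phi> y) = integral X (\<lambda>x. f (\<psi> x) * \<phi> x)"
proof -
  let ?F = "\<lambda>y. f y * composition_transpose X \<psi> \<phi> y"
  let ?G = "\<lambda>x. f (\<psi> x) * \<phi> x"
  have dpsi: "\<psi> differentiable at x" if "x \<in> X" for x
    using assms(2) that unfolding smooth_on_def by (metis iter_partial.simps(1))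
  define D where "D = (\<lambda>x. frechet_derivative \<psi> (at x))"
  have der: "(\<psi> has_derivative D x) (at x within X)" if "x \<in> X" for x
    using dpsi[OF that] frechet_derivative_works has_derivative_at_withinI D_def by metis
  have inj: "inj_on \<psi> X" and im: "\<psi> ` X = X"
    using assms(3) by (auto simp: bij_betw_def)
  have eq: "\<bar>det (matrix (D x))\<bar> *\<^sub>R ?F (\<psi> x) = ?G x" if "x \<in> X" for x
  proof -
    have "\<psi> x \<in> X" using im that by auto
    then show ?thesis
      using det[OF that] inj that
      by (simp add: composition_transpose_def Let_def inv_into_f_f jacobian_def D_def scaleR_conv_of_real)
  qed
  obtain K where K: "compact K" "K \<subseteq> X" "smooth_on UNIV \<phi>" "closure {x. \<phi> x \<noteq> 0} \<subseteq> K"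
    using \<phi> unfolding test_functions_def test_functions_in_def by auto
  have zero: "\<phi> x = 0" if "x \<notin> K" for x
    using K(4) closure_subset[of "{x. \<phi> x \<noteq> 0}"] that by auto
  have c\<phi>: "continuous_on UNIV \<phi>"
    using K(3) unfolding smooth_on_def
    by (metis UNIV_I continuous_at_imp_continuous_on differentiable_imp_continuous_within iter_partial.simps(1))
  have c\<psi>: "continuous_on X \<psi>"
    using dpsi by (meson continuous_at_imp_continuous_on differentiable_imp_continuous_within)
  have cG: "continuous_on K ?G"
    by (intro continuous_intros continuous_on_compose2[OF f] continuous_on_subset[OF c\<psi>]
          continuous_on_subset[OF c\<phi>]) (use K im in auto)
  have absG: "h \<circ> ?G absolutely_integrable_on X" if h: "linear h" for h :: "complex \<Rightarrow> real"
  proof -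
    have "continuous_on K (h \<circ> ?G)"
      by (intro continuous_on_compose cG linear_continuous_on linear_conv_bounded_linear[THEN iffD1] h)
    moreover have "K \<in> sets borel" using K(1) by (simp add: borel_compact)
    ultimately have 1: "h \<circ> ?G absolutely_integrable_on K"
      using borel_integrable_compact[of K "h \<circ> ?G"] K(1)
      unfolding set_integrable_def
      by (intro integrable_completion[THEN iffD2] borel_measurable_continuous_on_indicator) auto
    have "(h \<circ> ?G) x = 0" if "x \<notin> K" for x
      using zero[OF that] h by (simp add: linear_0)
    then have "{x \<in> K - X. (h \<circ> ?G) x \<noteq> 0} = {}" "{x \<in> X - K. (h \<circ> ?G) x \<noteq> 0} = {}"
      using K(2) by auto
    then show ?thesis
      using 1 absolutely_integrable_spike_set_eq[of K X "h \<circ> ?G"] by (metis negligible_empty)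
  qed
  have key: "h \<circ> ?F absolutely_integrable_on X \<and> integral X (h \<circ> ?F) = integral X (h \<circ> ?G)"
    if h: "linear h" for h :: "complex \<Rightarrow> real"
  proof -
    let ?v = "\<lambda>y. vec (h (?F y)) :: real^1"
    have 1: "\<bar>det (matrix (D x))\<bar> *\<^sub>R ?v (\<psi> x) = vec ((h \<circ> ?G) x)" if "x \<in> X" for x
    proof -
      have "(h \<circ> ?G) x = \<bar>det (matrix (D x))\<bar> * h (?F (\<psi> x))"
        using eq[OF that, symmetric] h by (simp add: linear_scale)
      then show ?thesis by (simp add: vec_eq_iff)
    qed
    have X: "X \<in> sets lebesgue" using assms(1) by (simp add: sets_completionI_sets)
    have "(\<lambda>x. vec ((h \<circ> ?G) x) :: real^1) absolutely_integrable_on X"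
      using absG[OF h] by (simp add: absolutely_integrable_on_1_iff o_def)
    then have a: "(\<lambda>x. \<bar>det (matrix (D x))\<bar> *\<^sub>R ?v (\<psi> x)) absolutely_integrable_on X"
      using 1 by (subst set_integrable_cong[OF refl refl, of X]) auto
    have b: "integral X (\<lambda>x. \<bar>det (matrix (D x))\<bar> *\<^sub>R ?v (\<psi> x)) = integral X (\<lambda>x. vec ((h \<circ> ?G) x))"
      by (rule integral_cong) (rule 1)
    have "?v absolutely_integrable_on \<psi> ` X \<and> integral (\<psi> ` X) ?v = integral X (\<lambda>x. vec ((h \<circ> ?G) x))"
      using has_absolute_integral_change_of_variables[OF X der inj, of ?v] a b by blast
    then show ?thesis
      unfolding im by (simp add: absolutely_integrable_on_1_iff integral_on_1_eq o_def)
  qed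
  have sub: "integral X (h \<circ> ?F) = h (integral X ?F)" "integral X (h \<circ> ?G) = h (integral X ?G)"
    if h: "bounded_linear h" and F: "?F integrable_on X" and G: "?G integrable_on X"
    for h :: "complex \<Rightarrow> real"
    using integral_linear[OF F h] integral_linear[OF G h] by auto
  have int: "H integrable_on X"
    if "Re \<circ> H integrable_on X" "Im \<circ> H integrable_on X" for H :: "real^'d::_ \<Rightarrow> complex"
    using that by (subst integrable_componentwise_iff) (auto simp: Basis_complex_def inner_complex_def o_def)
  have lin: "linear Re" "linear Im"
    using bounded_linear_Re bounded_linear_Im bounded_linear.linear by blast+
  have "?F integrable_on X" "?G integrable_on X"
    using key[OF lin(1)] key[OF lin(2)] absG[OF lin(1)] absG[OF lin(2)]
    by (auto intro!: int simp: absolutely_integrable_on_def)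
  then show ?thesis
    using key[OF lin(1)] key[OF lin(2)] sub[OF bounded_linear_Re] sub[OF bounded_linear_Im]
    by (simp add: complex_eq_iff)
qed

end

theory Submission
  imports Defs "HOL-Complex_Analysis.Great_Picard"
begin

text \<open>
  Write \<open>T\<close> for the operator \<open>\<phi> \<mapsto> (\<phi> / \<bar>det J\<psi>\<bar>) \<circ> \<psi>\<^sup>-\<^sup>1\<close> on test functions, so that \<open>C\<^sub>\<psi>\<close> is the transpose
  of \<open>T\<close>, and \<open>(T\<^sup>m \<phi>)(\<psi>\<^sup>m x) = \<phi>(x) w\<^sub>m(x)\<close> with \<open>w\<^sub>m = 1 / \<bar>det J\<psi>\<^sup>m\<bar>\<close>.

  Power boundedness of the transpose on the strong dual says that \<open>T\<close> maps bounded sets to bounded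
  sets uniformly in \<open>m\<close> (\<open>power_bounded_transpose_on_iff\<close>). This uses the derivatives of Dirac
  functionals: they see every value \<open>\<partial>\<^sup>\<alpha>(T\<^sup>m \<phi>)(x)\<close>, and a bounded set of test functions has a
  common compact support and bounded \<open>C\<^sup>n\<close> norms (\<open>von_Neumann_bounded_test_iff\<close>).

  That (ii) implies (i) is then a computation (\<open>orbit_bounded_if_inverse_iterates_bounded\<close>): by the chain
  rule \<open>T\<^sup>m \<phi> = (\<phi> \<circ> \<psi>\<^sup>-\<^sup>m) \<bar>det J\<psi>\<^sup>-\<^sup>m\<bar>\<close>, where only the values of \<open>\<psi>\<^sup>-\<^sup>m\<close> on \<open>\<psi>\<^sup>m(K)\<close> matter if \<open>\<phi>\<close>
  is supported in \<open>K\<close>.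

  Conversely, let all orbits of \<open>T\<close> be bounded. Cutoff functions show that \<open>\<psi>\<close> has stable orbits and
  that \<open>w\<^sub>m\<close> is bounded above on compact sets, uniformly in \<open>m\<close>. With a cutoff \<open>b\<close> for \<open>K\<close> one has
  \<open>(\<psi>\<^sup>-\<^sup>m)\<^sub>c = T\<^sup>m(b x\<^sub>c) / T\<^sup>m b\<close> on \<open>\<psi>\<^sup>m(K)\<close>, and numerator and denominator have bounded derivatives. What
  remains is a lower bound for the denominator, that is, for \<open>w\<^sub>m\<close> on \<open>K\<close>. It comes from recurrence.
  By Arzela--Ascoli the orbit of \<open>\<phi>\<close> contains \<open>T\<^sup>a \<phi>\<close> and \<open>T\<^sup>a\<^sup>+\<^sup>r \<phi>\<close> which are uniformly close, with \<open>r\<close> as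
  large as desired. The operator \<open>T\<close> preserves \<open>L\<^sup>1\<close> norms by the change of variables formula, so
  \<open>\<phi> - T\<^sup>r \<phi>\<close> is small in \<open>L\<^sup>1\<close>; being Lipschitz with a fixed constant, it is uniformly small
  (\<open>recurrence\<close>). For a cutoff function \<open>\<phi>\<close> of a compact set \<open>L\<close> containing all \<open>\<psi>\<^sup>m(K)\<close>, this bounds
  \<open>w\<^sub>r\<close> below on \<open>K\<close> for arbitrarily large \<open>r\<close>, and the cocycle identity
  \<open>w\<^sub>r(x) = w\<^sub>m(x) w\<^sub>r\<^sub>-\<^sub>m(\<psi>\<^sup>m x)\<close> together with the upper bound on \<open>L\<close> passes it on to every \<open>m\<close>
  (\<open>cocycle_lower\<close>).
\<close>

section \<open>Uniform bounds for families of smooth functions\<close>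

lemma iter_partial_snoc: "iter_partial (\<alpha> @ [j]) f = iter_partial \<alpha> (partial_deriv j f)"
  by (induction \<alpha>) auto

lemma iter_partial_cong:
  assumes "open S" and eq: "\<And>x. x \<in> S \<Longrightarrow> f x = g x" and "x \<in> S"
  shows "iter_partial \<alpha> f x = iter_partial \<alpha> g x"
  using \<open>x \<in> S\<close>
proof (induction \<alpha> arbitrary: x)
  case Nil
  then show ?case using eq by simp
next
  case (Cons i \<alpha>)
  have "(iter_partial \<alpha> f has_derivative h) (at x) \<longleftrightarrow> (iter_partial \<alpha> g has_derivative h) (at x)" for h
    using has_derivative_transform_within_open[OF _ \<open>open S\<close> Cons.prems] Cons.IH by metis
  then show ?case
    by (simp add: partial_deriv_def frechet_derivative_def)
qed

text \<open>
  Smoothness and uniform \<open>C\<^sup>n\<close> bounds obey the same rules of calculus, so one notion serves for both: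
  for empty sets \<open>K i\<close> it only asserts that the derivatives of order at most \<open>n\<close> are differentiable on \<open>U i\<close>.
  The sets depend on the index because \<open>\<psi>\<^sup>-\<^sup>m\<close> is controlled on the moving set \<open>\<psi>\<^sup>m(K)\<close>.
\<close>

definition bounded_smooth ::
    "nat \<Rightarrow> ('i \<Rightarrow> (real^'d::finite) set) \<Rightarrow> ('i \<Rightarrow> (real^'d) set) \<Rightarrow>
     ('i \<Rightarrow> real^'d \<Rightarrow> 'b::real_normed_vector) \<Rightarrow> bool" where
  "bounded_smooth n U K f \<longleftrightarrow> (\<forall>\<alpha>. length \<alpha> \<le> n \<longrightarrow>
     (\<forall>i. \<forall>x\<in>U i. iter_partial \<alpha> (f i) differentiable at x) \<and>
     (\<exists>C. \<forall>i. \<forall>x\<in>K i. norm (iter_partial \<alpha> (f i) x) \<le> C))"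

lemma smooth_on_iff_bounded_smooth:
  "smooth_on S f \<longleftrightarrow> (\<forall>n. bounded_smooth n (\<lambda>_::unit. S) (\<lambda>_. {}) (\<lambda>_. f))"
  unfolding smooth_on_def bounded_smooth_def by auto

lemma bounded_smooth_0:
  "bounded_smooth 0 U K f \<longleftrightarrow>
     (\<forall>i. \<forall>x\<in>U i. f i differentiable at x) \<and> (\<exists>C. \<forall>i. \<forall>x\<in>K i. norm (f i x) \<le> C)"
  unfolding bounded_smooth_def by simp

lemma bounded_smooth_mono:
  assumes "bounded_smooth n U K f" "m \<le> n" "\<And>i. K' i \<subseteq> K i"
  shows "bounded_smooth m U K' f"
  using assms unfolding bounded_smooth_def by (meson le_trans subsetD)

lemma bounded_smooth_bound:
  assumes "bounded_smooth n U K f"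
  obtains C where "\<And>i x. x \<in> K i \<Longrightarrow> norm (f i x) \<le> C"
  using bounded_smooth_mono[OF assms, of 0 K] unfolding bounded_smooth_0 by blast

text \<open>
  A word of directions is split at its inner end, so that the first partial derivatives form families
  of lower order. The basic rules of calculus below are proved by induction on \<open>n\<close> along this equivalence.
\<close>

lemma bounded_smooth_Suc:
  "bounded_smooth (Suc n) U K f \<longleftrightarrow>
     bounded_smooth 0 U K f \<and> (\<forall>j. bounded_smooth n U K (\<lambda>i. partial_deriv j (f i)))"
    (is "?l \<longleftrightarrow> ?r")
proof
  assume l: ?l
  have "bounded_smooth n U K (\<lambda>i. partial_deriv j (f i))" for j
    unfolding bounded_smooth_def
  proof (intro allI impI)
    fix \<alpha> :: "'b list"
    assume "length \<alpha> \<le> n"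
    then show "(\<forall>i. \<forall>x\<in>U i. iter_partial \<alpha> (partial_deriv j (f i)) differentiable at x) \<and>
         (\<exists>C. \<forall>i. \<forall>x\<in>K i. norm (iter_partial \<alpha> (partial_deriv j (f i)) x) \<le> C)"
      using l unfolding bounded_smooth_def
      by (metis iter_partial_snoc length_append_singleton Suc_le_mono)
  qed
  with l show ?r using bounded_smooth_mono[of "Suc n" U K f 0 K] by simp
next
  assume r: ?r
  show ?l
    unfolding bounded_smooth_def
  proof (intro allI impI)
    fix \<alpha> :: "'b list"
    assume len: "length \<alpha> \<le> Suc n"
    show "(\<forall>i. \<forall>x\<in>U i. iter_partial \<alpha> (f i) differentiable at x) \<and>
         (\<exists>C. \<forall>i. \<forall>x\<in>K i. norm (iter_partial \<alpha> (f i) x) \<le> C)"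
    proof (cases \<alpha> rule: rev_cases)
      case Nil
      then show ?thesis using r by (simp add: bounded_smooth_0)
    next
      case (snoc \<beta> j)
      with len r show ?thesis
        unfolding bounded_smooth_def by (simp add: iter_partial_snoc)
    qed
  qed
qed

lemma bounded_smooth_SucD:
  assumes "bounded_smooth (Suc n) U K f"
  shows "bounded_smooth n U K f" "bounded_smooth n U K (\<lambda>i. partial_deriv j (f i))"
    "x \<in> U i \<Longrightarrow> f i differentiable at x"
  using assms bounded_smooth_mono[OF assms, of n K] by (auto simp: bounded_smooth_Suc bounded_smooth_0)

lemma frechet_derivative_eq_sum_partial_deriv:
  assumes "f differentiable at x"
  shows "frechet_derivative f (at x) v = (\<Sum>i\<in>UNIV. (v $ i) *\<^sub>R partial_deriv i f x)"
proof -
  interpret linear "frechet_derivative f (at x)"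
    using assms by (rule linear_frechet_derivative)
  have "v = (\<Sum>i\<in>UNIV. (v $ i) *\<^sub>R axis i 1)"
    using basis_expansion[of v] by (simp add: scalar_mult_eq_scaleR)
  then have "frechet_derivative f (at x) v = frechet_derivative f (at x) (\<Sum>i\<in>UNIV. (v $ i) *\<^sub>R axis i 1)"
    by simp
  then show ?thesis
    by (simp add: sum scale partial_deriv_def)
qed

lemma partial_derivI:
  assumes "(f has_derivative f') (at x)"
  shows "partial_deriv j f x = f' (axis j 1)"
  using frechet_derivative_at[OF assms] by (simp add: partial_deriv_def)

lemma iter_partial_linear:
  assumes h: "bounded_linear h" and "open S"
    and d: "\<And>\<beta> y. length \<beta> < length \<alpha> \<Longrightarrow> y \<in> S \<Longrightarrow> iter_partial \<beta> f differentiable at y"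
    and "x \<in> S"
  shows "iter_partial \<alpha> (\<lambda>x. h (f x)) x = h (iter_partial \<alpha> f x)"
  using d \<open>x \<in> S\<close>
proof (induction \<alpha> arbitrary: x)
  case (Cons j \<beta>)
  have "(iter_partial \<beta> f has_derivative frechet_derivative (iter_partial \<beta> f) (at x)) (at x)"
    using Cons.prems by (simp add: frechet_derivative_works)
  from bounded_linear.has_derivative[OF h this]
  have "(iter_partial \<beta> (\<lambda>x. h (f x)) has_derivative (\<lambda>v. h (frechet_derivative (iter_partial \<beta> f) (at x) v))) (at x)"
    by (rule has_derivative_transform_within_open[OF _ \<open>open S\<close> Cons.prems(2)]) (use Cons in simp)
  then show ?case
    by (simp add: partial_derivI) (simp add: partial_deriv_def)
qed simp

lemma iter_partial_add:
  assumes "open S"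
    and d: "\<And>\<beta> y. length \<beta> < length \<alpha> \<Longrightarrow> y \<in> S \<Longrightarrow> iter_partial \<beta> f differentiable at y"
      "\<And>\<beta> y. length \<beta> < length \<alpha> \<Longrightarrow> y \<in> S \<Longrightarrow> iter_partial \<beta> g differentiable at y"
    and "x \<in> S"
  shows "iter_partial \<alpha> (\<lambda>x. f x + g x) x = iter_partial \<alpha> f x + iter_partial \<alpha> g x"
  using d \<open>x \<in> S\<close>
proof (induction \<alpha> arbitrary: x)
  case (Cons j \<beta>)
  have "(iter_partial \<beta> f has_derivative frechet_derivative (iter_partial \<beta> f) (at x)) (at x)"
    "(iter_partial \<beta> g has_derivative frechet_derivative (iter_partial \<beta> g) (at x)) (at x)"
    using Cons.prems by (simp_all add: frechet_derivative_works)
  from has_derivative_add[OF this]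
  have "(iter_partial \<beta> (\<lambda>x. f x + g x) has_derivative
      (\<lambda>v. frechet_derivative (iter_partial \<beta> f) (at x) v + frechet_derivative (iter_partial \<beta> g) (at x) v)) (at x)"
    by (rule has_derivative_transform_within_open[OF _ \<open>open S\<close> Cons.prems(3)]) (use Cons in simp)
  then show ?case
    by (simp add: partial_derivI) (simp add: partial_deriv_def)
qed simp

context
  fixes U K :: "'i \<Rightarrow> (real^'d::finite) set"
  assumes open_U: "\<And>i. open (U i)" and K_sub: "\<And>i. K i \<subseteq> U i"
begin

lemma bounded_smooth_cong:
  assumes eq: "\<And>i x. x \<in> U i \<Longrightarrow> f i x = g i x"
  shows "bounded_smooth n U K f \<longleftrightarrow> bounded_smooth n U K g"
proof -
  have "iter_partial \<alpha> (f i) x = iter_partial \<alpha> (g i) x" if "x \<in> U i" for \<alpha> i x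
    by (rule iter_partial_cong[OF open_U eq that])
  moreover from this have "iter_partial \<alpha> (f i) differentiable at x \<longleftrightarrow> iter_partial \<alpha> (g i) differentiable at x"
    if "x \<in> U i" for \<alpha> i x
    using has_derivative_transform_within_open[OF _ open_U that, of "iter_partial \<alpha> (f i)"]
      has_derivative_transform_within_open[OF _ open_U that, of "iter_partial \<alpha> (g i)"]
    unfolding differentiable_def by metis
  moreover have "x \<in> U i" if "x \<in> K i" for x i using K_sub that by auto
  ultimately show ?thesis
    unfolding bounded_smooth_def by metis
qed

lemma bounded_smooth_Suc_cong:
  assumes "bounded_smooth m U K f"
    and "\<And>j. bounded_smooth n U K (g j)"
    and "\<And>i j x. x \<in> U i \<Longrightarrow> partial_deriv j (f i) x = g j i x"
  shows "bounded_smooth (Suc n) U K f"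
  using assms bounded_smooth_cong[of "\<lambda>i. partial_deriv j (f i)" "g j" n for j]
    bounded_smooth_mono[OF assms(1), of 0 K]
  by (simp add: bounded_smooth_Suc)

lemma bounded_smooth_const: "bounded_smooth n U K (\<lambda>i x. c)"
proof (induction n arbitrary: c)
  case 0
  show ?case by (auto simp: bounded_smooth_0)
next
  case (Suc n)
  show ?case
    by (rule bounded_smooth_Suc_cong[where m = 0, OF _ Suc.IH[of 0]])
       (auto simp: bounded_smooth_0 partial_deriv_def)
qed

lemma bounded_smooth_linear:
  assumes h: "bounded_linear h" and "bounded_smooth n U K f"
  shows "bounded_smooth n U K (\<lambda>i x. h (f i x))"
  using assms(2)
proof (induction n arbitrary: f)
  case 0
  then obtain C where C: "\<And>i x. x \<in> K i \<Longrightarrow> norm (f i x) \<le> C" by (metis bounded_smooth_bound)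
  obtain B where B: "B \<ge> 0" "\<And>x. norm (h x) \<le> norm x * B"
    using bounded_linear.nonneg_bounded[OF h] by blast
  have "norm (h (f i x)) \<le> C * B" if "x \<in> K i" for i x
    using C[OF that] B by (meson mult_right_mono order_trans)
  moreover have "(\<lambda>x. h (f i x)) differentiable at x" if "x \<in> U i" for i x
    using 0 that bounded_linear.has_derivative[OF h] unfolding bounded_smooth_0 differentiable_def by blast
  ultimately show ?case by (auto simp: bounded_smooth_0)
next
  case (Suc n)
  note f = bounded_smooth_SucD[OF Suc.prems]
  show ?case
  proof (rule bounded_smooth_Suc_cong[OF Suc.IH[OF f(1)] Suc.IH[OF f(2)]])
    show "partial_deriv j (\<lambda>x. h (f i x)) x = h (partial_deriv j (f i) x)" if "x \<in> U i" for i j x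
      using partial_derivI[OF bounded_linear.has_derivative[OF h f(3)[OF that, unfolded frechet_derivative_works]]]
      by (simp add: partial_deriv_def)
  qed
qed

lemma bounded_smooth_add:
  assumes "bounded_smooth n U K f" and "bounded_smooth n U K g"
  shows "bounded_smooth n U K (\<lambda>i x. f i x + g i x)"
  using assms
proof (induction n arbitrary: f g)
  case 0
  then obtain C D where "\<And>i x. x \<in> K i \<Longrightarrow> norm (f i x) \<le> C" "\<And>i x. x \<in> K i \<Longrightarrow> norm (g i x) \<le> D"
    by (metis bounded_smooth_bound)
  then have "norm (f i x + g i x) \<le> C + D" if "x \<in> K i" for i x
    using that by (meson norm_triangle_mono)
  with 0 show ?case by (auto simp: bounded_smooth_0)
next
  case (Suc n)
  note f = bounded_smooth_SucD[OF Suc.prems(1)] and g = bounded_smooth_SucD[OF Suc.prems(2)]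
  show ?case
  proof (rule bounded_smooth_Suc_cong[OF Suc.IH[OF f(1) g(1)] Suc.IH[OF f(2) g(2)]])
    show "partial_deriv j (\<lambda>x. f i x + g i x) x = partial_deriv j (f i) x + partial_deriv j (g i) x"
      if "x \<in> U i" for i j x
      using partial_derivI[OF has_derivative_add[OF f(3)[OF that, unfolded frechet_derivative_works]
            g(3)[OF that, unfolded frechet_derivative_works]]] by (simp add: partial_deriv_def)
  qed
qed

lemma bounded_smooth_sum:
  assumes "\<And>c. c \<in> A \<Longrightarrow> bounded_smooth n U K (\<lambda>i. f c i)"
  shows "bounded_smooth n U K (\<lambda>i x. \<Sum>c\<in>A. f c i x)"
  using assms
  by (induction A rule: infinite_finite_induct) (auto intro: bounded_smooth_const bounded_smooth_add)

lemma bounded_smooth_bilinear: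
  assumes h: "bounded_bilinear h" and "bounded_smooth n U K f" "bounded_smooth n U K g"
  shows "bounded_smooth n U K (\<lambda>i x. h (f i x) (g i x))"
  using assms(2,3)
proof (induction n arbitrary: f g)
  case 0
  then obtain C D where C: "\<And>i x. x \<in> K i \<Longrightarrow> norm (f i x) \<le> C" and D: "\<And>i x. x \<in> K i \<Longrightarrow> norm (g i x) \<le> D"
    by (metis bounded_smooth_bound)
  obtain B where B: "B \<ge> 0" "\<And>x y. norm (h x y) \<le> norm x * norm y * B"
    using bounded_bilinear.nonneg_bounded[OF h] by blast
  have "norm (h (f i x) (g i x)) \<le> C * D * B" if "x \<in> K i" for i x
  proof -
    have "norm (f i x) * norm (g i x) \<le> C * D"
      using C[OF that] D[OF that] by (smt (verit) mult_mono norm_ge_zero)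
    then show ?thesis using B by (meson mult_right_mono order_trans)
  qed
  moreover have "(\<lambda>x. h (f i x) (g i x)) differentiable at x" if "x \<in> U i" for i x
    using 0 that bounded_bilinear.FDERIV[OF h] unfolding bounded_smooth_0 differentiable_def by blast
  ultimately show ?case by (auto simp: bounded_smooth_0)
next
  case (Suc n)
  note f = bounded_smooth_SucD[OF Suc.prems(1)] and g = bounded_smooth_SucD[OF Suc.prems(2)]
  show ?case
  proof (rule bounded_smooth_Suc_cong[OF Suc.IH[OF f(1) g(1)]
        bounded_smooth_add[OF Suc.IH[OF f(1) g(2)] Suc.IH[OF f(2) g(1)]]])
    show "partial_deriv j (\<lambda>x. h (f i x) (g i x)) x = h (f i x) (partial_deriv j (g i) x) + h (partial_deriv j (f i) x) (g i x)"
      if "x \<in> U i" for i j x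
      using partial_derivI[OF bounded_bilinear.FDERIV[OF h f(3)[OF that, unfolded frechet_derivative_works]
            g(3)[OF that, unfolded frechet_derivative_works]]] by (simp add: partial_deriv_def)
  qed
qed

lemmas bounded_smooth_mult = bounded_smooth_bilinear[OF bounded_bilinear_mult]
lemmas bounded_smooth_scaleR = bounded_smooth_bilinear[OF bounded_bilinear_scaleR]
lemmas bounded_smooth_vec_nth = bounded_smooth_linear[OF bounded_linear_vec_nth]

lemma bounded_smooth_vec_iff:
  fixes f :: "'i \<Rightarrow> real^'d \<Rightarrow> real^'e"
  shows "bounded_smooth n U K f \<longleftrightarrow> (\<forall>c. bounded_smooth n U K (\<lambda>i x. f i x $ c))" (is "?l \<longleftrightarrow> ?r")
proof
  assume ?r
  then have "bounded_smooth n U K (\<lambda>i x. \<Sum>c\<in>UNIV. (f i x $ c) *\<^sub>R (axis c 1 :: real^'e))"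
    by (intro bounded_smooth_sum bounded_smooth_scaleR bounded_smooth_const) simp
  moreover have "(\<Sum>c\<in>UNIV. (f i x $ c) *\<^sub>R (axis c 1 :: real^'e)) = f i x" for i x
    using basis_expansion[of "f i x"] by (simp add: scalar_mult_eq_scaleR)
  ultimately show ?l by simp
qed (simp add: bounded_smooth_vec_nth)

lemma bounded_smooth_prod:
  fixes f :: "'c \<Rightarrow> 'i \<Rightarrow> real^'d \<Rightarrow> 'b::real_normed_field"
  assumes "\<And>c. c \<in> A \<Longrightarrow> bounded_smooth n U K (\<lambda>i. f c i)"
  shows "bounded_smooth n U K (\<lambda>i x. \<Prod>c\<in>A. f c i x)"
  using assms
  by (induction A rule: infinite_finite_induct) (auto intro: bounded_smooth_const bounded_smooth_mult)

lemma bounded_smooth_det: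
  fixes M :: "'i \<Rightarrow> real^'d \<Rightarrow> real^'e^'e"
  assumes "\<And>a b. bounded_smooth n U K (\<lambda>i x. M i x $ a $ b)"
  shows "bounded_smooth n U K (\<lambda>i x. det (M i x))"
  unfolding det_def using assms
  by (intro bounded_smooth_sum bounded_smooth_mult bounded_smooth_prod bounded_smooth_const)

lemma bounded_smooth_inverse:
  fixes f :: "'i \<Rightarrow> real^'d \<Rightarrow> 'b::real_normed_field"
  assumes "bounded_smooth n U K f" and nz: "\<And>i x. x \<in> U i \<Longrightarrow> f i x \<noteq> 0"
    and "e > 0" and lower: "\<And>i x. x \<in> K i \<Longrightarrow> norm (f i x) \<ge> e"
  shows "bounded_smooth n U K (\<lambda>i x. inverse (f i x))"
  using assms(1)
proof (induction n)
  case 0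
  have "norm (inverse (f i x)) \<le> inverse e" if "x \<in> K i" for i x
    using lower[OF that] \<open>e > 0\<close> by (simp add: norm_inverse le_imp_inverse_le)
  moreover have "(\<lambda>x. inverse (f i x)) differentiable at x" if "x \<in> U i" for i x
    using 0 nz that by (simp add: bounded_smooth_0)
  ultimately show ?case unfolding bounded_smooth_0 by blast
next
  case (Suc n)
  note f = bounded_smooth_SucD[OF Suc.prems]
  note inv = Suc.IH[OF f(1)]
  have "bounded_smooth n U K (\<lambda>i x. (-1) * (inverse (f i x) * partial_deriv j (f i) x * inverse (f i x)))" for j
    by (intro bounded_smooth_mult bounded_smooth_const inv f(2))
  with inv show ?case
  proof (rule bounded_smooth_Suc_cong)
    show "partial_deriv j (\<lambda>x. inverse (f i x)) x = (-1) * (inverse (f i x) * partial_deriv j (f i) x * inverse (f i x))"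
      if "x \<in> U i" for i j x
      using partial_derivI[OF Deriv.has_derivative_inverse[OF nz[OF that] f(3)[OF that, unfolded frechet_derivative_works]]]
      by (simp add: partial_deriv_def)
  qed
qed

text \<open>
  By continuity the sign is locally constant, so that its derivatives vanish.
\<close>

lemma bounded_smooth_sgn:
  fixes f :: "'i \<Rightarrow> real^'d \<Rightarrow> real"
  assumes cont: "\<And>i. continuous_on (U i) (f i)" and nz: "\<And>i x. x \<in> U i \<Longrightarrow> f i x \<noteq> 0"
  shows "bounded_smooth n U K (\<lambda>i x. sgn (f i x))"
proof -
  have der: "((\<lambda>x. sgn (f i x)) has_derivative (\<lambda>_. 0)) (at x)" if x: "x \<in> U i" for i x
  proof (rule has_derivative_transform_within_open[OF has_derivative_const])
    show "open {y \<in> U i. 0 < f i y * f i x}"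
      using continuous_open_preimage[OF continuous_on_mult_right[OF cont] open_U open_greaterThan, of i "f i x" 0]
      by (simp add: vimage_def Int_def)
    show "x \<in> {y \<in> U i. 0 < f i y * f i x}" using x nz[OF x] by (simp add: not_sum_squares_lt_zero less_le)
    show "sgn (f i x) = sgn (f i y)" if "y \<in> {y \<in> U i. 0 < f i y * f i x}" for y
      using that by (auto simp: zero_less_mult_iff)
  qed
  have 0: "bounded_smooth 0 U K (\<lambda>i x. sgn (f i x))"
    unfolding bounded_smooth_0
  proof (intro conjI allI ballI exI[of _ 1])
    show "(\<lambda>x. sgn (f i x)) differentiable at x" if "x \<in> U i" for i x
      using der[OF that] by (rule differentiableI)
  qed (simp add: sgn_if)
  show ?thesis
  proof (cases n)
    case (Suc m)
    show ?thesis
      unfolding Suc by (rule bounded_smooth_Suc_cong[OF 0 bounded_smooth_const[of m 0] partial_derivI[OF der]])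
  qed (use 0 in simp)
qed

lemma bounded_smooth_abs:
  fixes f :: "'i \<Rightarrow> real^'d \<Rightarrow> real"
  assumes f: "bounded_smooth n U K f" and nz: "\<And>i x. x \<in> U i \<Longrightarrow> f i x \<noteq> 0"
  shows "bounded_smooth n U K (\<lambda>i x. \<bar>f i x\<bar>)"
proof -
  have "f i differentiable at x" if "x \<in> U i" for i x
    using bounded_smooth_mono[OF f, of 0 K] that by (simp add: bounded_smooth_0)
  then have "continuous_on (U i) (f i)" for i
    by (meson continuous_at_imp_continuous_on differentiable_imp_continuous_within)
  from bounded_smooth_mult[OF f bounded_smooth_sgn[OF this nz]]
  show ?thesis by (simp add: abs_sgn)
qed

text \<open>
  Since \<open>\<partial>\<^sub>j(f \<circ> g) = \<Sum>\<^sub>c \<partial>\<^sub>jg\<^sub>c (\<partial>\<^sub>cf \<circ> g)\<close>, the induction hypothesis for the derivatives of \<open>f\<close> and the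
  product rule replace the formula of Faa di Bruno.
\<close>

lemma bounded_smooth_compose:
  fixes g :: "'i \<Rightarrow> real^'d \<Rightarrow> real^'e" and f :: "'i \<Rightarrow> real^'e \<Rightarrow> 'b::real_normed_vector"
  assumes "bounded_smooth n V L f" "bounded_smooth n U K g"
    and U: "\<And>i x. x \<in> U i \<Longrightarrow> g i x \<in> V i" and K: "\<And>i x. x \<in> K i \<Longrightarrow> g i x \<in> L i"
  shows "bounded_smooth n U K (\<lambda>i x. f i (g i x))"
  using assms(1,2)
proof (induction n arbitrary: f)
  case 0
  then have "(\<lambda>x. f i (g i x)) differentiable at x" if "x \<in> U i" for i x
    using that U differentiable_chain_at[of "g i" x "f i"] by (auto simp: bounded_smooth_0 o_def)
  with 0 K show ?case
    by (auto simp: bounded_smooth_0) metis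
next
  case (Suc n)
  note f = bounded_smooth_SucD[OF Suc.prems(1)] and g = bounded_smooth_SucD[OF Suc.prems(2)]
  have "bounded_smooth n U K (\<lambda>i x. \<Sum>c\<in>UNIV. (partial_deriv j (g i) x $ c) *\<^sub>R partial_deriv c (f i) (g i x))" for j
    by (intro bounded_smooth_sum bounded_smooth_scaleR[OF bounded_smooth_vec_nth[OF g(2)] Suc.IH[OF f(2) g(1)]])
  with Suc.IH[OF f(1) g(1)] show ?case
  proof (rule bounded_smooth_Suc_cong)
    show "partial_deriv j (\<lambda>x. f i (g i x)) x = (\<Sum>c\<in>UNIV. (partial_deriv j (g i) x $ c) *\<^sub>R partial_deriv c (f i) (g i x))"
      if "x \<in> U i" for i j x
    proof -
      have df: "f i differentiable at (g i x)" and dg: "g i differentiable at x"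
        using f(3) g(3) that U by blast+
      have "partial_deriv j (\<lambda>x. f i (g i x)) x = frechet_derivative (f i) (at (g i x)) (partial_deriv j (g i) x)"
        using partial_derivI[OF has_derivative_compose[OF dg[unfolded frechet_derivative_works]
              df[unfolded frechet_derivative_works]]] by (simp add: partial_deriv_def)
      then show ?thesis by (simp add: frechet_derivative_eq_sum_partial_deriv[OF df])
    qed
  qed
qed

end

section \<open>Cutoff functions\<close>

lemma smooth_on_subset: "smooth_on S f \<Longrightarrow> T \<subseteq> S \<Longrightarrow> smooth_on T f"
  unfolding smooth_on_def by blast

lemma smooth_on_Un: "smooth_on S f \<Longrightarrow> smooth_on T f \<Longrightarrow> smooth_on (S \<union> T) f"
  unfolding smooth_on_def by blast

lemma smooth_on_imp_continuous_iter_partial: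
  "smooth_on S f \<Longrightarrow> continuous_on S (iter_partial \<alpha> f)"
  unfolding smooth_on_def
  by (meson continuous_at_imp_continuous_on differentiable_imp_continuous_within)

lemma smooth_on_imp_continuous_on: "smooth_on S f \<Longrightarrow> continuous_on S f"
  using smooth_on_imp_continuous_iter_partial[of S f "[]"] by simp

lemma smooth_on_imp_differentiable: "smooth_on S f \<Longrightarrow> x \<in> S \<Longrightarrow> f differentiable at x"
  unfolding smooth_on_def by (metis iter_partial.simps(1))

lemma smooth_on_imp_bounded_smooth:
  assumes "smooth_on S f" "compact K" "K \<subseteq> S"
  shows "bounded_smooth n (\<lambda>_. S) (\<lambda>_. K) (\<lambda>_. f)"
  unfolding bounded_smooth_def
proof (intro allI impI conjI)
  fix \<alpha>
  have "compact (iter_partial \<alpha> f ` K)"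
    using smooth_on_imp_continuous_iter_partial[OF assms(1)] assms(2,3)
    by (meson compact_continuous_image continuous_on_subset)
  from compact_imp_bounded[OF this] show "\<exists>C. \<forall>i::'c. \<forall>x\<in>K. norm (iter_partial \<alpha> f x) \<le> C"
    by (auto simp: bounded_iff)
qed (use assms(1) in \<open>auto simp: smooth_on_def\<close>)

lemma smooth_on_cong:
  assumes "open S" "\<And>x. x \<in> S \<Longrightarrow> f x = g x"
  shows "smooth_on S f \<longleftrightarrow> smooth_on S g"
  unfolding smooth_on_iff_bounded_smooth using bounded_smooth_cong assms by (metis empty_subsetI)

context
  fixes S :: "(real^'d::finite) set"
  assumes S: "open S"
begin

lemma smooth_on_const: "smooth_on S (\<lambda>_. c)"
  unfolding smooth_on_iff_bounded_smooth using S by (simp add: bounded_smooth_const)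

lemma smooth_on_linear:
  "bounded_linear h \<Longrightarrow> smooth_on S f \<Longrightarrow> smooth_on S (\<lambda>x. h (f x))"
  unfolding smooth_on_iff_bounded_smooth using S by (auto intro: bounded_smooth_linear)

lemma smooth_on_add: "smooth_on S f \<Longrightarrow> smooth_on S g \<Longrightarrow> smooth_on S (\<lambda>x. f x + g x)"
  unfolding smooth_on_iff_bounded_smooth using S by (simp add: bounded_smooth_add)

lemma smooth_on_sum: "(\<And>c. c \<in> A \<Longrightarrow> smooth_on S (f c)) \<Longrightarrow> smooth_on S (\<lambda>x. \<Sum>c\<in>A. f c x)"
  unfolding smooth_on_iff_bounded_smooth using S by (simp add: bounded_smooth_sum)

lemma smooth_on_mult:
  fixes f g :: "real^'d \<Rightarrow> 'b::real_normed_algebra"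
  shows "smooth_on S f \<Longrightarrow> smooth_on S g \<Longrightarrow> smooth_on S (\<lambda>x. f x * g x)"
  unfolding smooth_on_iff_bounded_smooth using S by (simp add: bounded_smooth_mult)

lemma smooth_on_diff: 
  fixes f g :: "real^'d \<Rightarrow> 'b::real_normed_vector"
  assumes "smooth_on S f" "smooth_on S g" shows "smooth_on S (\<lambda>x. f x - g x)"
  using smooth_on_add[OF assms(1) smooth_on_linear[OF bounded_linear_minus[OF bounded_linear_ident] assms(2)]]
  by simp

lemma smooth_on_det:
  fixes M :: "real^'d \<Rightarrow> real^'e^'e"
  shows "(\<And>a b. smooth_on S (\<lambda>x. M x $ a $ b)) \<Longrightarrow> smooth_on S (\<lambda>x. det (M x))"
  unfolding smooth_on_iff_bounded_smooth using S by (simp add: bounded_smooth_det)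

lemma smooth_on_inverse:
  fixes f :: "real^'d \<Rightarrow> 'b::real_normed_field"
  shows "smooth_on S f \<Longrightarrow> (\<And>x. x \<in> S \<Longrightarrow> f x \<noteq> 0) \<Longrightarrow> smooth_on S (\<lambda>x. inverse (f x))"
  unfolding smooth_on_iff_bounded_smooth using S
  by (auto intro: bounded_smooth_inverse[of _ _ _ _ 1])

lemma smooth_on_abs:
  fixes f :: "real^'d \<Rightarrow> real"
  shows "smooth_on S f \<Longrightarrow> (\<And>x. x \<in> S \<Longrightarrow> f x \<noteq> 0) \<Longrightarrow> smooth_on S (\<lambda>x. \<bar>f x\<bar>)"
  unfolding smooth_on_iff_bounded_smooth using S by (simp add: bounded_smooth_abs)

lemma smooth_on_vec_iff:
  fixes f :: "real^'d \<Rightarrow> real^'e"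
  shows "smooth_on S f \<longleftrightarrow> (\<forall>c. smooth_on S (\<lambda>x. f x $ c))"
  unfolding smooth_on_iff_bounded_smooth using S bounded_smooth_vec_iff[of "\<lambda>_. S" "\<lambda>_. {}"] by auto

lemma smooth_on_partial_deriv: "smooth_on S f \<Longrightarrow> smooth_on S (partial_deriv j f)"
  unfolding smooth_on_def by (metis iter_partial_snoc)

lemma smooth_on_compose:
  assumes "smooth_on V f" "smooth_on S g" "\<And>x. x \<in> S \<Longrightarrow> g x \<in> V" "open V"
  shows "smooth_on S (\<lambda>x. f (g x))"
proof -
  have "bounded_smooth n (\<lambda>_::unit. S) (\<lambda>_. {}) (\<lambda>_ x. f (g x))"
    if "bounded_smooth n (\<lambda>_::unit. V) (\<lambda>_. {}) (\<lambda>_. f)" "bounded_smooth n (\<lambda>_::unit. S) (\<lambda>_. {}) (\<lambda>_. g)" for n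
    by (rule bounded_smooth_compose[OF _ _ that]) (use S assms(3) in simp_all)
  with assms(1,2) show ?thesis unfolding smooth_on_iff_bounded_smooth by simp
qed

lemma smooth_on_ident: "smooth_on S (\<lambda>x. x)"
  unfolding smooth_on_iff_bounded_smooth
proof
  have p: "partial_deriv j (\<lambda>x. x) x = axis j 1" for j and x :: "real^'d"
    by (rule partial_derivI[OF has_derivative_ident])
  show "bounded_smooth n (\<lambda>_::unit. S) (\<lambda>_. {}) (\<lambda>_ x. x)" for n
  proof (cases n)
    case (Suc m)
    have "bounded_smooth m (\<lambda>_::unit. S) (\<lambda>_. {}) (\<lambda>_. partial_deriv j (\<lambda>x. x))" for j
      using bounded_smooth_const[of "\<lambda>_::unit. S" "\<lambda>_. {}" m "axis j 1"] S
      unfolding p[abs_def] by simp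
    then show ?thesis
      unfolding Suc bounded_smooth_Suc by (simp add: bounded_smooth_0)
  qed (simp add: bounded_smooth_0)
qed

end

text \<open>
  The factor \<open>t\<^sup>-\<^sup>k\<close> closes the family under differentiation: the derivative of \<open>flat k\<close> is
  \<open>flat (k + 2) - k flat (k + 1)\<close>, also at \<open>0\<close>. Smoothness of all members follows at once.
\<close>

definition flat :: "nat \<Rightarrow> real \<Rightarrow> real" where
  "flat k t = (if t > 0 then exp (- inverse t) * inverse t ^ k else 0)"

lemma flat_has_derivative: "(flat k has_real_derivative (flat (k + 2) t - k * flat (k + 1) t)) (at t)"
proof -
  consider "t > 0" | "t < 0" | "t = 0" by linarith
  then show ?thesis
  proof cases
    case 1
    have "((\<lambda>t. exp (- inverse t) * inverse t ^ k) has_real_derivative (flat (k + 2) t - k * flat (k + 1) t)) (at t)"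
    proof (cases k)
      case (Suc m)
      have "inverse t * inverse t ^ (m - Suc 0) = inverse t ^ m \<or> m = 0"
        by (cases m) auto
      with Suc 1 show ?thesis
        by (auto intro!: derivative_eq_intros simp: flat_def algebra_simps power2_eq_square)
    qed (use 1 in \<open>auto intro!: derivative_eq_intros simp: flat_def algebra_simps power2_eq_square\<close>)
    then show ?thesis
      by (rule has_field_derivative_transform_within_open[of _ _ _ "{0<..}"]) (use 1 in \<open>auto simp: flat_def\<close>)
  next
    case 2
    have "((\<lambda>t. 0) has_real_derivative (flat (k + 2) t - k * flat (k + 1) t)) (at t)"
      using 2 by (simp add: flat_def)
    then show ?thesis
      by (rule has_field_derivative_transform_within_open[of _ _ _ "{..<0}"]) (use 2 in \<open>auto simp: flat_def\<close>)
  next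
    case 3
    have "((\<lambda>x. flat k (0 + x) / x) \<longlongrightarrow> 0) (at_right 0)"
    proof (rule Lim_transform_eventually)
      show "((\<lambda>x. inverse x ^ (k + 1) / exp (inverse x)) \<longlongrightarrow> (0::real)) (at_right 0)"
        using filterlim_compose[OF tendsto_power_div_exp_0 filterlim_inverse_at_top_right] by blast
      show "\<forall>\<^sub>F x::real in at_right 0. inverse x ^ (k + 1) / exp (inverse x) = flat k (0 + x) / x"
        by (rule eventually_at_rightI[of 0 1]) (auto simp: flat_def field_simps exp_minus)
    qed
    moreover have "((\<lambda>x. flat k (0 + x) / x) \<longlongrightarrow> 0) (at_left 0)"
      by (rule Lim_transform_eventually[OF tendsto_const], rule eventually_at_leftI[of "-1"])
        (auto simp: flat_def)
    ultimately have "(\<lambda>x. (flat k (0 + x) - flat k 0) / x) \<midarrow>0\<rightarrow> 0"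
      by (simp add: filterlim_split_at flat_def)
    then show ?thesis using 3 by (simp add: DERIV_def flat_def)
  qed
qed

lemma smooth_on_flat_compose:
  assumes "open S" and q: "smooth_on S q"
  shows "smooth_on S (\<lambda>x. flat k (q x))"
  unfolding smooth_on_iff_bounded_smooth
proof
  let ?bs = "\<lambda>n f. bounded_smooth n (\<lambda>_::unit. S) (\<lambda>_. {}) (\<lambda>_. f)"
  have der: "((\<lambda>x. flat k (q x)) has_derivative
      (\<lambda>v. frechet_derivative q (at x) v * (flat (k + 2) (q x) - k * flat (k + 1) (q x)))) (at x)" if "x \<in> S" for k x
  proof -
    have "(flat k has_derivative (\<lambda>h. (flat (k + 2) (q x) - k * flat (k + 1) (q x)) * h)) (at (q x))"
      using flat_has_derivative unfolding has_field_derivative_def .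
    from has_derivative_compose[OF smooth_on_imp_differentiable[OF q that, unfolded frechet_derivative_works] this]
    show ?thesis by (simp add: mult.commute)
  qed
  show "?bs n (\<lambda>x. flat k (q x))" for n
  proof (induction n arbitrary: k)
    case 0
    show ?case using der by (auto simp: bounded_smooth_0 differentiable_def)
  next
    case (Suc n)
    have "?bs n (partial_deriv j q)" for j
      using smooth_on_partial_deriv[OF \<open>open S\<close> q] by (simp add: smooth_on_iff_bounded_smooth)
    then have "?bs n (\<lambda>x. partial_deriv j q x * (flat (k + 2) (q x) + (- of_nat k) * flat (k + 1) (q x)))" for j
      using \<open>open S\<close> Suc.IH by (intro bounded_smooth_mult bounded_smooth_add bounded_smooth_const) auto
    then show ?case
    proof (rule bounded_smooth_Suc_cong[rotated 3])
      show "bounded_smooth 0 (\<lambda>_. S) (\<lambda>_. {}) (\<lambda>_ x. flat k (q x))"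
        using der by (auto simp: bounded_smooth_0 differentiable_def)
      show "partial_deriv j (\<lambda>x. flat k (q x)) x =
          partial_deriv j q x * (flat (k + 2) (q x) + (- of_nat k) * flat (k + 1) (q x))" if "x \<in> S" for j x
        using partial_derivI[OF der[OF that]] by (simp add: partial_deriv_def)
    qed (use \<open>open S\<close> in auto)
  qed
qed

lemma exists_bump:
  fixes a :: "real^'d::finite"
  assumes "r > 0"
  obtains b :: "real^'d \<Rightarrow> real" where "smooth_on UNIV b" "\<And>x. b x \<ge> 0" "\<And>x. b x \<noteq> 0 \<longleftrightarrow> x \<in> ball a r"
proof
  let ?b = "\<lambda>x. flat 0 (r\<^sup>2 - (\<Sum>i\<in>UNIV. (x $ i - a $ i) * (x $ i - a $ i)))"
  show "smooth_on UNIV ?b"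
    by (intro smooth_on_flat_compose smooth_on_diff smooth_on_const smooth_on_sum smooth_on_mult
        smooth_on_linear[OF _ bounded_linear_vec_nth smooth_on_ident]) auto
  show "?b x \<ge> 0" for x by (simp add: flat_def)
  have "(\<Sum>i\<in>UNIV. (x $ i - a $ i) * (x $ i - a $ i)) = (dist a x)\<^sup>2" for x
    by (subst dist_commute) (simp add: dist_norm power2_norm_eq_inner inner_vec_def)
  moreover have "(dist a x)\<^sup>2 < r\<^sup>2 \<longleftrightarrow> dist a x < r" for x
    using \<open>r > 0\<close> power_strict_mono[of "dist a x" r 2] power2_less_imp_less[of "dist a x" r] by auto
  ultimately show "?b x \<noteq> 0 \<longleftrightarrow> x \<in> ball a r" for x
    by (simp add: flat_def)
qed

text \<open>
  Finitely many bumps whose balls cover \<open>K\<close> have a sum that is positive on \<open>K\<close>, hence bounded below there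
  by compactness; rescale it.
\<close>

lemma exists_cutoff:
  fixes X :: "(real^'d::finite) set"
  assumes "open X" "compact K" "K \<subseteq> X"
  obtains b :: "real^'d \<Rightarrow> real" where "smooth_on UNIV b" "\<And>x. b x \<ge> 0" "\<And>x. x \<in> K \<Longrightarrow> b x \<ge> 1"
    "compact (closure {x. b x \<noteq> 0})" "closure {x. b x \<noteq> 0} \<subseteq> X"
proof -
  have "\<exists>r>0. cball x r \<subseteq> X" if "x \<in> K" for x
    using assms that open_contains_cball by (metis subsetD)
  then obtain r where r: "\<And>x. x \<in> K \<Longrightarrow> r x > 0" "\<And>x. x \<in> K \<Longrightarrow> cball x (r x) \<subseteq> X"
    by metis
  have "\<exists>b. smooth_on UNIV b \<and> (\<forall>y. b y \<ge> (0::real)) \<and> (\<forall>y. b y \<noteq> 0 \<longleftrightarrow> y \<in> ball x (r x))" if "x \<in> K" for x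
    using exists_bump[OF r(1)[OF that], of x] by metis
  then obtain b :: "real^'d \<Rightarrow> real^'d \<Rightarrow> real" where b: "\<And>x. x \<in> K \<Longrightarrow> smooth_on UNIV (b x)" "\<And>x y. x \<in> K \<Longrightarrow> b x y \<ge> 0"
      "\<And>x y. x \<in> K \<Longrightarrow> b x y \<noteq> 0 \<longleftrightarrow> y \<in> ball x (r x)"
    by metis
  have "K \<subseteq> (\<Union>x\<in>K. ball x (r x))" using r(1) by force
  from compactE_image[OF assms(2) _ this] obtain F where F: "F \<subseteq> K" "finite F" "K \<subseteq> (\<Union>x\<in>F. ball x (r x))"
    by auto
  define s where "s = (\<lambda>y. \<Sum>x\<in>F. b x y)"
  have s: "smooth_on UNIV s"
    unfolding s_def using b(1) F(1) by (intro smooth_on_sum) auto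
  have nonneg: "s y \<ge> 0" for y
    unfolding s_def using b(2) F(1) by (blast intro: sum_nonneg)
  have pos: "s y > 0" if "y \<in> K" for y
  proof -
    from F(3) that obtain x where x: "x \<in> F" "y \<in> ball x (r x)" by blast
    then have "b x y > 0" using b(2)[of x y] b(3)[of x y] F(1) by (simp add: less_le subset_iff)
    moreover have "b i y \<ge> 0" if "i \<in> F" for i using b(2) F(1) that by blast
    ultimately show ?thesis unfolding s_def by (rule sum_pos2[OF F(2) x(1)])
  qed
  have "{y. s y \<noteq> 0} \<subseteq> (\<Union>x\<in>F. cball x (r x))"
  proof
    fix y assume "y \<in> {y. s y \<noteq> 0}"
    then have "(\<Sum>x\<in>F. b x y) \<noteq> 0" unfolding s_def by simp
    then obtain x where "x \<in> F" "b x y \<noteq> 0" by (rule sum.not_neutral_contains_not_neutral)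
    then have "y \<in> ball x (r x)" using b(3)[of x y] F(1) by (simp add: subset_iff)
    with \<open>x \<in> F\<close> show "y \<in> (\<Union>x\<in>F. cball x (r x))" using ball_subset_cball by blast
  qed
  moreover have cF: "compact (\<Union>x\<in>F. cball x (r x))" using F(2) by (intro compact_UN) auto
  ultimately have cl: "closure {y. s y \<noteq> 0} \<subseteq> (\<Union>x\<in>F. cball x (r x))"
    by (simp add: closure_minimal compact_imp_closed)
  have "\<exists>c>0. \<forall>y\<in>K. s y \<ge> c"
  proof (cases "K = {}")
    case False
    have "continuous_on K s" by (rule continuous_on_subset[OF smooth_on_imp_continuous_on[OF s]]) simp
    from continuous_attains_inf[OF assms(2) False this] show ?thesis using pos by blast
  qed (auto intro: exI[of _ 1])
  then obtain c where c: "c > 0" "\<And>y. y \<in> K \<Longrightarrow> s y \<ge> c" by blast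
  show ?thesis
  proof
    show "smooth_on UNIV (\<lambda>y. inverse c * s y)" using s by (intro smooth_on_mult smooth_on_const) auto
    show "inverse c * s y \<ge> 0" for y using c nonneg by simp
    show "inverse c * s y \<ge> 1" if "y \<in> K" for y using c(1) c(2)[OF that] by (simp add: field_simps)
    have "{y. inverse c * s y \<noteq> 0} = {y. s y \<noteq> 0}" using c(1) by auto
    moreover have "compact (closure {y. s y \<noteq> 0})"
      using compact_Int_closed[OF cF closed_closure, of "{y. s y \<noteq> 0}"] unfolding Int_absorb1[OF cl] .
    moreover have "(\<Union>x\<in>F. cball x (r x)) \<subseteq> X" using r(2) F(1) by blast
    ultimately show "compact (closure {y. inverse c * s y \<noteq> 0})" "closure {y. inverse c * s y \<noteq> 0} \<subseteq> X"
      using cl by auto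
  qed
qed

section \<open>Topologies generated by seminorms\<close>

definition function_space :: "('b \<Rightarrow> complex) set \<Rightarrow> bool" where
  "function_space E \<longleftrightarrow> (\<lambda>_. 0) \<in> E \<and> (\<forall>f\<in>E. \<forall>g\<in>E. (\<lambda>x. f x + g x) \<in> E) \<and>
     (\<forall>c. \<forall>f\<in>E. (\<lambda>x. c * f x) \<in> E)"

lemma function_space_add: "function_space E \<Longrightarrow> f \<in> E \<Longrightarrow> g \<in> E \<Longrightarrow> (\<lambda>x. f x + g x) \<in> E"
  by (simp add: function_space_def)

lemma function_space_scale: "function_space E \<Longrightarrow> f \<in> E \<Longrightarrow> (\<lambda>x. c * f x) \<in> E"
  by (simp add: function_space_def)

lemma seminorm_on_triangle:
  "seminorm_on E p \<Longrightarrow> f \<in> E \<Longrightarrow> g \<in> E \<Longrightarrow> p (\<lambda>x. f x + g x) \<le> p f + p g"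
  by (simp add: seminorm_on_def)

lemma seminorm_on_scale: "seminorm_on E p \<Longrightarrow> f \<in> E \<Longrightarrow> p (\<lambda>x. c * f x) = cmod c * p f"
  by (simp add: seminorm_on_def)

lemma function_space_diff:
  assumes "function_space E" "f \<in> E" "g \<in> E"
  shows "(\<lambda>x. f x - g x) \<in> E"
  using function_space_add[OF assms(1,2) function_space_scale[OF assms(1,3), of "-1"]] by simp

text \<open>
  Homogeneity follows from the upper estimate for \<open>c\<close> and for \<open>1 / c\<close>.
\<close>

lemma seminorm_onI:
  assumes E: "function_space E"
    and "\<And>f. f \<in> E \<Longrightarrow> 0 \<le> p f" "\<And>f g. f \<in> E \<Longrightarrow> g \<in> E \<Longrightarrow> p (\<lambda>x. f x + g x) \<le> p f + p g"
    and le: "\<And>c f. f \<in> E \<Longrightarrow> p (\<lambda>x. c * f x) \<le> cmod c * p f"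
  shows "seminorm_on E p"
  unfolding seminorm_on_def
proof (intro conjI allI ballI antisym)
  fix c f assume f: "f \<in> E"
  then have cf: "(\<lambda>x. c * f x) \<in> E" using E by (simp add: function_space_def)
  show "cmod c * p f \<le> p (\<lambda>x. c * f x)"
  proof (cases "c = 0")
    case False
    have "p f \<le> cmod (inverse c) * p (\<lambda>x. c * f x)"
      using le[OF cf, of "inverse c"] False by (simp add: field_simps)
    also have "\<dots> = p (\<lambda>x. c * f x) / cmod c" by (simp add: norm_inverse divide_inverse_commute)
    finally show ?thesis using False by (simp add: pos_le_divide_eq mult.commute)
  qed (use assms(2)[OF cf] in simp)
qed (use assms in auto)

lemma seminorm_on_diff_le:
  assumes "function_space E" "seminorm_on E p" "f \<in> E" "g \<in> E" "h \<in> E"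
  shows "p (\<lambda>x. g x - h x) \<le> p (\<lambda>x. g x - f x) + p (\<lambda>x. f x - h x)"
proof -
  have "(\<lambda>x. g x - f x) \<in> E" "(\<lambda>x. f x - h x) \<in> E"
    using assms by (simp_all add: function_space_diff)
  from seminorm_on_triangle[OF assms(2) this] show ?thesis by simp
qed

lemma seminorm_on_zero: "seminorm_on E p \<Longrightarrow> f \<in> E \<Longrightarrow> p (\<lambda>_. 0) = 0"
  using seminorm_on_scale[of E p f 0] by simp

lemma seminorm_on_abs_diff_le:
  assumes E: "function_space E" and p: "seminorm_on E p" "f \<in> E" "g \<in> E"
  shows "\<bar>p g - p f\<bar> \<le> p (\<lambda>x. g x - f x)"
proof -
  have 0: "(\<lambda>_. 0) \<in> E" using E by (simp add: function_space_def)
  have "p (\<lambda>x. (-1) * (g x - f x)) = cmod (-1) * p (\<lambda>x. g x - f x)"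
    using seminorm_on_scale[OF p(1) function_space_diff[OF E p(3,2)]] .
  then have "p (\<lambda>x. f x - g x) = p (\<lambda>x. g x - f x)" by simp
  moreover have "p g \<le> p (\<lambda>x. g x - f x) + p f"
    using seminorm_on_diff_le[OF E p(1) p(2) p(3) 0] by simp
  moreover have "p f \<le> p (\<lambda>x. f x - g x) + p g"
    using seminorm_on_diff_le[OF E p(1) p(3) p(2) 0] by simp
  ultimately show ?thesis by simp
qed

lemma topspace_seminorm_topology [simp]: "topspace (seminorm_topology E P) = E"
  unfolding seminorm_topology_def topology_generated_by_topspace by auto

context
  fixes E :: "('b \<Rightarrow> complex) set" and P :: "(('b \<Rightarrow> complex) \<Rightarrow> real) set"
  assumes E: "function_space E" and P: "\<And>p. p \<in> P \<Longrightarrow> seminorm_on E p"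
begin

abbreviation (input) "\<tau> \<equiv> seminorm_topology E P"

lemma zero_in: "(\<lambda>_. 0) \<in> E"
  using E by (simp add: function_space_def)

lemma openin_seminorm_ball:
  assumes "finite F" "F \<subseteq> P" "f \<in> E" "e > 0"
  shows "openin \<tau> {g \<in> E. \<forall>p\<in>F. p (\<lambda>x. g x - f x) < e}"
  using assms(1,2)
proof (induction F)
  case empty
  show ?case using openin_topspace[of "\<tau>"] by simp
next
  case (insert p F)
  have "openin \<tau> {g \<in> E. p (\<lambda>x. g x - f x) < e}"
    unfolding seminorm_topology_def using insert.prems assms(3,4)
    by (intro topology_generated_by_Basis) blast
  then have "openin \<tau>
      ({g \<in> E. p (\<lambda>x. g x - f x) < e} \<inter> {g \<in> E. \<forall>p\<in>F. p (\<lambda>x. g x - f x) < e})"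
    using insert by (intro openin_Int) auto
  also have "({g \<in> E. p (\<lambda>x. g x - f x) < e} \<inter> {g \<in> E. \<forall>p\<in>F. p (\<lambda>x. g x - f x) < e}) =
      {g \<in> E. \<forall>p\<in>insert p F. p (\<lambda>x. g x - f x) < e}" by auto
  finally show ?case .
qed

text \<open>
  The generating sets are balls with arbitrary centres, but by the triangle inequality such a ball
  contains a smaller ball of the same seminorm around each of its points.
\<close>

lemma openin_seminorm_topologyE:
  assumes "openin \<tau> U" "f \<in> U"
  obtains F d where "finite F" "F \<subseteq> P" "d > 0" "{g \<in> E. \<forall>p\<in>F. p (\<lambda>x. g x - f x) < d} \<subseteq> U"
proof -
  have "generate_topology_on (insert E {{g\<in>E. p (\<lambda>x. g x - f x) < e} | p f e. p \<in> P \<and> f \<in> E \<and> 0 < e}) U"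
    using assms(1) unfolding seminorm_topology_def openin_topology_generated_by_iff .
  then have "\<exists>F d. finite F \<and> F \<subseteq> P \<and> d > 0 \<and> {g \<in> E. \<forall>p\<in>F. p (\<lambda>x. g x - f x) < d} \<subseteq> U"
    using assms(2)
  proof (induction arbitrary: f)
    case (Int U V)
    then have "f \<in> U" "f \<in> V" by auto
    obtain F d where F: "finite F" "F \<subseteq> P" "d > 0" "{g \<in> E. \<forall>p\<in>F. p (\<lambda>x. g x - f x) < d} \<subseteq> U"
      using Int.IH(1)[OF \<open>f \<in> U\<close>] by blast
    obtain F' d' where F': "finite F'" "F' \<subseteq> P" "d' > 0" "{g \<in> E. \<forall>p\<in>F'. p (\<lambda>x. g x - f x) < d'} \<subseteq> V"
      using Int.IH(2)[OF \<open>f \<in> V\<close>] by blast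
    have "{g \<in> E. \<forall>p\<in>F \<union> F'. p (\<lambda>x. g x - f x) < min d d'} \<subseteq> U \<inter> V"
      using F(4) F'(4) by auto
    with F F' show ?case by (intro exI[of _ "F \<union> F'"] exI[of _ "min d d'"]) auto
  next
    case (UN \<U>)
    then obtain V where V: "V \<in> \<U>" "f \<in> V" by blast
    from UN.IH[OF V] show ?case using V(1) by (meson Union_upper order_trans)
  next
    case (Basis V)
    show ?case
    proof (cases "V = E")
      case True
      then show ?thesis by (intro exI[of _ "{}"] exI[of _ 1]) auto
    next
      case False
      then obtain p h e where V: "V = {g\<in>E. p (\<lambda>x. g x - h x) < e}" "p \<in> P" "h \<in> E" using Basis by blast
      have "{g \<in> E. \<forall>p\<in>{p}. p (\<lambda>x. g x - f x) < e - p (\<lambda>x. f x - h x)} \<subseteq> V"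
      proof
        fix g assume g: "g \<in> {g \<in> E. \<forall>p\<in>{p}. p (\<lambda>x. g x - f x) < e - p (\<lambda>x. f x - h x)}"
        then show "g \<in> V"
          using seminorm_on_diff_le[OF E P[OF V(2)], of f g h] V Basis(2) by auto
      qed
      then show ?thesis
        using V Basis(2) by (intro exI[of _ "{p}"] exI[of _ "e - p (\<lambda>x. f x - h x)"]) auto
    qed
  qed simp
  then show thesis using that by blast
qed

lemma sum_seminorm_nonneg: "F \<subseteq> P \<Longrightarrow> f \<in> E \<Longrightarrow> 0 \<le> (\<Sum>p\<in>F. p f)"
  using P by (intro sum_nonneg) (auto simp: seminorm_on_def)

text \<open>
  A continuous seminorm \<open>q\<close> is less than \<open>1\<close> on a basic neighbourhood of \<open>0\<close>; scaling carries this over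
  to the whole space.
\<close>

lemma continuous_seminorm_imp_dominated:
  assumes q: "continuous_seminorm \<tau> q"
  obtains F C where "finite F" "F \<subseteq> P" "C \<ge> 0" "\<And>f. f \<in> E \<Longrightarrow> q f \<le> C * (\<Sum>p\<in>F. p f)"
proof -
  have sq: "seminorm_on E q" and cq: "continuous_map \<tau> euclideanreal q"
    using q by (auto simp: continuous_seminorm_def)
  have "openin \<tau> {f \<in> E. q f \<in> {..<1}}"
    using openin_continuous_map_preimage[OF cq] by (metis open_lessThan open_openin topspace_seminorm_topology)
  moreover have "(\<lambda>_. 0) \<in> {f \<in> E. q f \<in> {..<1}}"
    using zero_in seminorm_on_zero[OF sq zero_in] by simp
  ultimately obtain F d where F: "finite F" "F \<subseteq> P" "d > 0"
      "{g \<in> E. \<forall>p\<in>F. p (\<lambda>x. g x - 0) < d} \<subseteq> {f \<in> E. q f \<in> {..<1}}"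
    by (rule openin_seminorm_topologyE)
  \<comment> \<open>The slack \<open>e\<close> keeps the scaling factor finite when all \<open>p f\<close> vanish.\<close>
  have "q f \<le> inverse d * (\<Sum>p\<in>F. p f)" if f: "f \<in> E" for f
  proof (rule field_le_epsilon)
    fix e :: real assume "e > 0"
    let ?s = "\<Sum>p\<in>F. p f"
    have s: "?s \<ge> 0" using sum_seminorm_nonneg F(2) f .
    define r where "r = d / (?s + d * e)"
    have r: "r > 0" using s \<open>d > 0\<close> \<open>e > 0\<close> by (simp add: r_def add_nonneg_pos)
    have rf: "(\<lambda>x. complex_of_real r * f x) \<in> E" using E f by (rule function_space_scale)
    have scal: "p (\<lambda>x. complex_of_real r * f x) = r * p f" if "seminorm_on E p" for p
      using seminorm_on_scale[OF that f] r by simp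
    have "p (\<lambda>x. complex_of_real r * f x - 0) < d" if "p \<in> F" for p
    proof -
      have "p f \<le> ?s"
        using F(1,2) that f P by (intro member_le_sum) (auto simp: seminorm_on_def)
      also have "?s < ?s + d * e" using \<open>d > 0\<close> \<open>e > 0\<close> by simp
      finally have "r * p f < r * (?s + d * e)" using r by simp
      also have "\<dots> = d" using s \<open>d > 0\<close> \<open>e > 0\<close> by (simp add: r_def add_nonneg_pos less_imp_neq[symmetric])
      finally show ?thesis using scal[OF P] that F(2) by auto
    qed
    with F(4) rf have "q (\<lambda>x. complex_of_real r * f x) < 1" by auto
    then have "q f < inverse r" using scal[OF sq] r by (simp add: field_simps)
    also have "inverse r = inverse d * ?s + e" using \<open>d > 0\<close> by (simp add: r_def field_simps)
    finally show "q f \<le> inverse d * ?s + e" by simp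
  qed
  then show thesis using that[OF F(1,2)] \<open>d > 0\<close> by (metis inverse_nonnegative_iff_nonnegative less_imp_le)
qed

lemma openin_seminorm_topologyI:
  assumes "U \<subseteq> E"
    and "\<And>f. f \<in> U \<Longrightarrow> \<exists>F d. finite F \<and> F \<subseteq> P \<and> d > 0 \<and> {g \<in> E. \<forall>p\<in>F. p (\<lambda>x. g x - f x) < d} \<subseteq> U"
  shows "openin \<tau> U"
proof (subst openin_subopen, intro ballI)
  fix f assume f: "f \<in> U"
  from assms(2)[OF f] obtain F d where F: "finite F" "F \<subseteq> P" "d > 0"
      "{g \<in> E. \<forall>p\<in>F. p (\<lambda>x. g x - f x) < d} \<subseteq> U"
    by meson
  have fE: "f \<in> E" using f assms(1) by blast
  have "p (\<lambda>x. f x - f x) < d" if "p \<in> F" for p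
    using seminorm_on_zero[OF P fE, of p] that F(2,3) by auto
  with fE have "f \<in> {g \<in> E. \<forall>p\<in>F. p (\<lambda>x. g x - f x) < d}" by simp
  with openin_seminorm_ball[OF F(1,2) fE F(3)] F(4)
  show "\<exists>T. openin \<tau> T \<and> f \<in> T \<and> T \<subseteq> U" by meson
qed

lemma small_if_dominated:
  assumes F: "finite F" "F \<subseteq> P" and "C \<ge> 0" "e > 0"
  obtains d where "d > 0" "\<And>f. f \<in> E \<Longrightarrow> (\<forall>p\<in>F. p f < d) \<Longrightarrow> C * (\<Sum>p\<in>F. p f) < e"
proof
  let ?d = "e / ((C + 1) * (card F + 1))"
  show "?d > 0" using assms by simp
  fix f assume f: "f \<in> E" "\<forall>p\<in>F. p f < ?d"
  have "(\<Sum>p\<in>F. p f) \<le> card F * ?d" using f by (intro sum_bounded_above) auto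
  then have "C * (\<Sum>p\<in>F. p f) \<le> C * (card F * ?d)" using \<open>C \<ge> 0\<close> by (rule mult_left_mono)
  also have "\<dots> = e * ((C * card F) / ((C + 1) * (card F + 1)))" by simp
  also have "\<dots> < e * 1"
    using \<open>C \<ge> 0\<close> by (intro mult_strict_left_mono[OF _ \<open>e > 0\<close>]) (simp add: divide_less_eq algebra_simps add_pos_nonneg add_nonneg_pos)
  finally show "C * (\<Sum>p\<in>F. p f) < e" by simp
qed

lemma continuous_map_if_dominated:
  fixes u :: "('b \<Rightarrow> complex) \<Rightarrow> 'c::metric_space"
  assumes F: "finite F" "F \<subseteq> P" and "C \<ge> 0"
    and le: "\<And>f g. f \<in> E \<Longrightarrow> g \<in> E \<Longrightarrow> dist (u g) (u f) \<le> C * (\<Sum>p\<in>F. p (\<lambda>x. g x - f x))"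
  shows "continuous_map \<tau> euclidean u"
  unfolding continuous_map_def
proof (intro conjI allI impI)
  fix V :: "'c set" assume "openin euclidean V"
  then have V: "open V" by simp
  show "openin \<tau> {f \<in> topspace \<tau>. u f \<in> V}"
  proof (rule openin_seminorm_topologyI)
    fix f assume "f \<in> {f \<in> topspace \<tau>. u f \<in> V}"
    then have f: "f \<in> E" "u f \<in> V" by auto
    obtain e where e: "e > 0" "\<And>y. dist y (u f) < e \<Longrightarrow> y \<in> V" using V f(2) open_dist by metis
    obtain d where d: "d > 0" "\<And>f. f \<in> E \<Longrightarrow> (\<forall>p\<in>F. p f < d) \<Longrightarrow> C * (\<Sum>p\<in>F. p f) < e"
      using small_if_dominated[OF F \<open>C \<ge> 0\<close> e(1)] by blast
    have "u g \<in> V" if "g \<in> E" "\<forall>p\<in>F. p (\<lambda>x. g x - f x) < d" for g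
      using e(2) le[OF f(1) that(1)] d(2)[OF function_space_diff[OF E that(1) f(1)] that(2)] by simp
    then show "\<exists>F d. finite F \<and> F \<subseteq> P \<and> d > 0 \<and> {g \<in> E. \<forall>p\<in>F. p (\<lambda>x. g x - f x) < d} \<subseteq>
        {f \<in> topspace \<tau>. u f \<in> V}"
      using F d(1) by (intro exI[of _ F] exI[of _ d]) auto
  qed auto
qed simp

lemma continuous_seminorm_if_dominated:
  assumes "seminorm_on E q" and F: "finite F" "F \<subseteq> P" "C \<ge> 0"
    and le: "\<And>f. f \<in> E \<Longrightarrow> q f \<le> C * (\<Sum>p\<in>F. p f)"
  shows "continuous_seminorm \<tau> q"
  unfolding continuous_seminorm_def
proof
  show "continuous_map \<tau> euclideanreal q"
  proof (rule continuous_map_if_dominated[OF F])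
    fix f g assume "f \<in> E" "g \<in> E"
    then show "dist (q g) (q f) \<le> C * (\<Sum>p\<in>F. p (\<lambda>x. g x - f x))"
      using order_trans[OF seminorm_on_abs_diff_le[OF E assms(1), of f g] le[OF function_space_diff[OF E, of g f]]]
      by (simp add: dist_real_def)
  qed
qed (use assms in simp)

lemma continuous_map_self_if_dominated:
  assumes A: "\<And>f. f \<in> E \<Longrightarrow> A f \<in> E"
    and diff: "\<And>f g. f \<in> E \<Longrightarrow> g \<in> E \<Longrightarrow> A (\<lambda>x. g x - f x) = (\<lambda>x. A g x - A f x)"
    and le: "\<And>p. p \<in> P \<Longrightarrow> \<exists>q\<in>P. \<forall>f\<in>E. p (A f) \<le> q f"
  shows "continuous_map \<tau> \<tau> A"
  unfolding continuous_map_def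
proof (intro conjI allI impI)
  show "A \<in> topspace \<tau> \<rightarrow> topspace \<tau>" using A by simp
  fix V assume V: "openin \<tau> V"
  show "openin \<tau> {f \<in> topspace \<tau>. A f \<in> V}"
  proof (rule openin_seminorm_topologyI)
    fix f assume "f \<in> {f \<in> topspace \<tau>. A f \<in> V}"
    then have f: "f \<in> E" "A f \<in> V" by auto
    obtain F d where F: "finite F" "F \<subseteq> P" "d > 0" "{g \<in> E. \<forall>p\<in>F. p (\<lambda>x. g x - A f x) < d} \<subseteq> V"
      by (rule openin_seminorm_topologyE[OF V f(2)])
    obtain h where h: "\<And>p. p \<in> F \<Longrightarrow> h p \<in> P" "\<And>p f. p \<in> F \<Longrightarrow> f \<in> E \<Longrightarrow> p (A f) \<le> h p f"
      using le F(2) by (metis subsetD)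
    have "A g \<in> V" if g: "g \<in> E" "\<forall>p\<in>h ` F. p (\<lambda>x. g x - f x) < d" for g
    proof -
      have "p (\<lambda>x. A g x - A f x) < d" if "p \<in> F" for p
      proof -
        have "p (A (\<lambda>x. g x - f x)) \<le> h p (\<lambda>x. g x - f x)"
          by (rule h(2)[OF that function_space_diff[OF E g(1) f(1)]])
        also have "\<dots> < d" using g(2) that by blast
        finally show ?thesis unfolding diff[OF f(1) g(1)] .
      qed
      then show ?thesis using F(4) A[OF g(1)] by blast
    qed
    then show "\<exists>F d. finite F \<and> F \<subseteq> P \<and> d > 0 \<and> {g \<in> E. \<forall>p\<in>F. p (\<lambda>x. g x - f x) < d} \<subseteq>
        {f \<in> topspace \<tau>. A f \<in> V}"
      using F h(1) by (intro exI[of _ "h ` F"] exI[of _ d]) auto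
  qed auto
qed

lemma von_Neumann_bounded_seminorm_topology_iff:
  "von_Neumann_bounded \<tau> B \<longleftrightarrow> B \<subseteq> E \<and> (\<forall>p\<in>P. \<exists>C. \<forall>f\<in>B. p f \<le> C)"
    (is "?l \<longleftrightarrow> ?r")
proof
  assume l: ?l
  then have B: "B \<subseteq> E" by (simp add: von_Neumann_bounded_def)
  have "\<exists>C. \<forall>f\<in>B. p f \<le> C" if p: "p \<in> P" for p
  proof -
    have "openin \<tau> {g \<in> E. \<forall>q\<in>{p}. q (\<lambda>x. g x - 0) < 1}"
      using openin_seminorm_ball[of "{p}" "\<lambda>_. 0" 1] p zero_in by simp
    moreover have "(\<lambda>_. 0) \<in> {g \<in> E. \<forall>q\<in>{p}. q (\<lambda>x. g x - 0) < 1}"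
      using zero_in seminorm_on_zero[OF P[OF p] zero_in] by simp
    ultimately obtain r where r: "r > 0" "\<And>f. f \<in> B \<Longrightarrow> (\<lambda>x. f x / complex_of_real r) \<in> {g \<in> E. \<forall>q\<in>{p}. q (\<lambda>x. g x - 0) < 1}"
      using l unfolding von_Neumann_bounded_def by (meson order_refl)
    have "p f \<le> r" if "f \<in> B" for f
    proof -
      have "p (\<lambda>x. complex_of_real (inverse r) * f x) = cmod (complex_of_real (inverse r)) * p f"
        using seminorm_on_scale[OF P[OF p]] B that by blast
      moreover have "(\<lambda>x. complex_of_real (inverse r) * f x) = (\<lambda>x. f x / complex_of_real r)"
        by (simp add: field_simps)
      ultimately have "inverse r * p f < 1"
        using r(2)[OF that] r(1) by (simp add: norm_inverse)
      then show ?thesis using r(1) by (simp add: field_simps)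
    qed
    then show ?thesis by blast
  qed
  with B show ?r by blast
next
  assume r: ?r
  show ?l
    unfolding von_Neumann_bounded_def
  proof (intro conjI allI impI)
    fix U assume "openin \<tau> U \<and> (\<lambda>_. 0) \<in> U"
    then have U: "openin \<tau> U" "(\<lambda>_. 0) \<in> U" by auto
    obtain F d where F: "finite F" "F \<subseteq> P" "d > 0" "{g \<in> E. \<forall>p\<in>F. p (\<lambda>x. g x - 0) < d} \<subseteq> U"
      by (rule openin_seminorm_topologyE[OF U])
    have "\<forall>p\<in>P. \<exists>C. \<forall>f\<in>B. p f \<le> C" using r by blast
    then obtain c where c: "\<And>p f. p \<in> P \<Longrightarrow> f \<in> B \<Longrightarrow> p f \<le> c p" by metis
    define C where "C = Max (insert 0 (c ` F))"
    have C: "C \<ge> 0" "\<And>p. p \<in> F \<Longrightarrow> c p \<le> C" unfolding C_def using F(1) by auto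
    show "\<exists>r>0. \<forall>t\<ge>r. \<forall>f\<in>B. (\<lambda>x. f x / complex_of_real t) \<in> U"
    proof (intro exI[of _ "(C + 1) / d"] conjI allI impI ballI)
      show "(C + 1) / d > 0" using C \<open>d > 0\<close> by simp
      fix t f assume t: "(C + 1) / d \<le> t" and f: "f \<in> B"
      have tpos: "t > 0" using t C \<open>d > 0\<close> by (meson add_nonneg_pos divide_pos_pos less_le_trans zero_less_one)
      have eq: "(\<lambda>x. f x / complex_of_real t) = (\<lambda>x. complex_of_real (inverse t) * f x)"
        by (simp add: field_simps)
      have "p (\<lambda>x. complex_of_real (inverse t) * f x) < d" if "p \<in> F" for p
      proof -
        have "p (\<lambda>x. complex_of_real (inverse t) * f x) = cmod (complex_of_real (inverse t)) * p f"
          by (rule seminorm_on_scale[OF P]) (use F(2) that r f in auto)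
        also have "\<dots> = p f / t" using tpos by (simp add: norm_inverse divide_inverse mult.commute)
        also have "\<dots> \<le> C / t" using c[of p f] C(2)[OF that] f F(2) that tpos by (intro divide_right_mono) auto
        also have "\<dots> < d" using t tpos \<open>d > 0\<close> by (simp add: field_simps)
        finally show ?thesis .
      qed
      moreover have "(\<lambda>x. complex_of_real (inverse t) * f x) \<in> E"
        by (rule function_space_scale[OF E]) (use r f in blast)
      ultimately show "(\<lambda>x. f x / complex_of_real t) \<in> U"
        unfolding eq using F(4) by auto
    qed
  qed (use r in simp)
qed

end

section \<open>Continuous seminorms on test functions\<close>

lemma Cn_norm_upper:
  assumes f: "smooth_on S f" and K: "compact K" "K \<subseteq> S" and "length \<alpha> \<le> n" "x \<in> K"
  shows "norm (iter_partial \<alpha> f x) \<le> Cn_norm n K f"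
  unfolding Cn_norm_def
proof (rule cSup_upper)
  have "bounded_smooth n (\<lambda>_::unit. S) (\<lambda>_. K) (\<lambda>_. f)"
    by (rule smooth_on_imp_bounded_smooth[OF f K])
  then have "\<exists>C. \<forall>x\<in>K. norm (iter_partial \<beta> f x) \<le> C" if "length \<beta> \<le> n" for \<beta>
    using that unfolding bounded_smooth_def by simp
  then obtain C where C: "\<And>\<beta> x. length \<beta> \<le> n \<Longrightarrow> x \<in> K \<Longrightarrow> norm (iter_partial \<beta> f x) \<le> C \<beta>" by metis
  have fin: "finite {\<beta> :: 'a list. length \<beta> \<le> n}"
    using finite_lists_length_le[of "UNIV :: 'a set" n] by simp
  have "norm (iter_partial \<beta> f x) \<le> (\<Sum>\<gamma> | length \<gamma> \<le> n. \<bar>C \<gamma>\<bar>)" if "length \<beta> \<le> n" "x \<in> K" for \<beta> x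
    using C[OF that] member_le_sum[of \<beta> "{\<beta>. length \<beta> \<le> n}" "\<lambda>\<gamma>. \<bar>C \<gamma>\<bar>"] fin that by auto
  then show "bdd_above (insert 0 {norm (iter_partial \<alpha> f x) |\<alpha> x. length \<alpha> \<le> n \<and> x \<in> K})"
    by (auto intro!: bdd_aboveI)
qed (use assms in auto)

lemma Cn_norm_least:
  assumes "0 \<le> C" "\<And>\<alpha> x. length \<alpha> \<le> n \<Longrightarrow> x \<in> K \<Longrightarrow> norm (iter_partial \<alpha> f x) \<le> C"
  shows "Cn_norm n K f \<le> C"
  unfolding Cn_norm_def by (rule cSup_least) (use assms in auto)

lemma iter_partial_zero: "iter_partial \<alpha> (\<lambda>_. 0) = (\<lambda>_. 0)"
  by (induction \<alpha>) (auto simp: partial_deriv_def)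

lemma test_functions_in_support:
  assumes "\<phi> \<in> test_functions_in K" "x \<notin> K"
  shows "iter_partial \<alpha> \<phi> x = 0"
proof -
  let ?S = "closure {x. \<phi> x \<noteq> 0}"
  have x: "x \<in> - ?S" using assms by (auto simp: test_functions_in_def)
  have 0: "\<phi> y = 0" if "y \<in> - ?S" for y using closure_subset[of "{x. \<phi> x \<noteq> 0}"] that by blast
  have "iter_partial \<alpha> \<phi> x = iter_partial \<alpha> (\<lambda>_. 0) x"
    by (rule iter_partial_cong[OF open_Compl[OF closed_closure] 0 x])
  then show ?thesis by (simp add: iter_partial_zero)
qed

lemma test_functions_inI:
  assumes "smooth_on UNIV \<phi>" "compact K" "\<And>x. x \<notin> K \<Longrightarrow> \<phi> x = 0"
  shows "\<phi> \<in> test_functions_in K"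
  unfolding test_functions_in_def
  using assms closure_minimal[of "{x. \<phi> x \<noteq> 0}" K] compact_imp_closed by blast

lemma test_functions_in_smooth: "\<phi> \<in> test_functions_in K \<Longrightarrow> smooth_on UNIV \<phi>"
  by (simp add: test_functions_in_def)

lemma test_functions_in_mono: "K \<subseteq> L \<Longrightarrow> test_functions_in K \<subseteq> test_functions_in L"
  by (auto simp: test_functions_in_def)

lemma test_functions_in_eq_0: "\<phi> \<in> test_functions_in K \<Longrightarrow> x \<notin> K \<Longrightarrow> \<phi> x = 0"
  using test_functions_in_support[of \<phi> K x "[]"] by simp

lemma test_function_space_in:
  assumes "compact K"
  shows "function_space (test_functions_in K)"
  unfolding function_space_def
proof (intro conjI ballI allI)
  show "(\<lambda>_. 0) \<in> test_functions_in K"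
    by (rule test_functions_inI[OF _ assms]) (simp_all add: smooth_on_const)
next
  fix f g :: "real^'a \<Rightarrow> complex" assume f: "f \<in> test_functions_in K" and g: "g \<in> test_functions_in K"
  show "(\<lambda>x. f x + g x) \<in> test_functions_in K"
    by (rule test_functions_inI[OF _ assms])
      (simp_all add: f g smooth_on_add test_functions_in_smooth[of _ K] test_functions_in_eq_0[of _ K])
next
  fix c and f :: "real^'a \<Rightarrow> complex" assume f: "f \<in> test_functions_in K"
  show "(\<lambda>x. c * f x) \<in> test_functions_in K"
    by (rule test_functions_inI[OF _ assms])
      (simp_all add: f smooth_on_mult smooth_on_const test_functions_in_smooth[of _ K] test_functions_in_eq_0[of _ K])
qed

lemma test_functionsI: "compact K \<Longrightarrow> K \<subseteq> X \<Longrightarrow> \<phi> \<in> test_functions_in K \<Longrightarrow> \<phi> \<in> test_functions X"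
  by (auto simp: test_functions_def)

lemma test_functionsE:
  assumes "\<phi> \<in> test_functions X"
  obtains K where "compact K" "K \<subseteq> X" "\<phi> \<in> test_functions_in K"
  using assms by (auto simp: test_functions_def)

lemma test_functions_smooth: "\<phi> \<in> test_functions X \<Longrightarrow> smooth_on UNIV \<phi>"
  by (auto simp: test_functions_def test_functions_in_def)

lemma test_function_space: "function_space (test_functions X)"
  unfolding function_space_def
proof (intro conjI ballI allI)
  show "(\<lambda>_. 0) \<in> test_functions X"
    using test_function_space_in[of "{}"] by (intro test_functionsI[of "{}"]) (auto simp: function_space_def)
  show "(\<lambda>x. c * f x) \<in> test_functions X" if "f \<in> test_functions X" for c f
    using that by (metis test_functionsE test_functionsI test_function_space_in function_space_scale)
  fix f g assume "f \<in> test_functions X" "g \<in> test_functions X"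
  then obtain K L where *: "compact K" "K \<subseteq> X" "f \<in> test_functions_in K" "compact L" "L \<subseteq> X" "g \<in> test_functions_in L"
    by (metis test_functionsE)
  have "f \<in> test_functions_in (K \<union> L)" "g \<in> test_functions_in (K \<union> L)"
    using * test_functions_in_mono by (metis Un_upper1 subsetD, metis Un_upper2 subsetD)
  then show "(\<lambda>x. f x + g x) \<in> test_functions X"
    using * by (intro test_functionsI[of "K \<union> L"] function_space_add test_function_space_in) auto
qed

lemma iter_partial_smooth_add:
  "smooth_on UNIV f \<Longrightarrow> smooth_on UNIV g \<Longrightarrow>
    iter_partial \<alpha> (\<lambda>x. f x + g x) x = iter_partial \<alpha> f x + iter_partial \<alpha> g x"
  by (rule iter_partial_add[of UNIV]) (auto simp: smooth_on_def)

lemma iter_partial_smooth_scale: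
  fixes c :: complex
  shows "smooth_on UNIV f \<Longrightarrow> iter_partial \<alpha> (\<lambda>x. c * f x) x = c * iter_partial \<alpha> f x"
  by (rule iter_partial_linear[OF bounded_linear_mult_right, of UNIV]) (auto simp: smooth_on_def)

lemma iter_partial_le_Cn_norm:
  assumes "\<phi> \<in> test_functions_in K" "compact K" "length \<alpha> \<le> n"
  shows "norm (iter_partial \<alpha> \<phi> x) \<le> Cn_norm n K \<phi>"
proof (cases "x \<in> K")
  case True
  then show ?thesis using assms Cn_norm_upper[OF test_functions_in_smooth, of \<phi> K K \<alpha> n x] by auto
next
  case False
  have "0 \<le> Cn_norm n K \<phi>"
  proof (cases "K = {}")
    case False
    then obtain y where "y \<in> K" by blast
    then have "norm (\<phi> y) \<le> Cn_norm n K \<phi>"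
      using assms Cn_norm_upper[OF test_functions_in_smooth, of \<phi> K K "[]" n y] by auto
    then show ?thesis using norm_ge_zero order_trans by blast
  qed (simp add: Cn_norm_def)
  with False show ?thesis using test_functions_in_support[OF assms(1) False] by simp
qed

lemma Cn_norm_nonneg: "\<phi> \<in> test_functions_in K \<Longrightarrow> compact K \<Longrightarrow> 0 \<le> Cn_norm n K \<phi>"
  by (rule order_trans[OF norm_ge_zero iter_partial_le_Cn_norm[of \<phi> K "[]" n]]) simp_all

lemma Cn_norm_mono:
  assumes "\<phi> \<in> test_functions_in K" "compact K" "m \<le> n"
  shows "Cn_norm m K \<phi> \<le> Cn_norm n K \<phi>"
  by (rule Cn_norm_least)
    (use assms(3) in \<open>simp_all add: Cn_norm_nonneg[OF assms(1,2)] iter_partial_le_Cn_norm[OF assms(1,2)]\<close>)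

lemma Cn_norm_superset:
  assumes "\<phi> \<in> test_functions_in K" "compact K" "K \<subseteq> L"
  shows "Cn_norm n L \<phi> = Cn_norm n K \<phi>"
proof (rule antisym)
  show "Cn_norm n L \<phi> \<le> Cn_norm n K \<phi>"
    by (rule Cn_norm_least) (simp_all add: Cn_norm_nonneg[OF assms(1,2)] iter_partial_le_Cn_norm[OF assms(1,2)])
  have "bdd_above (insert 0 {norm (iter_partial \<alpha> \<phi> x) |\<alpha> x. length \<alpha> \<le> n \<and> x \<in> L})"
    using Cn_norm_nonneg[OF assms(1,2)] iter_partial_le_Cn_norm[OF assms(1,2)]
    by (intro bdd_aboveI[of _ "Cn_norm n K \<phi>"]) auto
  then show "Cn_norm n K \<phi> \<le> Cn_norm n L \<phi>"
    unfolding Cn_norm_def using assms(3) by (intro cSup_subset_mono) auto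
qed

lemma seminorm_on_Cn_norm_UNIV: "seminorm_on (test_functions X) (Cn_norm n UNIV)"
proof -
  have up: "0 \<le> Cn_norm n UNIV f" "\<And>\<alpha> x. length \<alpha> \<le> n \<Longrightarrow> cmod (iter_partial \<alpha> f x) \<le> Cn_norm n UNIV f"
    if "f \<in> test_functions X" for f
  proof -
    obtain K where K: "compact K" "f \<in> test_functions_in K" using \<open>f \<in> test_functions X\<close> by (rule test_functionsE)
    show "0 \<le> Cn_norm n UNIV f" "\<And>\<alpha> x. length \<alpha> \<le> n \<Longrightarrow> cmod (iter_partial \<alpha> f x) \<le> Cn_norm n UNIV f"
      unfolding Cn_norm_superset[OF K(2,1) subset_UNIV]
      by (simp_all add: Cn_norm_nonneg[OF K(2,1)] iter_partial_le_Cn_norm[OF K(2,1)])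
  qed
  show ?thesis
  proof (rule seminorm_onI[OF test_function_space])
    fix f assume f: "f \<in> test_functions X"
    show "0 \<le> Cn_norm n UNIV f" by (rule up[OF f])
    show "Cn_norm n UNIV (\<lambda>x. c * f x) \<le> cmod c * Cn_norm n UNIV f" for c
      by (rule Cn_norm_least) (simp_all add: up[OF f] iter_partial_smooth_scale[OF test_functions_smooth[OF f]]
          norm_mult mult_left_mono)
    fix g assume g: "g \<in> test_functions X"
    show "Cn_norm n UNIV (\<lambda>x. f x + g x) \<le> Cn_norm n UNIV f + Cn_norm n UNIV g"
      by (rule Cn_norm_least) (simp_all add: up[OF f] up[OF g] norm_triangle_mono
          iter_partial_smooth_add[OF test_functions_smooth[OF f] test_functions_smooth[OF g]])
  qed
qed

lemma seminorm_on_Cn_norm: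
  assumes K: "compact K"
  shows "seminorm_on (test_functions_in K) (Cn_norm n K)"
proof -
  have "seminorm_on (test_functions_in K) (Cn_norm n UNIV)"
    using seminorm_on_Cn_norm_UNIV[of K n] test_functionsI[OF K order_refl] by (simp add: seminorm_on_def)
  then show ?thesis
    using test_function_space_in[OF K] Cn_norm_superset[OF _ K subset_UNIV, of _ n]
    unfolding seminorm_on_def function_space_def by simp
qed

text \<open>
  The \<open>C\<^sup>n\<close> norms increase with \<open>n\<close>, so the finitely many norms that bound the elements of \<open>F\<close> are dominated by a single one.
\<close>

lemma estimate_if_dominated:
  assumes K: "compact K" and F: "finite F" "C \<ge> 0"
    and est: "\<And>q. q \<in> F \<Longrightarrow> \<exists>n C. \<forall>\<phi>\<in>test_functions_in K. q \<phi> \<le> C * Cn_norm n K \<phi>"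
    and p: "\<And>\<phi>. \<phi> \<in> test_functions_in K \<Longrightarrow> p \<phi> \<le> C * (\<Sum>q\<in>F. q \<phi>)"
  shows "\<exists>n C. \<forall>\<phi>\<in>test_functions_in K. p \<phi> \<le> C * Cn_norm n K \<phi>"
proof -
  obtain N D where N: "\<And>q \<phi>. q \<in> F \<Longrightarrow> \<phi> \<in> test_functions_in K \<Longrightarrow> q \<phi> \<le> D q * Cn_norm (N q) K \<phi>"
    using est by metis
  define n where "n = Max (insert 0 (N ` F))"
  have "p \<phi> \<le> (C * (\<Sum>q\<in>F. \<bar>D q\<bar>)) * Cn_norm n K \<phi>" if \<phi>: "\<phi> \<in> test_functions_in K" for \<phi>
  proof -
    have "q \<phi> \<le> \<bar>D q\<bar> * Cn_norm n K \<phi>" if q: "q \<in> F" for q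
    proof -
      have "N q \<le> n" unfolding n_def using q F(1) by auto
      then have "D q * Cn_norm (N q) K \<phi> \<le> \<bar>D q\<bar> * Cn_norm n K \<phi>"
        using Cn_norm_mono[OF \<phi> K] Cn_norm_nonneg[OF \<phi> K] by (intro mult_mono) auto
      with N[OF q \<phi>] show ?thesis by simp
    qed
    then have "(\<Sum>q\<in>F. q \<phi>) \<le> (\<Sum>q\<in>F. \<bar>D q\<bar>) * Cn_norm n K \<phi>"
      unfolding sum_distrib_right by (rule sum_mono)
    from order_trans[OF p[OF \<phi>] mult_left_mono[OF this F(2)]] show ?thesis by (simp add: mult.assoc)
  qed
  then show ?thesis by blast
qed

lemma continuous_on_test_functions_in_iff:
  assumes K: "compact K" and p: "seminorm_on (test_functions_in K) p"
  shows "continuous_map (test_topology_in K) euclideanreal p \<longleftrightarrow>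
    (\<exists>n C. \<forall>\<phi>\<in>test_functions_in K. p \<phi> \<le> C * Cn_norm n K \<phi>)" (is "?l \<longleftrightarrow> ?r")
proof
  note E = test_function_space_in[OF K]
  have P: "seminorm_on (test_functions_in K) q" if "q \<in> {Cn_norm n K |n. True}" for q
    using that seminorm_on_Cn_norm[OF K] by auto
  {
    assume ?l
    then have "continuous_seminorm (seminorm_topology (test_functions_in K) {Cn_norm n K |n. True}) p"
      using p by (simp add: continuous_seminorm_def test_topology_in_def)
    note dom = continuous_seminorm_imp_dominated[OF E _ this]
    obtain F C where F: "finite F" "F \<subseteq> {Cn_norm n K |n. True}" "C \<ge> 0"
        "\<And>f. f \<in> test_functions_in K \<Longrightarrow> p f \<le> C * (\<Sum>q\<in>F. q f)"
      by (rule dom, erule P) (rule that)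
    have "\<exists>n C. \<forall>\<phi>\<in>test_functions_in K. q \<phi> \<le> C * Cn_norm n K \<phi>" if q: "q \<in> F" for q
    proof -
      obtain n where "q = Cn_norm n K" using q F(2) by blast
      then show ?thesis by (intro exI[of _ n] exI[of _ 1]) simp
    qed
    from estimate_if_dominated[OF K F(1,3) this F(4)] show ?r .
  }
  assume ?r
  then obtain n C where C: "\<And>\<phi>. \<phi> \<in> test_functions_in K \<Longrightarrow> p \<phi> \<le> C * Cn_norm n K \<phi>" by blast
  have "continuous_seminorm (seminorm_topology (test_functions_in K) {Cn_norm n K |n. True}) p"
  proof (rule continuous_seminorm_if_dominated[OF E P p])
    show "finite {Cn_norm n K}" "{Cn_norm n K} \<subseteq> {Cn_norm n K |n. True}" "\<bar>C\<bar> \<ge> 0" by auto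
    fix f assume f: "f \<in> test_functions_in K"
    show "p f \<le> \<bar>C\<bar> * (\<Sum>p\<in>{Cn_norm n K}. p f)"
      using C[OF f] mult_right_mono[OF abs_ge_self[of C] Cn_norm_nonneg[OF f K, of n]] by simp
  qed
  then show ?l by (simp add: continuous_seminorm_def test_topology_in_def)
qed

text \<open>
  The generating seminorms of the inductive limit topology, with their continuity on each space of
  functions supported in \<open>K\<close> made explicit as an estimate. By \<open>continuous_test_seminorm\<close> these are all
  continuous seminorms.
\<close>

definition test_seminorms :: "(real^'d::finite) set \<Rightarrow> ((real^'d \<Rightarrow> complex) \<Rightarrow> real) set" where
  "test_seminorms X = {p. seminorm_on (test_functions X) p \<and>
     (\<forall>K. compact K \<and> K \<subseteq> X \<longrightarrow> (\<exists>n C. \<forall>\<phi>\<in>test_functions_in K. p \<phi> \<le> C * Cn_norm n K \<phi>))}"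

lemma seminorm_on_subset: "seminorm_on E p \<Longrightarrow> F \<subseteq> E \<Longrightarrow> seminorm_on F p"
  unfolding seminorm_on_def by (simp add: subset_iff)

lemma test_topology_eq: "test_topology X = seminorm_topology (test_functions X) (test_seminorms X)"
proof -
  have "{p. seminorm_on (test_functions X) p \<and>
         (\<forall>K. compact K \<and> K \<subseteq> X \<longrightarrow> continuous_map (test_topology_in K) euclideanreal p)} = test_seminorms X"
    (is "?A = _")
  proof -
    have "continuous_map (test_topology_in K) euclideanreal p \<longleftrightarrow>
        (\<exists>n C. \<forall>\<phi>\<in>test_functions_in K. p \<phi> \<le> C * Cn_norm n K \<phi>)"
      if "seminorm_on (test_functions X) p" "compact K \<and> K \<subseteq> X" for p K
    proof -
      have "test_functions_in K \<subseteq> test_functions X" using that by (auto simp: test_functions_def)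
      from seminorm_on_subset[OF that(1) this] show ?thesis
        using continuous_on_test_functions_in_iff that by blast
    qed
    then show ?thesis unfolding test_seminorms_def by (simp cong: conj_cong imp_cong)
  qed
  then show ?thesis by (simp add: test_topology_def)
qed

lemma test_seminorms_seminorm: "p \<in> test_seminorms X \<Longrightarrow> seminorm_on (test_functions X) p"
  by (simp add: test_seminorms_def)

lemma continuous_test_seminorm:
  assumes "continuous_seminorm (test_topology X) p"
  shows "p \<in> test_seminorms X"
proof -
  have p: "seminorm_on (test_functions X) p"
    using assms by (simp add: continuous_seminorm_def test_topology_eq)
  note dom = continuous_seminorm_imp_dominated[OF test_function_space _ assms[unfolded test_topology_eq]]
  obtain F C where F: "finite F" "F \<subseteq> test_seminorms X" "C \<ge> 0"
      "\<And>f. f \<in> test_functions X \<Longrightarrow> p f \<le> C * (\<Sum>q\<in>F. q f)"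
    by (rule dom, erule test_seminorms_seminorm) (rule that)
  have "\<exists>n C. \<forall>\<phi>\<in>test_functions_in K. p \<phi> \<le> C * Cn_norm n K \<phi>" if K: "compact K" "K \<subseteq> X" for K
  proof (rule estimate_if_dominated[OF K(1) F(1,3) _ F(4)[OF test_functionsI[OF K]]])
    show "\<exists>n C. \<forall>\<phi>\<in>test_functions_in K. q \<phi> \<le> C * Cn_norm n K \<phi>" if "q \<in> F" for q
      using F(2) that K unfolding test_seminorms_def by blast
  qed
  with p show ?thesis by (simp add: test_seminorms_def)
qed

lemma test_seminorms_if_dominated:
  assumes "seminorm_on (test_functions X) q" "finite F" "F \<subseteq> test_seminorms X" "C \<ge> 0"
    and "\<And>f. f \<in> test_functions X \<Longrightarrow> q f \<le> C * (\<Sum>p\<in>F. p f)"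
  shows "q \<in> test_seminorms X"
  by (rule continuous_test_seminorm, unfold test_topology_eq,
      rule continuous_seminorm_if_dominated[OF test_function_space test_seminorms_seminorm assms])

text \<open>
  A linear functional \<open>u\<close> is continuous iff the seminorm \<open>\<bar>u\<bar>\<close> is.
\<close>

lemma distributions_iff:
  "u \<in> distributions X \<longleftrightarrow>
     (\<forall>\<phi>\<in>test_functions X. \<forall>\<eta>\<in>test_functions X. u (\<lambda>x. \<phi> x + \<eta> x) = u \<phi> + u \<eta>) \<and>
     (\<forall>c. \<forall>\<phi>\<in>test_functions X. u (\<lambda>x. c * \<phi> x) = c * u \<phi>) \<and>
     (\<lambda>\<phi>. cmod (u \<phi>)) \<in> test_seminorms X \<and>
     (\<forall>\<phi>. \<phi> \<notin> test_functions X \<longrightarrow> u \<phi> = 0)" (is "_ \<longleftrightarrow> ?add \<and> ?hom \<and> ?cont \<and> ?zero")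
proof -
  have "continuous_map (test_topology X) euclidean u \<longleftrightarrow> ?cont" if lin: ?add ?hom
  proof
    assume "continuous_map (test_topology X) euclidean u"
    then have "continuous_map (test_topology X) euclideanreal (\<lambda>\<phi>. cmod (u \<phi>))"
      by (rule continuous_map_norm)
    moreover have "seminorm_on (test_functions X) (\<lambda>\<phi>. cmod (u \<phi>))"
      using lin by (simp add: seminorm_on_def norm_triangle_ineq norm_mult)
    ultimately show ?cont
      by (intro continuous_test_seminorm) (simp add: continuous_seminorm_def test_topology_eq)
  next
    assume P: ?cont
    have diff: "u (\<lambda>x. g x - f x) = u g - u f" if "f \<in> test_functions X" "g \<in> test_functions X" for f g
    proof -
      have "(\<lambda>x. (-1) * f x) \<in> test_functions X"
        using function_space_scale[OF test_function_space that(1)] .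
      then have "u (\<lambda>x. g x + (-1) * f x) = u g + u (\<lambda>x. (-1) * f x)"
        by (rule lin(1)[rule_format, OF that(2)])
      also have "u (\<lambda>x. (-1) * f x) = (-1) * u f"
        by (rule lin(2)[rule_format, OF that(1)])
      finally show ?thesis by simp
    qed
    show "continuous_map (test_topology X) euclidean u"
      unfolding test_topology_eq
    proof (rule continuous_map_if_dominated[OF test_function_space test_seminorms_seminorm])
      show "finite {\<lambda>\<phi>. cmod (u \<phi>)}" "{\<lambda>\<phi>. cmod (u \<phi>)} \<subseteq> test_seminorms X" "(1::real) \<ge> 0" using P by auto
      show "dist (u g) (u f) \<le> 1 * (\<Sum>p\<in>{\<lambda>\<phi>. cmod (u \<phi>)}. p (\<lambda>x. g x - f x))"
        if "f \<in> test_functions X" "g \<in> test_functions X" for f g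
        using diff[OF that] by (simp add: dist_norm)
    qed
  qed
  then show ?thesis
    unfolding distributions_def mem_Collect_eq by (intro conj_cong refl)
qed

section \<open>Bounded sets of test functions and the strong dual\<close>

lemma test_seminorm_estimate:
  assumes "p \<in> test_seminorms X" "compact K" "K \<subseteq> X"
  obtains n C where "\<And>\<phi>. \<phi> \<in> test_functions_in K \<Longrightarrow> p \<phi> \<le> C * Cn_norm n K \<phi>"
proof -
  obtain n C where "\<forall>\<phi>\<in>test_functions_in K. p \<phi> \<le> C * Cn_norm n K \<phi>"
    using assms unfolding test_seminorms_def by auto
  then have "p \<phi> \<le> C * Cn_norm n K \<phi>" if "\<phi> \<in> test_functions_in K" for \<phi> using that by simp
  then show thesis by (rule that)
qed

text \<open>
  Taking the supremum over the whole space gives one continuous seminorm on all test functions that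
  restricts to the \<open>C\<^sup>n\<close> norm of every \<open>K\<close>.
\<close>

lemma Cn_norm_UNIV_test_seminorm: "Cn_norm n UNIV \<in> test_seminorms X"
  unfolding test_seminorms_def
proof (intro CollectI conjI allI impI seminorm_on_Cn_norm_UNIV)
  fix K assume K: "compact K \<and> K \<subseteq> X"
  have "Cn_norm n UNIV \<phi> = Cn_norm n K \<phi>" if "\<phi> \<in> test_functions_in K" for \<phi>
    using Cn_norm_superset[OF that, of UNIV n] K by simp
  then show "\<exists>m C. \<forall>\<phi>\<in>test_functions_in K. Cn_norm n UNIV \<phi> \<le> C * Cn_norm m K \<phi>"
    by (intro exI[of _ n] exI[of _ 1]) simp
qed

abbreviation "bounded_tests X \<equiv> von_Neumann_bounded (test_topology X)"

lemma von_Neumann_bounded_test_topology: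
  "bounded_tests X B \<longleftrightarrow>
    B \<subseteq> test_functions X \<and> (\<forall>p\<in>test_seminorms X. \<exists>C. \<forall>f\<in>B. p f \<le> C)"
  unfolding test_topology_eq
  by (rule von_Neumann_bounded_seminorm_topology_iff[OF test_function_space]) (rule test_seminorms_seminorm)

text \<open>
  Otherwise an exhaustion of \<open>X\<close> by compact sets \<open>Q n\<close> yields functions \<open>\<phi> n\<close> in \<open>B\<close> and points \<open>x n\<close> outside
  \<open>Q n\<close> with \<open>\<phi> n (x n) \<noteq> 0\<close>. A compact set contains only finitely many of these points, so
  \<open>\<eta> \<mapsto> \<Sum>\<^sub>n n \<bar>\<eta>(x n)\<bar> / \<bar>\<phi> n (x n)\<bar>\<close> is a continuous seminorm; it is at least \<open>n\<close> at \<open>\<phi> n\<close>.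
\<close>

lemma bounded_imp_common_support:
  assumes "open X" and B: "bounded_tests X B"
  shows "\<exists>K. compact K \<and> K \<subseteq> X \<and> B \<subseteq> test_functions_in K"
proof (rule ccontr)
  assume contr: "\<not> ?thesis"
  obtain Q where Q: "\<And>n. compact (Q n)" "\<And>n. Q n \<subseteq> X"
      "\<And>K. \<lbrakk>compact K; K \<subseteq> X\<rbrakk> \<Longrightarrow> \<exists>N::nat. \<forall>n\<ge>N. K \<subseteq> Q n"
    using open_Union_compact_subsets[OF \<open>open X\<close>] by metis
  have BX: "B \<subseteq> test_functions X" using B by (simp add: von_Neumann_bounded_test_topology)
  have "\<exists>\<phi> x. \<phi> \<in> B \<and> x \<notin> Q n \<and> \<phi> x \<noteq> 0" for n
  proof (rule ccontr)
    assume "\<nexists>\<phi> x. \<phi> \<in> B \<and> x \<notin> Q n \<and> \<phi> x \<noteq> 0"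
    then have "\<phi> \<in> test_functions_in (Q n)" if "\<phi> \<in> B" for \<phi>
      using that BX by (intro test_functions_inI[OF test_functions_smooth Q(1), of \<phi> X]) auto
    with contr Q(1,2) show False by blast
  qed
  then obtain \<phi> x where \<phi>: "\<And>n. \<phi> n \<in> B" and x: "\<And>n. x n \<notin> Q n" and nz: "\<And>n. \<phi> n (x n) \<noteq> 0"
    by metis
  define a where "a = (\<lambda>n::nat. real n / cmod (\<phi> n (x n)))"
  have a: "a n \<ge> 0" for n by (simp add: a_def)
  define p where "p = (\<lambda>\<eta>. \<Sum>n. a n * cmod (\<eta> (x n)))"
  have zero: "\<exists>N. \<forall>n\<ge>N. \<forall>\<eta>\<in>test_functions_in K. \<eta> (x n) = 0" if K: "compact K" "K \<subseteq> X" for K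
  proof -
    obtain N where N: "\<And>n. n \<ge> N \<Longrightarrow> K \<subseteq> Q n" using Q(3)[OF K] by blast
    have "\<eta> (x n) = 0" if "n \<ge> N" "\<eta> \<in> test_functions_in K" for n \<eta>
      using test_functions_in_eq_0[OF that(2)] N[OF that(1)] x by blast
    then show ?thesis by blast
  qed
  have summable: "summable (\<lambda>n. a n * cmod (\<eta> (x n)))" if \<eta>: "\<eta> \<in> test_functions X" for \<eta>
  proof -
    obtain K where K: "compact K" "K \<subseteq> X" "\<eta> \<in> test_functions_in K" using \<eta> by (rule test_functionsE)
    obtain N where "\<And>n. n \<ge> N \<Longrightarrow> \<eta> (x n) = 0" using zero[OF K(1,2)] K(3) by blast
    then show ?thesis by (intro summable_finite[of "{..<N}"]) auto
  qed
  have "seminorm_on (test_functions X) p"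
  proof (rule seminorm_onI[OF test_function_space])
    fix f assume f: "f \<in> test_functions X"
    show "0 \<le> p f" unfolding p_def by (rule suminf_nonneg[OF summable[OF f]]) (simp add: a)
    show "p (\<lambda>x. c * f x) \<le> cmod c * p f" for c
      using suminf_mult[OF summable[OF f], of "cmod c"] by (simp add: p_def norm_mult mult.left_commute)
    fix g assume g: "g \<in> test_functions X"
    have "p (\<lambda>x. f x + g x) \<le> (\<Sum>n. a n * cmod (f (x n)) + a n * cmod (g (x n)))"
      unfolding p_def
    proof (rule suminf_le)
      show "a n * cmod (f (x n) + g (x n)) \<le> a n * cmod (f (x n)) + a n * cmod (g (x n))" for n
        unfolding distrib_left[symmetric] by (intro mult_left_mono norm_triangle_ineq a)
    qed (rule summable[OF function_space_add[OF test_function_space f g]]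
        summable_add[OF summable[OF f] summable[OF g]])+
    also have "\<dots> = p f + p g"
      unfolding p_def by (rule suminf_add[OF summable[OF f] summable[OF g], symmetric])
    finally show "p (\<lambda>x. f x + g x) \<le> p f + p g" .
  qed
  moreover have "\<exists>n C. \<forall>\<eta>\<in>test_functions_in K. p \<eta> \<le> C * Cn_norm n K \<eta>" if K: "compact K" "K \<subseteq> X" for K
  proof -
    obtain N where N: "\<And>n \<eta>. n \<ge> N \<Longrightarrow> \<eta> \<in> test_functions_in K \<Longrightarrow> \<eta> (x n) = 0"
      using zero[OF K] by blast
    have "p \<eta> \<le> (\<Sum>n<N. a n) * Cn_norm 0 K \<eta>" if \<eta>: "\<eta> \<in> test_functions_in K" for \<eta>
    proof -
      have "p \<eta> = (\<Sum>n<N. a n * cmod (\<eta> (x n)))"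
        unfolding p_def by (rule suminf_finite) (use N[OF _ \<eta>] in auto)
      moreover have "cmod (\<eta> y) \<le> Cn_norm 0 K \<eta>" for y
        using iter_partial_le_Cn_norm[OF \<eta> K(1), of "[]" 0] by simp
      ultimately show ?thesis
        unfolding sum_distrib_right by (simp add: sum_mono mult_left_mono a)
    qed
    then show ?thesis by blast
  qed
  ultimately have "p \<in> test_seminorms X" by (simp add: test_seminorms_def)
  then obtain C where C: "\<And>f. f \<in> B \<Longrightarrow> p f \<le> C"
    using B unfolding von_Neumann_bounded_test_topology by blast
  obtain k :: nat where k: "real k > C" using reals_Archimedean2 by blast
  have "\<phi> k \<in> test_functions X" using \<phi> BX by blast
  note term_le = sum_le_suminf[OF summable[OF this], of "{k}"]
  have "real k = a k * cmod (\<phi> k (x k))" using nz[of k] by (simp add: a_def)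
  also have "\<dots> \<le> p (\<phi> k)" using term_le a by (simp add: p_def)
  also have "\<dots> \<le> C" by (rule C[OF \<phi>])
  finally show False using k by simp
qed

lemma von_Neumann_bounded_test_iff:
  assumes "open X"
  shows "bounded_tests X B \<longleftrightarrow>
    (\<exists>K. compact K \<and> K \<subseteq> X \<and> B \<subseteq> test_functions_in K \<and> (\<forall>n. \<exists>C. \<forall>\<phi>\<in>B. Cn_norm n K \<phi> \<le> C))"
    (is "?l \<longleftrightarrow> ?r")
proof
  assume l: ?l
  then obtain K where K: "compact K" "K \<subseteq> X" "B \<subseteq> test_functions_in K"
    using bounded_imp_common_support[OF assms] by blast
  have "\<exists>C. \<forall>\<phi>\<in>B. Cn_norm n K \<phi> \<le> C" for n
  proof -
    obtain C where C: "\<And>\<phi>. \<phi> \<in> B \<Longrightarrow> Cn_norm n UNIV \<phi> \<le> C"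
      using l Cn_norm_UNIV_test_seminorm[of n X] unfolding von_Neumann_bounded_test_topology by blast
    have "Cn_norm n K \<phi> \<le> C" if "\<phi> \<in> B" for \<phi>
      using C[OF that] Cn_norm_superset[of \<phi> K UNIV n] K that by auto
    then show ?thesis by blast
  qed
  with K show ?r by blast
next
  assume ?r
  then obtain K where K: "compact K" "K \<subseteq> X" "B \<subseteq> test_functions_in K"
    and bd: "\<And>n. \<exists>C. \<forall>\<phi>\<in>B. Cn_norm n K \<phi> \<le> C" by blast
  show ?l
    unfolding von_Neumann_bounded_test_topology
  proof (intro conjI ballI)
    show "B \<subseteq> test_functions X" using K by (auto simp: test_functions_def)
    fix p assume p: "p \<in> test_seminorms X"
    obtain n C where C: "\<And>\<phi>. \<phi> \<in> test_functions_in K \<Longrightarrow> p \<phi> \<le> C * Cn_norm n K \<phi>"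
      by (rule test_seminorm_estimate[OF p K(1,2)]) (rule that)
    obtain D where D: "\<And>\<phi>. \<phi> \<in> B \<Longrightarrow> Cn_norm n K \<phi> \<le> D" using bd[of n] by auto
    have "p \<phi> \<le> \<bar>C\<bar> * D" if "\<phi> \<in> B" for \<phi>
    proof -
      have \<phi>: "\<phi> \<in> test_functions_in K" using K that by blast
      have "p \<phi> \<le> C * Cn_norm n K \<phi>" by (rule C[OF \<phi>])
      also have "\<dots> \<le> \<bar>C\<bar> * D" using D[OF that] Cn_norm_nonneg[OF \<phi> K(1)] by (intro mult_mono) auto
      finally show ?thesis .
    qed
    then show "\<exists>C. \<forall>f\<in>B. p f \<le> C" by blast
  qed
qed

lemma von_Neumann_bounded_test_UN:
  assumes "finite I" "\<And>i. i \<in> I \<Longrightarrow> bounded_tests X (B i)"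
  shows "bounded_tests X (\<Union>i\<in>I. B i)"
  unfolding von_Neumann_bounded_test_topology
proof (intro conjI ballI)
  show "(\<Union>i\<in>I. B i) \<subseteq> test_functions X"
    using assms(2) unfolding von_Neumann_bounded_test_topology by blast
  fix p assume p: "p \<in> test_seminorms X"
  have "\<forall>i\<in>I. \<exists>C. \<forall>f\<in>B i. p f \<le> C"
    using assms(2) p unfolding von_Neumann_bounded_test_topology by blast
  then obtain C where C: "\<And>i f. i \<in> I \<Longrightarrow> f \<in> B i \<Longrightarrow> p f \<le> C i" by metis
  have "p f \<le> Max (insert 0 (C ` I))" if "i \<in> I" "f \<in> B i" for i f
    using C[OF that] that assms(1) by (meson Max_ge finite_imageI finite_insert image_eqI insertCI order_trans)
  then show "\<exists>C. \<forall>f\<in>\<Union>i\<in>I. B i. p f \<le> C" by blast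
qed

lemma von_Neumann_bounded_test_singleton:
  "\<phi> \<in> test_functions X \<Longrightarrow> bounded_tests X {\<phi>}"
  unfolding von_Neumann_bounded_test_topology by auto

lemma distribution_seminorm: "u \<in> distributions X \<Longrightarrow> (\<lambda>\<phi>. cmod (u \<phi>)) \<in> test_seminorms X"
  by (simp add: distributions_iff)

lemma distributionI:
  assumes lin: "\<And>\<phi> \<eta>. \<phi> \<in> test_functions X \<Longrightarrow> \<eta> \<in> test_functions X \<Longrightarrow> u (\<lambda>x. \<phi> x + \<eta> x) = u \<phi> + u \<eta>"
      "\<And>c \<phi>. \<phi> \<in> test_functions X \<Longrightarrow> u (\<lambda>x. c * \<phi> x) = c * u \<phi>"
    and F: "finite F" "F \<subseteq> test_seminorms X" "C \<ge> 0"
      "\<And>\<phi>. \<phi> \<in> test_functions X \<Longrightarrow> cmod (u \<phi>) \<le> C * (\<Sum>p\<in>F. p \<phi>)"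
    and "\<And>\<phi>. \<phi> \<notin> test_functions X \<Longrightarrow> u \<phi> = 0"
  shows "u \<in> distributions X"
proof -
  have "seminorm_on (test_functions X) (\<lambda>\<phi>. cmod (u \<phi>))"
    using lin by (simp add: seminorm_on_def norm_triangle_ineq norm_mult)
  from test_seminorms_if_dominated[OF this F] show ?thesis
    using assms by (simp add: distributions_iff)
qed

lemma function_space_distributions: "function_space (distributions X)"
  unfolding function_space_def
proof (intro conjI ballI allI)
  show "(\<lambda>_. 0) \<in> distributions X" by (rule distributionI[of _ _ "{}" 0]) simp_all
next
  fix u v assume u: "u \<in> distributions X" and v: "v \<in> distributions X"
  let ?p = "\<lambda>\<phi>. cmod (u \<phi>)" and ?q = "\<lambda>\<phi>. cmod (v \<phi>)"
  show "(\<lambda>\<phi>. u \<phi> + v \<phi>) \<in> distributions X"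
  proof (rule distributionI[of _ _ "{?p, ?q}" 2])
    show "cmod (u \<phi> + v \<phi>) \<le> 2 * (\<Sum>r\<in>{?p, ?q}. r \<phi>)" for \<phi>
      using norm_triangle_ineq[of "u \<phi>" "v \<phi>"] by (cases "?p = ?q") (simp_all add: fun_eq_iff, smt (verit) norm_ge_zero)
  qed (use u v in \<open>simp_all add: distributions_iff distrib_left\<close>)
next
  fix c u assume u: "u \<in> distributions X"
  show "(\<lambda>\<phi>. c * u \<phi>) \<in> distributions X"
    by (rule distributionI[of _ _ "{\<lambda>\<phi>. cmod (u \<phi>)}" "cmod c"])
      (use u in \<open>simp_all add: distributions_iff norm_mult distrib_left mult.left_commute\<close>)
qed

lemma distributions_bounded_on:
  assumes u: "u \<in> distributions X" and B: "bounded_tests X B"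
  shows "bdd_above ((\<lambda>\<phi>. cmod (u \<phi>)) ` B)"
proof -
  obtain C where "\<forall>\<phi>\<in>B. cmod (u \<phi>) \<le> C"
    using B distribution_seminorm[OF u] unfolding von_Neumann_bounded_test_topology by meson
  then show ?thesis by (intro bdd_aboveI2[of _ _ C]) simp
qed

definition dual_seminorms :: "(real^'d::finite) set \<Rightarrow> (((real^'d \<Rightarrow> complex) \<Rightarrow> complex) \<Rightarrow> real) set" where
  "dual_seminorms X = {(\<lambda>u. SUP \<phi>\<in>B. cmod (u \<phi>)) | B. bounded_tests X B \<and> B \<noteq> {}}"

lemma strong_dual_topology_eq:
  "strong_dual_topology X = seminorm_topology (distributions X) (dual_seminorms X)"
  by (simp add: strong_dual_topology_def dual_seminorms_def)

lemma dual_seminorms_seminorm: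
  assumes "p \<in> dual_seminorms X"
  shows "seminorm_on (distributions X) p"
proof -
  obtain B where p: "p = (\<lambda>u. SUP \<phi>\<in>B. cmod (u \<phi>))" and B: "bounded_tests X B" "B \<noteq> {}"
    using assms by (auto simp: dual_seminorms_def)
  have up: "cmod (u \<phi>) \<le> p u" if "u \<in> distributions X" "\<phi> \<in> B" for u \<phi>
    unfolding p by (rule cSUP_upper[OF that(2) distributions_bounded_on[OF that(1) B(1)]])
  have least: "p u \<le> C" if "\<And>\<phi>. \<phi> \<in> B \<Longrightarrow> cmod (u \<phi>) \<le> C" for u C
    unfolding p by (rule cSUP_least[OF B(2) that])
  show ?thesis
  proof (rule seminorm_onI[OF function_space_distributions])
    show "0 \<le> p u" if "u \<in> distributions X" for u
      using up[OF that] B(2) norm_ge_zero order_trans by (metis ex_in_conv)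
    show "p (\<lambda>x. u x + v x) \<le> p u + p v" if "u \<in> distributions X" "v \<in> distributions X" for u v
      by (rule least) (intro norm_triangle_mono up that)
    show "p (\<lambda>x. c * u x) \<le> cmod c * p u" if "u \<in> distributions X" for c u
      by (rule least) (simp add: norm_mult mult_left_mono up that)
  qed
qed

text \<open>
  Finite unions of bounded sets are bounded, so one supremum seminorm dominates finitely many.
\<close>

lemma continuous_dual_seminorm_dominated:
  assumes q: "continuous_seminorm (strong_dual_topology X) q"
  obtains B C where "bounded_tests X B" "B \<noteq> {}" "C \<ge> 0"
    "\<And>u. u \<in> distributions X \<Longrightarrow> q u \<le> C * (SUP \<phi>\<in>B. cmod (u \<phi>))"
proof -
  note dom = continuous_seminorm_imp_dominated[OF function_space_distributions _ q[unfolded strong_dual_topology_eq]]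
  obtain F C where F: "finite F" "F \<subseteq> dual_seminorms X" "C \<ge> 0"
      "\<And>u. u \<in> distributions X \<Longrightarrow> q u \<le> C * (\<Sum>p\<in>F. p u)"
    by (rule dom, erule dual_seminorms_seminorm) (rule that)
  have "\<forall>p\<in>F. \<exists>B. p = (\<lambda>u. SUP \<phi>\<in>B. cmod (u \<phi>)) \<and> bounded_tests X B \<and> B \<noteq> {}"
    using F(2) unfolding dual_seminorms_def by blast
  then obtain b where b: "\<And>p. p \<in> F \<Longrightarrow> p = (\<lambda>u. SUP \<phi>\<in>b p. cmod (u \<phi>))"
    "\<And>p. p \<in> F \<Longrightarrow> bounded_tests X (b p)" "\<And>p. p \<in> F \<Longrightarrow> b p \<noteq> {}"
    by metis
  \<comment> \<open>The zero function makes \<open>B\<close> nonempty when \<open>F\<close> is empty.\<close>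
  define B where "B = (\<Union>i\<in>insert None (Some ` F). case i of None \<Rightarrow> {\<lambda>_. 0} | Some p \<Rightarrow> b p)"
  have "(\<lambda>_. 0) \<in> test_functions X"
    using test_function_space[of X] by (simp add: function_space_def)
  then have B: "bounded_tests X B"
    unfolding B_def using F(1) b(2)
    by (intro von_Neumann_bounded_test_UN) (auto simp: von_Neumann_bounded_test_singleton)
  have "q u \<le> (C * card F) * (SUP \<phi>\<in>B. cmod (u \<phi>))" if u: "u \<in> distributions X" for u
  proof -
    have "p u \<le> (SUP \<phi>\<in>B. cmod (u \<phi>))" if "p \<in> F" for p
    proof -
      have "b p \<subseteq> B" unfolding B_def using that by auto
      then have "(SUP \<phi>\<in>b p. cmod (u \<phi>)) \<le> (SUP \<phi>\<in>B. cmod (u \<phi>))"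
        by (intro cSUP_subset_mono b(3) that distributions_bounded_on[OF u B]) auto
      then show ?thesis using b(1)[OF that] by metis
    qed
    then have "(\<Sum>p\<in>F. p u) \<le> card F * (SUP \<phi>\<in>B. cmod (u \<phi>))" by (intro sum_bounded_above) auto
    then have "C * (\<Sum>p\<in>F. p u) \<le> C * (card F * (SUP \<phi>\<in>B. cmod (u \<phi>)))" using F(3) by (rule mult_left_mono)
    with F(4)[OF u] show ?thesis by (simp add: mult.assoc)
  qed
  moreover have "B \<noteq> {}" unfolding B_def by auto
  moreover have "C * card F \<ge> 0" using F(3) by simp
  ultimately show thesis using that B by blast
qed

text \<open>
  Up to sign, \<open>\<partial>\<^sup>\<alpha>\<delta>\<^sub>x\<close>. Estimates that hold for all distributions become \<open>C\<^sup>n\<close> estimates for test functions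
  through these functionals.
\<close>

lemma derivative_evaluation_distribution:
  "(\<lambda>\<phi>. if \<phi> \<in> test_functions X then iter_partial \<alpha> \<phi> x else 0) \<in> distributions X"
proof (rule distributionI[of _ _ "{Cn_norm (length \<alpha>) UNIV}" 1])
  fix \<phi> assume \<phi>: "\<phi> \<in> test_functions X"
  then obtain K where K: "compact K" "\<phi> \<in> test_functions_in K" by (rule test_functionsE)
  show "cmod (if \<phi> \<in> test_functions X then iter_partial \<alpha> \<phi> x else 0) \<le> 1 * (\<Sum>p\<in>{Cn_norm (length \<alpha>) UNIV}. p \<phi>)"
    using \<phi> iter_partial_le_Cn_norm[OF K(2,1) order_refl, of \<alpha> x] Cn_norm_superset[OF K(2,1) subset_UNIV] by simp
qed (simp_all add: Cn_norm_UNIV_test_seminorm function_space_add[OF test_function_space]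
    function_space_scale[OF test_function_space] iter_partial_smooth_add iter_partial_smooth_scale
    test_functions_smooth[of _ X])

section \<open>Power bounded transposes\<close>

text \<open>
  A continuous linear operator on test functions, where continuity is expressed by pulling back
  continuous seminorms.
\<close>

definition continuous_test_map ::
    "(real^'d::finite) set \<Rightarrow> ((real^'d \<Rightarrow> complex) \<Rightarrow> real^'d \<Rightarrow> complex) \<Rightarrow> bool" where
  "continuous_test_map X S \<longleftrightarrow>
     (\<forall>\<phi>\<in>test_functions X. S \<phi> \<in> test_functions X) \<and>
     (\<forall>\<phi>\<in>test_functions X. \<forall>\<eta>\<in>test_functions X. S (\<lambda>x. \<phi> x + \<eta> x) = (\<lambda>x. S \<phi> x + S \<eta> x)) \<and>
     (\<forall>c. \<forall>\<phi>\<in>test_functions X. S (\<lambda>x. c * \<phi> x) = (\<lambda>x. c * S \<phi> x)) \<and>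
     (\<forall>p\<in>test_seminorms X. (\<lambda>\<phi>. p (S \<phi>)) \<in> test_seminorms X)"

definition transpose_on ::
    "(real^'d::finite) set \<Rightarrow> ((real^'d \<Rightarrow> complex) \<Rightarrow> real^'d \<Rightarrow> complex) \<Rightarrow>
     ((real^'d \<Rightarrow> complex) \<Rightarrow> complex) \<Rightarrow> (real^'d \<Rightarrow> complex) \<Rightarrow> complex" where
  "transpose_on X S u \<phi> = (if \<phi> \<in> test_functions X then u (S \<phi>) else 0)"

lemma transpose_on_SUP:
  assumes "bounded_tests X B"
  shows "(SUP \<phi>\<in>B. cmod (transpose_on X S u \<phi>)) = (SUP \<phi>\<in>S ` B. cmod (u \<phi>))"
proof -
  have "B \<subseteq> test_functions X" using assms by (simp add: von_Neumann_bounded_test_topology)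
  then show ?thesis
    by (intro arg_cong[where f = Sup]) (auto simp: transpose_on_def image_image intro!: image_cong)
qed

context
  fixes X :: "(real^'d::finite) set" and S
  assumes S: "continuous_test_map X S"
begin

lemma continuous_test_map_in: "\<phi> \<in> test_functions X \<Longrightarrow> S \<phi> \<in> test_functions X"
  using S by (simp add: continuous_test_map_def)

lemma continuous_test_map_seminorm: "p \<in> test_seminorms X \<Longrightarrow> (\<lambda>\<phi>. p (S \<phi>)) \<in> test_seminorms X"
  using S by (simp add: continuous_test_map_def)

lemma continuous_test_map_funpow_in: "\<phi> \<in> test_functions X \<Longrightarrow> (S ^^ m) \<phi> \<in> test_functions X"
  by (induction m) (simp_all add: continuous_test_map_in)

lemma continuous_test_map_bounded:
  assumes "bounded_tests X B"
  shows "bounded_tests X (S ` B)"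
proof -
  have "\<exists>C. \<forall>\<eta>\<in>S ` B. p \<eta> \<le> C" if "p \<in> test_seminorms X" for p
    using assms continuous_test_map_seminorm[OF that] unfolding von_Neumann_bounded_test_topology by simp
  then show ?thesis
    using assms unfolding von_Neumann_bounded_test_topology by (auto simp: continuous_test_map_in)
qed

lemma transpose_on_distribution:
  assumes u: "u \<in> distributions X"
  shows "transpose_on X S u \<in> distributions X"
proof (rule distributionI[of _ _ "{\<lambda>\<phi>. cmod (u (S \<phi>))}" 1])
  show "{\<lambda>\<phi>. cmod (u (S \<phi>))} \<subseteq> test_seminorms X"
    using continuous_test_map_seminorm[OF distribution_seminorm[OF u]] by simp
qed (use S u in \<open>simp_all add: transpose_on_def continuous_test_map_def distributions_iff
    function_space_add[OF test_function_space] function_space_scale[OF test_function_space]\<close>)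

lemma transpose_on_funpow:
  assumes u: "u \<in> distributions X"
  shows "(transpose_on X S ^^ m) u = transpose_on X (S ^^ m) u"
    and "transpose_on X (S ^^ m) u \<in> distributions X"
proof -
  show eq: "(transpose_on X S ^^ m) u = transpose_on X (S ^^ m) u"
  proof (induction m)
    case 0
    show ?case using assms by (auto simp: transpose_on_def distributions_iff)
  next
    case (Suc m)
    have "(transpose_on X S ^^ Suc m) u = transpose_on X S (transpose_on X (S ^^ m) u)"
      by (simp add: Suc)
    also have "\<dots> = transpose_on X (S ^^ Suc m) u"
      by (rule ext) (simp add: transpose_on_def continuous_test_map_in funpow_swap1)
    finally show ?case .
  qed
  have "(transpose_on X S ^^ m) u \<in> distributions X"
    by (induction m) (simp_all add: u transpose_on_distribution)
  then show "transpose_on X (S ^^ m) u \<in> distributions X" unfolding eq .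
qed

lemma transpose_on_continuous_linear:
  "continuous_linear_operator (strong_dual_topology X) (transpose_on X S)"
  unfolding continuous_linear_operator_def
proof (intro conjI)
  show "continuous_map (strong_dual_topology X) (strong_dual_topology X) (transpose_on X S)"
    unfolding strong_dual_topology_eq
  proof (rule continuous_map_self_if_dominated[OF function_space_distributions])
    fix p :: "((real^'d \<Rightarrow> complex) \<Rightarrow> complex) \<Rightarrow> real" assume "p \<in> dual_seminorms X"
    then obtain B where p: "p = (\<lambda>u. SUP \<phi>\<in>B. cmod (u \<phi>))" and B: "bounded_tests X B" "B \<noteq> {}"
      by (auto simp: dual_seminorms_def)
    have "(\<lambda>u. SUP \<phi>\<in>S ` B. cmod (u \<phi>)) \<in> dual_seminorms X"
      using continuous_test_map_bounded[OF B(1)] B(2) by (auto simp: dual_seminorms_def)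
    then show "\<exists>q\<in>dual_seminorms X. \<forall>u\<in>distributions X. p (transpose_on X S u) \<le> q u"
      by (rule bexI[rotated]) (simp add: p transpose_on_SUP[OF B(1)])
  qed (auto simp: transpose_on_distribution dual_seminorms_seminorm transpose_on_def)
qed (auto simp: strong_dual_topology_eq transpose_on_def)

end

text \<open>
  If the orbit of every bounded set \<open>B\<close> under \<open>S\<close> is bounded, then the supremum over that orbit is a
  seminorm on the dual that dominates all \<open>\<bar>(S\<^sup>m)\<^sup>t u\<bar>\<^sub>B\<close>. Conversely, power boundedness gives a bounded set \<open>B'\<close>
  with \<open>\<bar>u(S\<^sup>m \<phi>)\<bar> \<le> C sup\<^bsub>\<eta>\<in>B'\<^esub> \<bar>u(\<eta>)\<bar>\<close> for every distribution \<open>u\<close>, \<open>m \<ge> 1\<close> and \<open>\<phi>\<close> in \<open>B\<close>. Inserting derivatives of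
  Dirac functionals bounds the support and all derivatives of \<open>S\<^sup>m \<phi>\<close> by those of the elements of \<open>B'\<close>.
\<close>

lemma power_bounded_transpose_on_iff:
  fixes X :: "(real^'d::finite) set"
  assumes X: "open X" and S: "continuous_test_map X S"
  shows "power_bounded (strong_dual_topology X) (transpose_on X S) \<longleftrightarrow>
    (\<forall>B. bounded_tests X B \<longrightarrow>
      bounded_tests X (\<Union>m\<in>{1..}. (S ^^ m) ` B))" (is "?l \<longleftrightarrow> ?r")
proof
  assume r: ?r
  show ?l
    unfolding power_bounded_def
  proof (intro conjI allI impI transpose_on_continuous_linear[OF S])
    fix p assume "continuous_seminorm (strong_dual_topology X) p"
    then obtain B C where B: "bounded_tests X B" "B \<noteq> {}" "C \<ge> 0"
      and p: "\<And>u. u \<in> distributions X \<Longrightarrow> p u \<le> C * (SUP \<phi>\<in>B. cmod (u \<phi>))"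
      by (rule continuous_dual_seminorm_dominated) (rule that)
    let ?B = "\<Union>m\<in>{1..}. (S ^^ m) ` B"
    let ?q = "\<lambda>u. SUP \<phi>\<in>?B. cmod (u \<phi>)"
    have B': "bounded_tests X ?B" using r B(1) by simp
    have "?B \<noteq> {}" using B(2) by force
    with B' have q: "?q \<in> dual_seminorms X" by (auto simp: dual_seminorms_def)
    let ?Cq = "\<lambda>u. C * ?q u"
    have "seminorm_on (distributions X) ?Cq"
      using dual_seminorms_seminorm[OF q] B(3)
      unfolding seminorm_on_def by (simp add: mult_left_mono mult.left_commute flip: distrib_left)
    moreover have "{?q} \<subseteq> dual_seminorms X" using q by simp
    ultimately have cont: "continuous_seminorm (strong_dual_topology X) ?Cq"
      unfolding strong_dual_topology_eq
      by (intro continuous_seminorm_if_dominated[OF function_space_distributions dual_seminorms_seminorm, where F = "{?q}" and C = C])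
        (use B(3) in auto)
    have "p ((transpose_on X S ^^ m) u) \<le> C * ?q u" if m: "m \<ge> 1" and u: "u \<in> distributions X" for m u
    proof -
      have "p ((transpose_on X S ^^ m) u) \<le> C * (SUP \<phi>\<in>(S ^^ m) ` B. cmod (u \<phi>))"
        using p[OF transpose_on_funpow(2)[OF S u]]
        unfolding transpose_on_funpow(1)[OF S u] transpose_on_SUP[OF B(1)] .
      also have "(SUP \<phi>\<in>(S ^^ m) ` B. cmod (u \<phi>)) \<le> ?q u"
        using B(2) m by (intro cSUP_subset_mono distributions_bounded_on[OF u B']) auto
      finally show ?thesis using B(3) by (simp add: mult_left_mono)
    qed
    with cont show "\<exists>q. continuous_seminorm (strong_dual_topology X) q \<and>
        (\<forall>m\<ge>1. \<forall>f\<in>topspace (strong_dual_topology X). p ((transpose_on X S ^^ m) f) \<le> q f)"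
      by (intro exI[of _ ?Cq]) (simp add: strong_dual_topology_eq)
  qed
next
  assume l: ?l
  show ?r
  proof (intro allI impI)
    fix B assume B: "bounded_tests X B"
    show "bounded_tests X (\<Union>m\<in>{1..}. (S ^^ m) ` B)"
    proof (cases "B = {}")
      case True
      then show ?thesis by (simp add: von_Neumann_bounded_test_topology)
    next
      case False
      let ?p = "\<lambda>u. SUP \<phi>\<in>B. cmod (u \<phi>)"
      have p: "?p \<in> dual_seminorms X" using B False by (auto simp: dual_seminorms_def)
      then have "continuous_seminorm (strong_dual_topology X) ?p"
        unfolding strong_dual_topology_eq
        by (intro continuous_seminorm_if_dominated[OF function_space_distributions dual_seminorms_seminorm, where F = "{?p}" and C = 1])
          (auto simp: dual_seminorms_seminorm)
      then obtain q where q: "continuous_seminorm (strong_dual_topology X) q"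
        and pq: "\<And>m u. m \<ge> 1 \<Longrightarrow> u \<in> distributions X \<Longrightarrow> ?p ((transpose_on X S ^^ m) u) \<le> q u"
        using l unfolding power_bounded_def by (force simp: strong_dual_topology_eq)
      obtain B' C where B': "bounded_tests X B'" "B' \<noteq> {}" "C \<ge> 0"
        and qB: "\<And>u. u \<in> distributions X \<Longrightarrow> q u \<le> C * (SUP \<phi>\<in>B'. cmod (u \<phi>))"
        by (rule continuous_dual_seminorm_dominated[OF q]) (rule that)
      obtain L where L: "compact L" "L \<subseteq> X" "B' \<subseteq> test_functions_in L" and bd: "\<And>n. \<exists>C. \<forall>\<phi>\<in>B'. Cn_norm n L \<phi> \<le> C"
        using B'(1) unfolding von_Neumann_bounded_test_iff[OF X] by auto
      have BX: "B \<subseteq> test_functions X" and B'X: "B' \<subseteq> test_functions X"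
        using B B'(1) by (simp_all add: von_Neumann_bounded_test_topology)
      have main: "cmod (iter_partial \<alpha> ((S ^^ m) \<phi>) x) \<le> C * D"
        if m: "m \<ge> 1" and \<phi>: "\<phi> \<in> B" and D: "\<And>\<eta>. \<eta> \<in> B' \<Longrightarrow> cmod (iter_partial \<alpha> \<eta> x) \<le> D" for \<alpha> m \<phi> x D
      proof -
        let ?u = "\<lambda>\<phi>. if \<phi> \<in> test_functions X then iter_partial \<alpha> \<phi> x else 0"
        have u: "?u \<in> distributions X" by (rule derivative_evaluation_distribution)
        have "(S ^^ m) \<phi> \<in> test_functions X"
          using continuous_test_map_funpow_in[OF S] \<phi> BX by auto
        then have "cmod (iter_partial \<alpha> ((S ^^ m) \<phi>) x) = cmod (transpose_on X (S ^^ m) ?u \<phi>)"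
          using \<phi> BX by (auto simp: transpose_on_def)
        also have "\<dots> \<le> (SUP \<phi>\<in>B. cmod (transpose_on X (S ^^ m) ?u \<phi>))"
          by (rule cSUP_upper[OF \<phi> distributions_bounded_on[OF transpose_on_funpow(2)[OF S u] B]])
        also have "\<dots> \<le> q ?u"
          using pq[OF m u] unfolding transpose_on_funpow(1)[OF S u] .
        also have "\<dots> \<le> C * (SUP \<phi>\<in>B'. cmod (?u \<phi>))" by (rule qB[OF u])
        also have "(SUP \<phi>\<in>B'. cmod (?u \<phi>)) \<le> D"
          using D B'X by (intro cSUP_least[OF B'(2)]) auto
        finally show ?thesis using B'(3) by (simp add: mult_left_mono)
      qed
      have in_L: "(S ^^ m) \<phi> \<in> test_functions_in L" if m: "m \<ge> 1" and \<phi>: "\<phi> \<in> B" for m \<phi>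
      proof (rule test_functions_inI[OF _ L(1)])
        have "(S ^^ m) \<phi> \<in> test_functions X"
          by (rule continuous_test_map_funpow_in[OF S]) (use \<phi> BX in auto)
        then show "smooth_on UNIV ((S ^^ m) \<phi>)" by (rule test_functions_smooth)
        fix x assume x: "x \<notin> L"
        have "cmod (iter_partial [] ((S ^^ m) \<phi>) x) \<le> C * 0"
          by (rule main[OF m \<phi>]) (use test_functions_in_eq_0[of _ L x] L(3) x in auto)
        then show "(S ^^ m) \<phi> x = 0" by simp
      qed
      have "\<exists>D. \<forall>\<eta>\<in>(\<Union>m\<in>{1..}. (S ^^ m) ` B). Cn_norm n L \<eta> \<le> D" for n
      proof -
        obtain D where D: "\<forall>\<phi>\<in>B'. Cn_norm n L \<phi> \<le> D" using bd[of n] by auto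
        have D0: "D \<ge> 0"
          using B'(2) D L(1,3) Cn_norm_nonneg[of _ L n] by (meson all_not_in_conv order_trans subsetD)
        have "Cn_norm n L ((S ^^ m) \<phi>) \<le> C * D" if m: "m \<ge> 1" and \<phi>: "\<phi> \<in> B" for m \<phi>
        proof (rule Cn_norm_least)
          fix \<alpha> :: "'d list" and x :: "real^'d" assume \<alpha>: "length \<alpha> \<le> n"
          have "cmod (iter_partial \<alpha> \<eta> x) \<le> D" if "\<eta> \<in> B'" for \<eta>
            using iter_partial_le_Cn_norm[of \<eta> L \<alpha> n x] L(1,3) D that \<alpha> by fastforce
          then show "cmod (iter_partial \<alpha> ((S ^^ m) \<phi>) x) \<le> C * D" by (rule main[OF m \<phi>])
        qed (use D0 B'(3) in simp)
        then show ?thesis by auto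
      qed
      with L(1,2) in_L show ?thesis
        unfolding von_Neumann_bounded_test_iff[OF X] by (intro exI[of _ L]) auto
    qed
  qed
qed

section \<open>The transpose of the composition operator\<close>

lemma bounded_smooth_imp_Cn_norm_bounded:
  assumes "bounded_smooth n U K f"
  obtains C where "C \<ge> 0" "\<And>i. Cn_norm n (K i) (f i) \<le> C"
proof -
  have "\<exists>C. \<forall>i. \<forall>x\<in>K i. norm (iter_partial \<alpha> (f i) x) \<le> C" if "length \<alpha> \<le> n" for \<alpha>
    using assms that unfolding bounded_smooth_def by simp
  then obtain C where C: "\<And>\<alpha> i x. length \<alpha> \<le> n \<Longrightarrow> x \<in> K i \<Longrightarrow> norm (iter_partial \<alpha> (f i) x) \<le> C \<alpha>"
    by metis
  let ?D = "\<Sum>\<alpha> | length \<alpha> \<le> n. \<bar>C \<alpha>\<bar>"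
  have fin: "finite {\<alpha> :: 'b list. length \<alpha> \<le> n}"
    using finite_lists_length_le[of "UNIV :: 'b set" n] by simp
  have "Cn_norm n (K i) (f i) \<le> ?D" for i
  proof (rule Cn_norm_least)
    fix \<alpha> :: "'b list" and x assume \<alpha>: "length \<alpha> \<le> n" and x: "x \<in> K i"
    have "\<bar>C \<alpha>\<bar> \<le> ?D" using fin \<alpha> by (intro member_le_sum) auto
    with C[OF \<alpha> x] show "norm (iter_partial \<alpha> (f i) x) \<le> ?D" by simp
  qed (simp add: sum_nonneg)
  then show thesis by (intro that[of ?D]) (simp_all add: sum_nonneg)
qed

lemma Cn_norm_bounded_imp_bounded_smooth:
  assumes "\<And>i. smooth_on (U i) (f i)" "\<And>i. compact (K i)" "\<And>i. K i \<subseteq> U i" "\<And>i. Cn_norm n (K i) (f i) \<le> C"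
  shows "bounded_smooth n U K f"
  unfolding bounded_smooth_def
proof (intro allI impI conjI ballI)
  show "iter_partial \<alpha> (f i) differentiable at x" if "x \<in> U i" for \<alpha> i x
    using assms(1)[of i] that by (simp add: smooth_on_def)
  show "\<exists>C. \<forall>i. \<forall>x\<in>K i. norm (iter_partial \<alpha> (f i) x) \<le> C" if "length \<alpha> \<le> n" for \<alpha>
    by (intro exI[of _ C] allI ballI order_trans[OF Cn_norm_upper[OF assms(1-3) that]] assms(4))
qed

lemma mult_matrix_inv:
  fixes A :: "real^'d::finite^'d"
  assumes "det A \<noteq> 0"
  shows "A ** matrix_inv A = mat 1"
  using assms unfolding invertible_det_nz[symmetric] invertible_def matrix_inv_def
  by (metis (mono_tags, lifting) someI_ex)

lemma jacobian_nth: "jacobian f (at x) $ a $ b = partial_deriv b f x $ a"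
  by (simp add: jacobian_def matrix_def partial_deriv_def)

lemma jacobian_has_derivative:
  fixes f :: "real^'d::finite \<Rightarrow> real^'e::finite"
  assumes "f differentiable at x"
  shows "(f has_derivative (*v) (jacobian f (at x))) (at x)"
proof -
  have "(*v) (jacobian f (at x)) = frechet_derivative f (at x)"
  proof
    fix v
    show "jacobian f (at x) *v v = frechet_derivative f (at x) v"
      unfolding frechet_derivative_eq_sum_partial_deriv[OF assms]
      by (simp add: vec_eq_iff matrix_vector_mult_def jacobian_nth mult.commute)
  qed
  with assms show ?thesis by (simp add: frechet_derivative_works)
qed

lemma jacobian_eqI:
  fixes f :: "real^'d::finite \<Rightarrow> real^'e::finite"
  assumes "(f has_derivative (*v) A) (at x)"
  shows "jacobian f (at x) = A"
  using frechet_derivative_at[OF assms] by (metis jacobian_def matrix_of_matrix_vector_mul)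

lemma jacobian_compose:
  fixes f :: "real^'d::finite \<Rightarrow> real^'e::finite" and g :: "real^'e \<Rightarrow> real^'f::finite"
  assumes "f differentiable at x" "g differentiable at (f x)"
  shows "jacobian (\<lambda>x. g (f x)) (at x) = jacobian g (at (f x)) ** jacobian f (at x)"
proof (rule jacobian_eqI)
  show "((\<lambda>x. g (f x)) has_derivative (*v) (jacobian g (at (f x)) ** jacobian f (at x))) (at x)"
    using has_derivative_compose[OF assms[THEN jacobian_has_derivative]]
    by (simp add: matrix_vector_mul_assoc)
qed

text \<open>
  Otherwise the seminorm exceeds \<open>n\<close> times the \<open>C\<^sup>n\<close> norm at some function supported in \<open>K\<close>, for every \<open>n\<close>. Rescaled so
  that the seminorm takes the value \<open>n\<close>, these functions form a bounded set.
\<close>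

lemma test_seminorm_if_bounded_on_bounded:
  assumes X: "open X" and p: "seminorm_on (test_functions X) p"
    and bd: "\<And>B. bounded_tests X B \<Longrightarrow> \<exists>C. \<forall>\<phi>\<in>B. p \<phi> \<le> C"
  shows "p \<in> test_seminorms X"
proof -
  have "\<exists>n C. \<forall>\<phi>\<in>test_functions_in K. p \<phi> \<le> C * Cn_norm n K \<phi>" if K: "compact K" "K \<subseteq> X" for K
  proof (rule ccontr)
    assume "\<not> ?thesis"
    then have "\<forall>n. \<exists>\<phi>\<in>test_functions_in K. p \<phi> > real n * Cn_norm n K \<phi>" by (meson not_le)
    then obtain \<phi> where \<phi>: "\<And>n. \<phi> n \<in> test_functions_in K" "\<And>n. p (\<phi> n) > real n * Cn_norm n K (\<phi> n)" by metis
    define a where "a = (\<lambda>n. complex_of_real (n / p (\<phi> n)))"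
    define \<eta> where "\<eta> = (\<lambda>n x. a n * \<phi> n x)"
    have pos: "p (\<phi> n) > 0" for n
      using \<phi>(2)[of n] mult_nonneg_nonneg[OF of_nat_0_le_iff[of n] Cn_norm_nonneg[OF \<phi>(1) K(1), of n n]] by linarith
    have a: "cmod (a n) = n / p (\<phi> n)" for n using pos[of n] by (simp add: a_def norm_divide)
    have \<eta>: "\<eta> n \<in> test_functions_in K" for n
      unfolding \<eta>_def by (rule function_space_scale[OF test_function_space_in[OF K(1)] \<phi>(1)])
    have "Cn_norm n K (\<eta> n) \<le> 1" for n
      unfolding \<eta>_def seminorm_on_scale[OF seminorm_on_Cn_norm[OF K(1)] \<phi>(1)] a
      using \<phi>(2)[of n] pos[of n] by (simp add: divide_le_eq)
    then have le1: "Cn_norm m K (\<eta> n) \<le> 1" if "m \<le> n" for m n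
      using Cn_norm_mono[OF \<eta> K(1) that] order_trans by blast
    have "\<exists>C. \<forall>\<phi>\<in>range \<eta>. Cn_norm m K \<phi> \<le> C" for m
    proof -
      let ?S = "insert 1 ((\<lambda>n. Cn_norm m K (\<eta> n)) ` {..m})"
      have "Cn_norm m K (\<eta> n) \<le> Max ?S" for n
      proof (cases "m \<le> n")
        case True
        from le1[OF this] show ?thesis by (rule order_trans) simp
      next
        case False
        then show ?thesis by (intro Max_ge) auto
      qed
      then show ?thesis by blast
    qed
    then have "bounded_tests X (range \<eta>)"
      unfolding von_Neumann_bounded_test_iff[OF X] using K \<eta> by (intro exI[of _ K]) auto
    then obtain C where C: "\<And>n. p (\<eta> n) \<le> C" using bd[of "range \<eta>"] by blast
    have "p (\<eta> n) = n" for n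
      unfolding \<eta>_def seminorm_on_scale[OF p test_functionsI[OF K \<phi>(1)]] a using pos[of n] by simp
    with C reals_Archimedean2[of C] show False by (metis not_le)
  qed
  with p show ?thesis by (simp add: test_seminorms_def)
qed

locale diffeo =
  fixes X :: "(real^'d::finite) set" and \<psi> :: "real^'d \<Rightarrow> real^'d"
  assumes open_X: "open X" and smooth_psi: "smooth_on X \<psi>" and bij: "bij_betw \<psi> X X"
    and det_nz: "\<And>x. x \<in> X \<Longrightarrow> det (jacobian \<psi> (at x)) \<noteq> 0"
begin

abbreviation "\<iota> \<equiv> inv_into X \<psi>"
abbreviation "T \<equiv> composition_transpose X \<psi>"

lemma psi_in: "x \<in> X \<Longrightarrow> \<psi> x \<in> X"
  using bij by (auto simp: bij_betw_def)

lemma inv_in: "y \<in> X \<Longrightarrow> \<iota> y \<in> X"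
  using bij by (metis bij_betw_imp_surj_on inv_into_into)

lemma psi_inv: "y \<in> X \<Longrightarrow> \<psi> (\<iota> y) = y"
  using bij by (simp add: bij_betw_inv_into_right)

lemma inv_psi: "x \<in> X \<Longrightarrow> \<iota> (\<psi> x) = x"
  using bij by (simp add: bij_betw_inv_into_left)

lemma inv_has_derivative:
  assumes x: "x \<in> X"
  shows "(\<iota> has_derivative (*v) (matrix_inv (jacobian \<psi> (at x)))) (at (\<psi> x))"
proof (rule has_derivative_inverse_strong[OF open_X x smooth_on_imp_continuous_on[OF smooth_psi] inv_psi])
  show "(\<psi> has_derivative (*v) (jacobian \<psi> (at x))) (at x)"
    by (rule jacobian_has_derivative[OF smooth_on_imp_differentiable[OF smooth_psi x]])
  have "jacobian \<psi> (at x) ** matrix_inv (jacobian \<psi> (at x)) = mat 1"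
    by (rule mult_matrix_inv[OF det_nz[OF x]])
  then show "(*v) (jacobian \<psi> (at x)) \<circ> (*v) (matrix_inv (jacobian \<psi> (at x))) = id"
    by (simp add: fun_eq_iff matrix_vector_mul_assoc)
qed

lemma smooth_jacobian_entry: "smooth_on X (\<lambda>x. jacobian \<psi> (at x) $ a $ b)"
  unfolding jacobian_nth
  by (rule smooth_on_linear[OF open_X bounded_linear_vec_nth smooth_on_partial_deriv[OF open_X smooth_psi]])

text \<open>
  The inverse function theorem and Cramer's rule give \<open>\<partial>\<^sub>j\<psi>\<^sup>-\<^sup>1 = G\<^sub>j \<circ> \<psi>\<^sup>-\<^sup>1\<close> with smooth \<open>G\<^sub>j\<close>, which raises the
  regularity of \<open>\<psi>\<^sup>-\<^sup>1\<close> by one order at a time.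
\<close>

lemma smooth_inv: "smooth_on X \<iota>"
proof -
  let ?J = "\<lambda>x. jacobian \<psi> (at x)"
  let ?M = "\<lambda>j k x. \<chi> a b. if b = k then axis j 1 $ a else ?J x $ a $ b"
  define G where "G = (\<lambda>j x. \<chi> k. det (?M j k x) * inverse (det (?J x)))"
  have smooth_G: "smooth_on X (G j)" for j
  proof -
    have "smooth_on X (\<lambda>x. ?M j k x $ a $ b)" for k a b
      using smooth_jacobian_entry smooth_on_const[OF open_X] by (cases "b = k") simp_all
    then have "smooth_on X (\<lambda>x. det (?M j k x))" for k
      by (rule smooth_on_det[OF open_X])
    moreover have "smooth_on X (\<lambda>x. inverse (det (?J x)))"
      by (intro smooth_on_inverse[OF open_X] smooth_on_det[OF open_X] smooth_jacobian_entry det_nz)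
    ultimately show ?thesis
      unfolding smooth_on_vec_iff[OF open_X] G_def by (simp add: smooth_on_mult[OF open_X])
  qed
  have pd: "partial_deriv j \<iota> y = G j (\<iota> y)" if y: "y \<in> X" for j y
  proof -
    let ?x = "\<iota> y"
    have x: "?x \<in> X" using inv_in[OF y] .
    have inv: "?J ?x ** matrix_inv (?J ?x) = mat 1"
      by (rule mult_matrix_inv[OF det_nz[OF x]])
    have "partial_deriv j \<iota> y = matrix_inv (?J ?x) *v axis j 1"
      using partial_derivI[OF inv_has_derivative[OF x]] by (simp add: psi_inv[OF y])
    moreover have "?J ?x *v (matrix_inv (?J ?x) *v axis j 1) = axis j 1"
      by (simp add: matrix_vector_mul_assoc inv)
    then have "matrix_inv (?J ?x) *v axis j 1 = G j ?x"
      unfolding cramer[OF det_nz[OF x]] by (simp add: G_def divide_inverse)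
    ultimately show ?thesis by simp
  qed
  have diff: "\<iota> differentiable at y" if "y \<in> X" for y
    using inv_has_derivative[OF inv_in[OF that]] unfolding psi_inv[OF that] differentiable_def by blast
  let ?bs = "\<lambda>n f. bounded_smooth n (\<lambda>_::unit. X) (\<lambda>_. {}) (\<lambda>_. f)"
  have "?bs n \<iota>" for n
  proof (induction n)
    case 0
    show ?case using diff by (simp add: bounded_smooth_0)
  next
    case (Suc n)
    show ?case
    proof (rule bounded_smooth_Suc_cong)
      show "?bs 0 \<iota>" using diff by (simp add: bounded_smooth_0)
      show "?bs n (\<lambda>y. G j (\<iota> y))" for j
      proof (rule bounded_smooth_compose[OF _ _ _ Suc])
        show "?bs n (G j)" using smooth_G by (simp add: smooth_on_iff_bounded_smooth)
      qed (use open_X inv_in in auto)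
      show "partial_deriv j \<iota> y = G j (\<iota> y)" if "y \<in> X" for j y by (rule pd[OF that])
    qed (use open_X in auto)
  qed
  then show ?thesis by (simp add: smooth_on_iff_bounded_smooth)
qed

lemma psi_pow_in: "x \<in> X \<Longrightarrow> (\<psi> ^^ m) x \<in> X"
  by (induction m) (simp_all add: psi_in)

lemma inv_pow_in: "y \<in> X \<Longrightarrow> (\<iota> ^^ m) y \<in> X"
  by (induction m) (simp_all add: inv_in)

lemma inv_pow_psi_pow: "x \<in> X \<Longrightarrow> (\<iota> ^^ m) ((\<psi> ^^ m) x) = x"
proof (induction m arbitrary: x)
  case (Suc m)
  have "(\<iota> ^^ Suc m) ((\<psi> ^^ Suc m) x) = (\<iota> ^^ m) (\<iota> (\<psi> ((\<psi> ^^ m) x)))"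
    by (simp add: funpow_swap1)
  with Suc show ?case by (simp add: inv_psi psi_pow_in)
qed simp

lemma psi_pow_inv_pow: "y \<in> X \<Longrightarrow> (\<psi> ^^ m) ((\<iota> ^^ m) y) = y"
proof (induction m arbitrary: y)
  case (Suc m)
  have "(\<psi> ^^ Suc m) ((\<iota> ^^ Suc m) y) = (\<psi> ^^ m) (\<psi> (\<iota> ((\<iota> ^^ m) y)))"
    by (simp add: funpow_swap1)
  with Suc show ?case by (simp add: psi_inv inv_pow_in)
qed simp

lemma smooth_psi_pow: "smooth_on X (\<psi> ^^ m)"
proof (induction m)
  case (Suc m)
  show ?case
    using smooth_on_compose[OF open_X smooth_psi Suc psi_pow_in open_X] by (simp add: comp_def)
qed (simp add: id_def smooth_on_ident[OF open_X])

lemma smooth_inv_pow: "smooth_on X (\<iota> ^^ m)"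
proof (induction m)
  case (Suc m)
  show ?case
    using smooth_on_compose[OF open_X smooth_inv Suc inv_pow_in open_X] by (simp add: comp_def)
qed (simp add: id_def smooth_on_ident[OF open_X])

lemma compact_image: "compact K \<Longrightarrow> K \<subseteq> X \<Longrightarrow> compact ((\<psi> ^^ m) ` K)"
  using smooth_on_imp_continuous_on[OF smooth_psi_pow] compact_continuous_image continuous_on_subset by blast

lemma image_subset: "K \<subseteq> X \<Longrightarrow> (\<psi> ^^ m) ` K \<subseteq> X"
  using psi_pow_in by blast

lemma image_eq_vimage: "K \<subseteq> X \<Longrightarrow> (\<psi> ^^ m) ` K = X \<inter> (\<iota> ^^ m) -` K"
proof (intro equalityI subsetI)
  fix y assume y: "y \<in> X \<inter> (\<iota> ^^ m) -` K"
  then show "y \<in> (\<psi> ^^ m) ` K" using psi_pow_inv_pow[of y m] by (intro image_eqI[of _ _ "(\<iota> ^^ m) y"]) auto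
qed (auto simp: psi_pow_in inv_pow_psi_pow subset_iff)

lemma open_image: "open V \<Longrightarrow> V \<subseteq> X \<Longrightarrow> open ((\<psi> ^^ m) ` V)"
  by (subst image_eq_vimage) (auto intro: continuous_open_preimage[OF smooth_on_imp_continuous_on[OF smooth_inv_pow] open_X])

definition weight :: "real^'d \<Rightarrow> real" where
  "weight x = inverse \<bar>det (jacobian \<psi> (at x))\<bar>"

lemma weight_pos: "x \<in> X \<Longrightarrow> weight x > 0"
  using det_nz by (simp add: weight_def)

lemma smooth_weight: "smooth_on X weight"
  unfolding weight_def[abs_def]
  by (intro smooth_on_inverse[OF open_X] smooth_on_abs[OF open_X] smooth_on_det[OF open_X] smooth_jacobian_entry)
    (simp_all add: det_nz)

lemma T_eq: "y \<in> X \<Longrightarrow> T \<phi> y = \<phi> (\<iota> y) * of_real (weight (\<iota> y))"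
  by (simp add: composition_transpose_def Let_def weight_def divide_inverse)

lemma T_psi: "x \<in> X \<Longrightarrow> T \<phi> (\<psi> x) = \<phi> x * of_real (weight x)"
  by (simp add: T_eq psi_in inv_psi)

lemma T_outside: "y \<notin> X \<Longrightarrow> T \<phi> y = 0"
  by (simp add: composition_transpose_def)

lemma T_test_function:
  assumes K: "compact K" "K \<subseteq> X" and \<phi>: "\<phi> \<in> test_functions_in K"
  shows "T \<phi> \<in> test_functions_in (\<psi> ` K)"
proof (rule test_functions_inI)
  show cpt: "compact (\<psi> ` K)" using compact_image[OF K, of 1] by simp
  show zero: "T \<phi> y = 0" if "y \<notin> \<psi> ` K" for y
  proof (cases "y \<in> X")
    case True
    then have "\<iota> y \<notin> K" using that psi_inv by (metis image_eqI)
    with True show ?thesis by (simp add: T_eq test_functions_in_eq_0[OF \<phi>])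
  qed (simp add: T_outside)
  have "smooth_on X (\<lambda>x. \<phi> x * complex_of_real (weight x))"
    by (intro smooth_on_mult[OF open_X] smooth_on_linear[OF open_X bounded_linear_of_real] smooth_weight
        smooth_on_subset[OF test_functions_in_smooth[OF \<phi>]]) simp
  from smooth_on_compose[OF open_X this smooth_inv inv_in open_X]
  have "smooth_on X (T \<phi>)"
    by (subst smooth_on_cong[OF open_X T_eq])
  moreover have "smooth_on (- \<psi> ` K) (T \<phi>)"
    using zero by (subst smooth_on_cong[of _ _ "\<lambda>_. 0"])
      (simp_all add: smooth_on_const compact_imp_closed[OF cpt] open_Compl)
  ultimately have "smooth_on (X \<union> - \<psi> ` K) (T \<phi>)" by (rule smooth_on_Un)
  moreover have "X \<union> - \<psi> ` K = UNIV" using K(2) psi_in by auto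
  ultimately show "smooth_on UNIV (T \<phi>)" by simp
qed

lemma T_add: "T (\<lambda>x. \<phi> x + \<eta> x) = (\<lambda>y. T \<phi> y + T \<eta> y)"
  by (rule ext) (simp add: composition_transpose_def Let_def add_divide_distrib)

lemma T_scale: "T (\<lambda>x. c * \<phi> x) = (\<lambda>y. c * T \<phi> y)"
  by (rule ext) (simp add: composition_transpose_def Let_def)

lemma composition_operator_eq: "composition_operator X \<psi> = transpose_on X T"
  by (intro ext) (simp add: composition_operator_def transpose_on_def)

text \<open>
  The number \<open>1 / \<bar>det J\<psi>\<^sup>m(x)\<bar>\<close>, written as a product along the orbit of \<open>x\<close> so that its multiplicativity
  is visible.
\<close>

definition cocycle :: "nat \<Rightarrow> real^'d \<Rightarrow> real" where
  "cocycle m x = (\<Prod>k<m. weight ((\<psi> ^^ k) x))"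

lemma cocycle_pos: "x \<in> X \<Longrightarrow> cocycle m x > 0"
  unfolding cocycle_def by (intro prod_pos) (simp add: weight_pos psi_pow_in)

lemma cocycle_add: "cocycle (m + k) x = cocycle m x * cocycle k ((\<psi> ^^ m) x)"
proof (induction k)
  case (Suc k)
  have "cocycle (m + Suc k) x = cocycle (m + k) x * weight ((\<psi> ^^ (m + k)) x)"
    by (simp add: cocycle_def)
  also have "(\<psi> ^^ (m + k)) x = (\<psi> ^^ k) ((\<psi> ^^ m) x)"
    by (simp add: add.commute[of m] funpow_add)
  finally show ?case by (simp add: Suc) (simp add: cocycle_def)
qed (simp add: cocycle_def)

lemma T_pow_psi_pow: "x \<in> X \<Longrightarrow> (T ^^ m) \<phi> ((\<psi> ^^ m) x) = \<phi> x * of_real (cocycle m x)"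
proof (induction m)
  case (Suc m)
  then show ?case by (simp add: T_psi psi_pow_in cocycle_def)
qed (simp add: cocycle_def)

lemma T_pow_test_function:
  assumes "compact K" "K \<subseteq> X" "\<phi> \<in> test_functions_in K"
  shows "(T ^^ m) \<phi> \<in> test_functions_in ((\<psi> ^^ m) ` K)"
proof (induction m)
  case (Suc m)
  from T_test_function[OF compact_image[OF assms(1,2)] image_subset[OF assms(2)] Suc]
  show ?case by (simp add: image_image)
qed (use assms in simp)

lemma det_jacobian_inv: "x \<in> X \<Longrightarrow> \<bar>det (jacobian \<iota> (at (\<psi> x)))\<bar> = weight x"
proof -
  assume x: "x \<in> X"
  have J: "jacobian \<iota> (at (\<psi> x)) = matrix_inv (jacobian \<psi> (at x))"
    by (rule jacobian_eqI[OF inv_has_derivative[OF x]])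
  have "det (jacobian \<psi> (at x)) * det (matrix_inv (jacobian \<psi> (at x))) = 1"
    by (simp add: det_mul[symmetric] mult_matrix_inv[OF det_nz[OF x]])
  then show ?thesis
    unfolding J weight_def by (metis abs_inverse inverse_unique)
qed

lemma det_jacobian_inv_pow: "x \<in> X \<Longrightarrow> \<bar>det (jacobian (\<iota> ^^ m) (at ((\<psi> ^^ m) x)))\<bar> = cocycle m x"
proof (induction m arbitrary: x)
  case 0
  have "(*v) (mat 1 :: real^'d^'d) = (\<lambda>v. v)" by (rule ext) simp
  then have "((\<lambda>x. x) has_derivative (*v) (mat 1 :: real^'d^'d)) (at x)"
    by (simp add: has_derivative_ident)
  from jacobian_eqI[OF this] show ?case by (simp add: cocycle_def id_def)
next
  case (Suc m)
  let ?y = "(\<psi> ^^ m) x"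
  have y: "?y \<in> X" using Suc.prems psi_pow_in by simp
  have "jacobian (\<iota> ^^ Suc m) (at (\<psi> ?y)) = jacobian (\<lambda>z. (\<iota> ^^ m) (\<iota> z)) (at (\<psi> ?y))"
    by (simp add: funpow_swap1 comp_def)
  also have "\<dots> = jacobian (\<iota> ^^ m) (at ?y) ** jacobian \<iota> (at (\<psi> ?y))"
    using jacobian_compose[of \<iota> "\<psi> ?y" "\<iota> ^^ m"] smooth_on_imp_differentiable[OF smooth_inv psi_in[OF y]]
      smooth_on_imp_differentiable[OF smooth_inv_pow[of m] y] by (simp add: inv_psi[OF y])
  finally have J: "jacobian (\<iota> ^^ Suc m) (at (\<psi> ?y)) = jacobian (\<iota> ^^ m) (at ?y) ** jacobian \<iota> (at (\<psi> ?y))" .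
  have "(\<psi> ^^ Suc m) x = \<psi> ?y" by simp
  then show ?case
    unfolding J \<open>(\<psi> ^^ Suc m) x = \<psi> ?y\<close> det_mul abs_mult Suc.IH[OF Suc.prems] det_jacobian_inv[OF y]
    by (simp add: cocycle_def)
qed

lemma T_pow_eq:
  assumes "y \<in> X"
  shows "(T ^^ m) \<phi> y = \<phi> ((\<iota> ^^ m) y) * of_real \<bar>det (jacobian (\<iota> ^^ m) (at y))\<bar>"
  using T_pow_psi_pow[OF inv_pow_in[OF assms], of m \<phi> m] det_jacobian_inv_pow[OF inv_pow_in[OF assms], of m m]
  unfolding psi_pow_inv_pow[OF assms] by simp

lemma bounded_smooth_inv_pow:
  assumes bd: "\<And>n c. bdd_above ((\<lambda>m. Cn_norm n ((\<psi> ^^ m) ` K) (\<lambda>x. (\<iota> ^^ m) x $ c)) ` M)"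
    and K: "compact K" "K \<subseteq> X" and h: "\<And>i. h i \<in> M"
  shows "bounded_smooth n (\<lambda>_. X) (\<lambda>i. (\<psi> ^^ h i) ` K) (\<lambda>i. \<iota> ^^ h i)"
  unfolding bounded_smooth_vec_iff[of "\<lambda>_. X" "\<lambda>i. (\<psi> ^^ h i) ` K", OF open_X image_subset[OF K(2)]]
proof
  fix c
  obtain C where C: "\<And>m. m \<in> M \<Longrightarrow> Cn_norm n ((\<psi> ^^ m) ` K) (\<lambda>x. (\<iota> ^^ m) x $ c) \<le> C"
    using bd[of n c] by (auto simp: bdd_above_def)
  show "bounded_smooth n (\<lambda>_. X) (\<lambda>i. (\<psi> ^^ h i) ` K) (\<lambda>i x. (\<iota> ^^ h i) x $ c)"
  proof (rule Cn_norm_bounded_imp_bounded_smooth)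
    show "smooth_on X (\<lambda>x. (\<iota> ^^ h i) x $ c)" for i
      by (rule smooth_on_linear[OF open_X bounded_linear_vec_nth smooth_inv_pow])
    show "Cn_norm n ((\<psi> ^^ h i) ` K) (\<lambda>x. (\<iota> ^^ h i) x $ c) \<le> C" for i
      by (rule C[OF h])
  qed (rule compact_image[OF K] image_subset[OF K(2)])+
qed

text \<open>
  The derivatives of \<open>T\<^sup>m \<phi> = (\<phi> \<circ> \<psi>\<^sup>-\<^sup>m) \<bar>det J\<psi>\<^sup>-\<^sup>m\<bar>\<close> on \<open>\<psi>\<^sup>m(K)\<close> are bounded by those of \<open>\<phi>\<close> on \<open>K\<close> and of \<open>\<psi>\<^sup>-\<^sup>m\<close> on
  \<open>\<psi>\<^sup>m(K)\<close>, while stability of orbits keeps all supports in one compact set.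
\<close>

lemma orbit_bounded_if_inverse_iterates_bounded:
  assumes m0: "m0 \<in> M"
    and stable: "\<And>K. compact K \<Longrightarrow> K \<subseteq> X \<Longrightarrow> \<exists>L. compact L \<and> L \<subseteq> X \<and> (\<forall>m\<in>M. (\<psi> ^^ m) ` K \<subseteq> L)"
    and bd: "\<And>K n c. compact K \<Longrightarrow> K \<subseteq> X \<Longrightarrow>
      bdd_above ((\<lambda>m. Cn_norm n ((\<psi> ^^ m) ` K) (\<lambda>x. (\<iota> ^^ m) x $ c)) ` M)"
    and B: "bounded_tests X B"
  shows "bounded_tests X (\<Union>m\<in>M. (T ^^ m) ` B)"
proof -
  obtain K where K: "compact K" "K \<subseteq> X" "B \<subseteq> test_functions_in K" and Bbd: "\<And>n. \<exists>C. \<forall>\<phi>\<in>B. Cn_norm n K \<phi> \<le> C"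
    using B unfolding von_Neumann_bounded_test_iff[OF open_X] by auto
  obtain L where L: "compact L" "L \<subseteq> X" "\<And>m. m \<in> M \<Longrightarrow> (\<psi> ^^ m) ` K \<subseteq> L"
    using stable[OF K(1,2)] by blast
  \<comment> \<open>All pairs serve as indices: a first component outside \<open>B\<close> stands for the zero function, a second one
    outside \<open>M\<close> for \<open>m0\<close>.\<close>
  define h where "h = (\<lambda>i :: (real^'d \<Rightarrow> complex) \<times> nat. if snd i \<in> M then snd i else m0)"
  define f where "f = (\<lambda>i :: (real^'d \<Rightarrow> complex) \<times> nat. if fst i \<in> B then fst i else (\<lambda>_. 0))"
  let ?K = "\<lambda>i. (\<psi> ^^ h i) ` K"
  have h: "h i \<in> M" for i by (simp add: h_def m0)
  have sub: "?K i \<subseteq> X" for i using image_subset[OF K(2)] .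
  have in_K: "(T ^^ m) \<phi> \<in> test_functions_in ((\<psi> ^^ m) ` K)" if "\<phi> \<in> B" for \<phi> m
    using T_pow_test_function[OF K(1,2)] K(3) that by blast
  have "\<exists>C. \<forall>m\<in>M. \<forall>\<phi>\<in>B. Cn_norm n L ((T ^^ m) \<phi>) \<le> C" for n
  proof -
    have zero_in: "(\<lambda>_. 0) \<in> test_functions_in K"
      using test_function_space_in[OF K(1)] by (simp add: function_space_def)
    obtain C where C: "\<forall>\<phi>\<in>B. Cn_norm n K \<phi> \<le> C" using Bbd[of n] by auto
    have f_in: "f i \<in> test_functions_in K" "Cn_norm n K (f i) \<le> \<bar>C\<bar>" for i
      using zero_in seminorm_on_zero[OF seminorm_on_Cn_norm[OF K(1)] zero_in, of n] K(3) C
      by (auto simp: f_def intro: order_trans[OF _ abs_ge_self])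
    have bf: "bounded_smooth n (\<lambda>_. X) (\<lambda>_. K) f"
      using f_in smooth_on_subset[OF test_functions_in_smooth[OF f_in(1)]] K
      by (intro Cn_norm_bounded_imp_bounded_smooth[where C = "\<bar>C\<bar>"]) auto
    have bg: "bounded_smooth k (\<lambda>_. X) ?K (\<lambda>i. \<iota> ^^ h i)" for k
      by (rule bounded_smooth_inv_pow[OF bd[OF K(1,2)] K(1,2) h])
    have 1: "bounded_smooth n (\<lambda>_. X) ?K (\<lambda>i y. f i ((\<iota> ^^ h i) y))"
    proof (rule bounded_smooth_compose[OF _ _ bf bg])
      show "(\<iota> ^^ h i) y \<in> K" if "y \<in> ?K i" for i y
        using that K(2) inv_pow_psi_pow by auto
    qed (use open_X sub inv_pow_in in auto)
    have "bounded_smooth n (\<lambda>_. X) ?K (\<lambda>i y. jacobian (\<iota> ^^ h i) (at y) $ a $ b)" for a b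
      unfolding jacobian_nth using bg[of "Suc n"] open_X sub
      by (intro bounded_smooth_vec_nth) (simp_all add: bounded_smooth_Suc)
    then have "bounded_smooth n (\<lambda>_. X) ?K (\<lambda>i y. det (jacobian (\<iota> ^^ h i) (at y)))"
      by (rule bounded_smooth_det[OF open_X sub])
    moreover have "det (jacobian (\<iota> ^^ h i) (at y)) \<noteq> 0" if "y \<in> X" for i y
      using det_jacobian_inv_pow[OF inv_pow_in[OF that], of "h i" "h i"] cocycle_pos[OF inv_pow_in[OF that]]
      unfolding psi_pow_inv_pow[OF that] by (metis abs_zero less_irrefl)
    ultimately have "bounded_smooth n (\<lambda>_. X) ?K (\<lambda>i y. \<bar>det (jacobian (\<iota> ^^ h i) (at y))\<bar>)"
      by (rule bounded_smooth_abs[OF open_X sub])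
    then have "bounded_smooth n (\<lambda>_. X) ?K (\<lambda>i y. complex_of_real \<bar>det (jacobian (\<iota> ^^ h i) (at y))\<bar>)"
      by (rule bounded_smooth_linear[OF open_X sub bounded_linear_of_real])
    from bounded_smooth_mult[OF open_X sub 1 this]
    have "bounded_smooth n (\<lambda>_. X) ?K (\<lambda>i. (T ^^ h i) (f i))"
      by (subst bounded_smooth_cong[OF open_X sub T_pow_eq])
    then obtain D where D: "\<And>i. Cn_norm n (?K i) ((T ^^ h i) (f i)) \<le> D"
      by (rule bounded_smooth_imp_Cn_norm_bounded) (rule that)
    have "Cn_norm n L ((T ^^ m) \<phi>) \<le> D" if "m \<in> M" "\<phi> \<in> B" for m \<phi>
      using D[of "(\<phi>, m)"] Cn_norm_superset[OF in_K[OF that(2)] compact_image[OF K(1,2)] L(3)[OF that(1)]] that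
      by (simp add: h_def f_def)
    then show ?thesis by blast
  qed
  note bounds = this
  have "\<exists>C. \<forall>\<eta>\<in>(\<Union>m\<in>M. (T ^^ m) ` B). Cn_norm n L \<eta> \<le> C" for n
  proof -
    obtain C where "\<forall>m\<in>M. \<forall>\<phi>\<in>B. Cn_norm n L ((T ^^ m) \<phi>) \<le> C" using bounds[of n] by blast
    then show ?thesis by (intro exI[of _ C]) auto
  qed
  moreover have "(\<Union>m\<in>M. (T ^^ m) ` B) \<subseteq> test_functions_in L"
  proof -
    have "(T ^^ m) \<phi> \<in> test_functions_in L" if "m \<in> M" "\<phi> \<in> B" for m \<phi>
      using in_K[OF that(2)] test_functions_in_mono[OF L(3)[OF that(1)]] by blast
    then show ?thesis by auto
  qed
  ultimately show ?thesis
    unfolding von_Neumann_bounded_test_iff[OF open_X] using L(1,2) by auto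
qed

text \<open>
  The preceding lemma for \<open>M = {1}\<close> shows that \<open>T\<close> preserves bounded sets, and on test functions this
  implies continuity.
\<close>

lemma T_continuous: "continuous_test_map X T"
proof -
  have T_in: "T \<phi> \<in> test_functions X" if \<phi>: "\<phi> \<in> test_functions X" for \<phi>
  proof -
    obtain K where K: "compact K" "K \<subseteq> X" "\<phi> \<in> test_functions_in K" using \<phi> by (rule test_functionsE)
    show ?thesis
      using test_functionsI[OF _ _ T_test_function[OF K]] compact_image[OF K(1,2), of 1] image_subset[OF K(2), of 1] by simp
  qed
  have bounded: "bounded_tests X (T ` B)" if B: "bounded_tests X B" for B
  proof -
    have "\<exists>L. compact L \<and> L \<subseteq> X \<and> (\<forall>m\<in>{1}. (\<psi> ^^ m) ` K \<subseteq> L)" if "compact K" "K \<subseteq> X" for K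
      using compact_image[OF that, of 1] image_subset[OF that(2), of 1] by (intro exI[of _ "(\<psi> ^^ 1) ` K"]) simp
    from orbit_bounded_if_inverse_iterates_bounded[OF _ this _ B, of 1] show ?thesis by simp
  qed
  have "(\<lambda>\<phi>. p (T \<phi>)) \<in> test_seminorms X" if p: "p \<in> test_seminorms X" for p
  proof (rule test_seminorm_if_bounded_on_bounded)
    show "seminorm_on (test_functions X) (\<lambda>\<phi>. p (T \<phi>))"
      using test_seminorms_seminorm[OF p] T_in by (simp add: seminorm_on_def T_add T_scale)
    show "\<exists>C. \<forall>\<phi>\<in>B. p (T \<phi>) \<le> C" if "bounded_tests X B" for B
      using bounded[OF that] p unfolding von_Neumann_bounded_test_topology by simp
  qed (rule open_X)
  then show ?thesis
    by (simp add: continuous_test_map_def T_add T_scale T_in)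
qed

end

section \<open>Integration on finite-dimensional coordinate spaces\<close>

text \<open>
  A copy of a finite type that carries some well-order. The change of variables formula is stated for
  well-ordered index types; relabelling coordinates changes neither determinants nor volumes.
\<close>

typedef 'a wo = "UNIV :: 'a set" by simp

lemma Abs_wo_bij: "bij (Abs_wo :: 'a \<Rightarrow> 'a wo)"
  by (metis Abs_wo_inverse Rep_wo_inverse UNIV_I bijI')

instance wo :: (finite) finite
proof
  have "UNIV = range (Abs_wo :: 'a \<Rightarrow> 'a wo)" by (rule bij_is_surj[OF Abs_wo_bij, symmetric])
  then show "finite (UNIV :: 'a wo set)" by (metis finite_imageI finite)
qed

definition wo_rank :: "'a::finite wo \<Rightarrow> nat" where
  "wo_rank x = (SOME e :: 'a \<Rightarrow> nat. inj e) (Rep_wo x)"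

lemma inj_wo_rank: "inj (wo_rank :: 'a::finite wo \<Rightarrow> nat)"
proof -
  have "\<exists>e :: 'a \<Rightarrow> nat. inj e" using finite_imp_inj_to_nat_seg[of "UNIV :: 'a set"] by auto
  then have "inj (SOME e :: 'a \<Rightarrow> nat. inj e)" by (rule someI_ex)
  moreover have "inj (Rep_wo :: 'a wo \<Rightarrow> 'a)" by (rule injI) (simp only: Rep_wo_inject)
  ultimately have "inj (\<lambda>x. (SOME e :: 'a \<Rightarrow> nat. inj e) (Rep_wo x))" by (rule inj_compose[unfolded comp_def])
  then show ?thesis unfolding wo_rank_def[abs_def] .
qed

instantiation wo :: (finite) wellorder
begin

definition less_eq_wo :: "'a wo \<Rightarrow> 'a wo \<Rightarrow> bool" where "x \<le> y \<longleftrightarrow> wo_rank x \<le> wo_rank y"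
definition less_wo :: "'a wo \<Rightarrow> 'a wo \<Rightarrow> bool" where "x < y \<longleftrightarrow> wo_rank x < wo_rank y"

instance
proof
  show "P a" if "\<And>x. (\<And>y. y < x \<Longrightarrow> P y) \<Longrightarrow> P x" for P :: "'a wo \<Rightarrow> bool" and a
    using that unfolding less_wo_def by (rule measure_induct_rule)
  show "x = y" if "x \<le> y" "y \<le> x" for x y :: "'a wo"
    using that injD[OF inj_wo_rank] unfolding less_eq_wo_def by (meson order_antisym)
qed (auto simp: less_eq_wo_def less_wo_def)

end

definition to_wo :: "real^'d::finite \<Rightarrow> real^'d wo" where
  "to_wo x = (\<chi> i. x $ Rep_wo i)"

definition of_wo :: "real^'d::finite wo \<Rightarrow> real^'d" where
  "of_wo v = (\<chi> i. v $ Abs_wo i)"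

lemma of_wo_to_wo [simp]: "of_wo (to_wo x) = x"
  by (simp add: of_wo_def to_wo_def vec_eq_iff Abs_wo_inverse)

lemma to_wo_of_wo [simp]: "to_wo (of_wo v) = v"
  by (simp add: of_wo_def to_wo_def vec_eq_iff Rep_wo_inverse)

lemma linear_to_wo: "linear to_wo" and linear_of_wo: "linear of_wo"
  by (auto simp: linear_iff to_wo_def of_wo_def vec_eq_iff)

lemma norm_of_wo: "norm (of_wo v) = norm v"
proof -
  have "(\<Sum>i\<in>UNIV. (v $ Abs_wo i)\<^sup>2) = (\<Sum>i\<in>UNIV. (v $ i)\<^sup>2)"
    by (rule sum.reindex_bij_betw[OF Abs_wo_bij])
  then show ?thesis by (simp add: norm_vec_def L2_set_def of_wo_def)
qed

lemma dist_of_wo: "dist (of_wo v) (of_wo w) = dist v w"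
  using norm_of_wo[of "v - w"] by (simp add: dist_norm linear_diff[OF linear_of_wo])

lemma continuous_on_of_wo: "continuous_on S of_wo" and continuous_on_to_wo: "continuous_on T to_wo"
  by (simp_all add: linear_continuous_on linear_conv_bounded_linear[symmetric] linear_to_wo linear_of_wo)

lemma det_reindex_wo:
  fixes A :: "real^'d::finite^'d"
  shows "det (\<chi> i j. A $ Rep_wo i $ Rep_wo j) = det A"
proof -
  let ?M = "map_permutation (UNIV :: 'd set) Abs_wo"
  have inj: "inj (Abs_wo :: 'd \<Rightarrow> 'd wo)" using Abs_wo_bij by (rule bij_is_inj)
  have inv: "inv Abs_wo = (Rep_wo :: 'd wo \<Rightarrow> 'd)"
    by (rule inv_unique_comp) (auto simp: Abs_wo_inverse Rep_wo_inverse)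
  have bij_Rep: "bij (Rep_wo :: 'd wo \<Rightarrow> 'd)"
    unfolding inv[symmetric] by (rule bij_imp_bij_inv[OF Abs_wo_bij])
  have M: "?M p = Abs_wo \<circ> p \<circ> Rep_wo" for p :: "'d \<Rightarrow> 'd"
    by (simp add: map_permutation_def inv restrict_id_def fun_eq_iff bij_is_surj[OF Abs_wo_bij])
  have bij: "bij_betw ?M {p. p permutes UNIV} {p. p permutes UNIV}"
  proof (rule bij_betwI[where g = "\<lambda>q. Rep_wo \<circ> q \<circ> Abs_wo"])
    show "?M \<in> {p. p permutes UNIV} \<rightarrow> {p. p permutes UNIV}"
      using map_permutation_permutes[OF Abs_wo_bij] by auto
    show "(\<lambda>q. Rep_wo \<circ> q \<circ> Abs_wo) \<in> {p. p permutes UNIV} \<rightarrow> {p. p permutes (UNIV :: 'd set)}"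
    proof clarify
      fix q :: "'d wo \<Rightarrow> 'd wo" assume "q permutes UNIV"
      then have "bij (Rep_wo \<circ> q \<circ> Abs_wo)"
        by (intro bij_comp bij_Rep Abs_wo_bij permutes_bij[of q UNIV])
      then show "(Rep_wo \<circ> q \<circ> Abs_wo) permutes UNIV" by (rule bij_imp_permutes) simp
    qed
  qed (auto simp: M fun_eq_iff Abs_wo_inverse Rep_wo_inverse)
  have summand: "of_int (sign (?M p)) * (\<Prod>i\<in>UNIV. A $ Rep_wo i $ Rep_wo (?M p i)) =
      of_int (sign p) * (\<Prod>i\<in>UNIV. A $ i $ p i)" if "p permutes UNIV" for p
  proof -
    have "sign (?M p) = sign p" by (rule sign_map_permutation[OF inj that]) simp
    moreover have "(\<Prod>i\<in>UNIV. A $ Rep_wo i $ p (Rep_wo i)) = (\<Prod>i\<in>UNIV. A $ i $ p i)"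
      by (rule prod.reindex_bij_betw[OF bij_Rep])
    ultimately show ?thesis by (simp add: M Abs_wo_inverse)
  qed
  have "det (\<chi> i j. A $ Rep_wo i $ Rep_wo j) =
      (\<Sum>q | q permutes UNIV. of_int (sign q) * (\<Prod>i\<in>UNIV. A $ Rep_wo i $ Rep_wo (q i)))"
    by (simp add: det_def)
  also have "\<dots> = (\<Sum>p | p permutes UNIV. of_int (sign (?M p)) * (\<Prod>i\<in>UNIV. A $ Rep_wo i $ Rep_wo (?M p i)))"
    by (rule sum.reindex_bij_betw[OF bij, symmetric])
  also have "\<dots> = (\<Sum>p | p permutes UNIV. of_int (sign p) * (\<Prod>i\<in>UNIV. A $ i $ p i))"
    by (rule sum.cong) (simp_all add: summand)
  finally show ?thesis by (simp add: det_def)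
qed

lemma compact_support_integral:
  fixes h :: "'a::euclidean_space \<Rightarrow> real"
  assumes "continuous_on UNIV h" "compact S" "\<And>v. v \<notin> S \<Longrightarrow> h v = 0"
  shows "h absolutely_integrable_on S" "h absolutely_integrable_on UNIV" "integral S h = integral UNIV h"
proof -
  obtain a b where ab: "S \<subseteq> cbox a b" using bounded_subset_cbox_symmetric[OF compact_imp_bounded[OF assms(2)]] by metis
  have cb: "h absolutely_integrable_on cbox a b"
    by (rule absolutely_integrable_continuous[OF continuous_on_subset[OF assms(1)]]) simp
  show S: "h absolutely_integrable_on S"
    by (rule set_integrable_subset[OF cb _ ab]) (use assms(2) in \<open>simp add: borel_compact\<close>)
  have eq: "(\<lambda>x. if x \<in> S then h x else 0) = h" using assms(3) by auto
  show "integral S h = integral UNIV h"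
    using integral_restrict_UNIV[of S h] unfolding eq by simp
  show "h absolutely_integrable_on UNIV"
    using S absolutely_integrable_restrict_UNIV[of S h] unfolding eq by simp
qed

text \<open>
  The Lebesgue integral after relabelling the coordinates. Only a functional with a change of variables
  formula and volume bounds from both sides is wanted, so it is left in this form.
\<close>

definition volume_integral :: "(real^'d::finite \<Rightarrow> real) \<Rightarrow> real" where
  "volume_integral g = integral UNIV (\<lambda>v. g (of_wo v))"

lemma volume_integral_compact_support:
  fixes g :: "real^'d::finite \<Rightarrow> real"
  assumes g: "continuous_on UNIV g" "\<And>x. x \<notin> K \<Longrightarrow> g x = 0" and K: "compact K"
  shows "compact (to_wo ` K)" "(\<lambda>v. g (of_wo v)) absolutely_integrable_on to_wo ` K"
    "(\<lambda>v. g (of_wo v)) absolutely_integrable_on UNIV"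
    "integral (to_wo ` K) (\<lambda>v. g (of_wo v)) = volume_integral g"
proof -
  show S: "compact (to_wo ` K)" by (rule compact_continuous_image[OF continuous_on_to_wo K])
  have cont: "continuous_on UNIV (\<lambda>v. g (of_wo v))"
    by (rule continuous_on_compose2[OF g(1) continuous_on_of_wo]) simp
  have "g (of_wo v) = 0" if "v \<notin> to_wo ` K" for v
    using that g(2)[of "of_wo v"] by (metis image_eqI to_wo_of_wo)
  note int = compact_support_integral[OF cont S this]
  show "(\<lambda>v. g (of_wo v)) absolutely_integrable_on to_wo ` K"
    "(\<lambda>v. g (of_wo v)) absolutely_integrable_on UNIV"
    "integral (to_wo ` K) (\<lambda>v. g (of_wo v)) = volume_integral g"
    using int by (simp_all add: volume_integral_def)
qed

lemma volume_integral_change_of_variables: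
  fixes \<psi> :: "real^'d::finite \<Rightarrow> real^'d"
  assumes K: "compact K" and der: "\<And>x. x \<in> K \<Longrightarrow> \<psi> differentiable (at x)" and inj: "inj_on \<psi> K"
    and f: "continuous_on UNIV f" "\<And>y. y \<notin> \<psi> ` K \<Longrightarrow> f y = 0"
    and g: "continuous_on UNIV g" "\<And>x. x \<notin> K \<Longrightarrow> g x = 0"
    and fg: "\<And>x. x \<in> K \<Longrightarrow> \<bar>det (jacobian \<psi> (at x))\<bar> * f (\<psi> x) = g x"
  shows "volume_integral f = volume_integral g"
proof -
  let ?S = "to_wo ` K"
  let ?\<Psi> = "\<lambda>v. to_wo (\<psi> (of_wo v))"
  let ?D = "\<lambda>v u. to_wo (jacobian \<psi> (at (of_wo v)) *v of_wo u)"
  note g_int = volume_integral_compact_support[OF g K]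
  have der': "(?\<Psi> has_derivative ?D v) (at v within ?S)" if "v \<in> ?S" for v
  proof -
    have "of_wo v \<in> K" using that by auto
    from jacobian_has_derivative[OF der[OF this]]
    have 1: "(\<psi> has_derivative (*v) (jacobian \<psi> (at (of_wo v)))) (at (of_wo v))" .
    have 2: "(of_wo has_derivative of_wo) (at v)" and 3: "(to_wo has_derivative to_wo) (at y)" for y
      by (simp_all add: linear_imp_has_derivative linear_of_wo linear_to_wo)
    show ?thesis
      by (rule has_derivative_at_withinI[OF has_derivative_compose[OF has_derivative_compose[OF 2 1] 3]])
  qed
  have inj': "inj_on ?\<Psi> ?S"
  proof (rule inj_onI)
    fix v w assume v: "v \<in> ?S" and w: "w \<in> ?S" and "?\<Psi> v = ?\<Psi> w"
    then have "\<psi> (of_wo v) = \<psi> (of_wo w)" by (metis of_wo_to_wo)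
    then have "of_wo v = of_wo w" by (rule inj_onD[OF inj]) (use v w in auto)
    then show "v = w" by (metis to_wo_of_wo)
  qed
  have matD: "matrix (?D v) = (\<chi> i j. jacobian \<psi> (at (of_wo v)) $ Rep_wo i $ Rep_wo j)" for v
  proof -
    have ax: "of_wo (axis j 1) = axis (Rep_wo j) 1" for j :: "'d wo"
      by (simp add: of_wo_def axis_def vec_eq_iff) (metis Abs_wo_inverse Rep_wo_inverse UNIV_I)
    show ?thesis
      unfolding matrix_def to_wo_def ax by (simp add: vec_eq_iff matrix_vector_mul_component inner_axis)
  qed
  have detD: "\<bar>det (matrix (?D v))\<bar> = \<bar>det (jacobian \<psi> (at (of_wo v)))\<bar>" for v
    unfolding matD det_reindex_wo ..
  let ?f = "\<lambda>v. vec (f (of_wo v)) :: real^1"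
  have img: "?\<Psi> ` ?S = to_wo ` \<psi> ` K" by (auto simp: image_image)
  have "continuous_on K \<psi>"
    using der by (meson continuous_at_imp_continuous_on differentiable_imp_continuous_within)
  note f_int = volume_integral_compact_support[OF f compact_continuous_image[OF this K], folded img]
  have eq: "\<bar>det (matrix (?D v))\<bar> *\<^sub>R ?f (?\<Psi> v) = vec (g (of_wo v))" if "v \<in> ?S" for v
    using fg[of "of_wo v"] that unfolding detD by (auto simp: vec_eq_iff)
  have "(\<lambda>v. vec (g (of_wo v)) :: real^1) absolutely_integrable_on ?S"
    using g_int(2) by (simp add: absolutely_integrable_on_1_iff)
  then have a: "(\<lambda>v. \<bar>det (matrix (?D v))\<bar> *\<^sub>R ?f (?\<Psi> v)) absolutely_integrable_on ?S"
    by (subst set_integrable_cong[OF refl refl eq])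
  have b: "integral ?S (\<lambda>v. \<bar>det (matrix (?D v))\<bar> *\<^sub>R ?f (?\<Psi> v)) = integral ?S (\<lambda>v. vec (g (of_wo v)))"
    by (rule integral_cong) (rule eq)
  have "integral (?\<Psi> ` ?S) ?f = integral ?S (\<lambda>v. vec (g (of_wo v)))"
    using has_absolute_integral_change_of_variables_compact[OF g_int(1) der' inj', of ?f] a b by blast
  then have "integral (?\<Psi> ` ?S) (\<lambda>v. f (of_wo v)) = integral ?S (\<lambda>v. g (of_wo v))"
    by (simp add: integral_on_1_eq)
  then show ?thesis using f_int(4) g_int(4) by simp
qed

lemma volume_integral_upper:
  fixes g :: "real^'d::finite \<Rightarrow> real"
  assumes g: "continuous_on UNIV g" "\<And>x. x \<notin> K \<Longrightarrow> g x = 0" "\<And>x. g x \<le> e" and K: "compact K"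
  shows "volume_integral g \<le> e * measure lebesgue (to_wo ` K)"
proof -
  let ?S = "to_wo ` K"
  note g_int = volume_integral_compact_support[OF g(1,2) K]
  have "integral ?S (\<lambda>v. g (of_wo v)) \<le> integral ?S (\<lambda>v. e)"
    using g_int(2) g(3) lmeasurable_compact[OF g_int(1)]
    by (intro integral_le) (auto simp: absolutely_integrable_on_def integrable_on_const)
  also have "\<dots> = e * measure lebesgue ?S"
    using lmeasure_integral[OF lmeasurable_compact[OF g_int(1)]] integral_mult_right[of ?S e "\<lambda>_. 1"] by simp
  finally show ?thesis
    using g_int(4) by simp
qed

lemma volume_integral_lower:
  fixes g :: "real^'d::finite \<Rightarrow> real"
  assumes g: "continuous_on UNIV g" "compact K" "\<And>x. x \<notin> K \<Longrightarrow> g x = 0" "\<And>x. 0 \<le> g x"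
    and s: "\<And>x. dist y x \<le> r \<Longrightarrow> s \<le> g x" and "r > 0"
  shows "s * measure lborel (cball (0 :: real^'d wo) r) \<le> volume_integral g"
proof -
  let ?B = "\<lambda>w. cball w r :: (real^'d wo) set"
  have B: "measure lborel (?B w) = measure lborel (?B 0)" for w
    using \<open>r > 0\<close> by (simp add: content_cball)
  note g_int = volume_integral_compact_support[OF g(1,3,2)]
  have intU: "(\<lambda>v. g (of_wo v)) integrable_on UNIV" using g_int(3) by (simp add: absolutely_integrable_on_def)
  have intB: "(\<lambda>v. g (of_wo v)) integrable_on ?B (to_wo y)"
    using set_integrable_subset[OF g_int(3), of "?B (to_wo y)"] by (simp add: absolutely_integrable_on_def)
  have "s * measure lborel (?B 0) = integral (?B (to_wo y)) (\<lambda>_. s)"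
    using lmeasure_integral[OF lmeasurable_cball, of "to_wo y" r] integral_mult_right[of "?B (to_wo y)" s "\<lambda>_. 1"]
      B[of "to_wo y"] by (simp add: measure_completion)
  also have "\<dots> \<le> integral (?B (to_wo y)) (\<lambda>v. g (of_wo v))"
  proof (rule integral_le[OF integrable_on_const[OF lmeasurable_cball] intB])
    fix v assume "v \<in> ?B (to_wo y)"
    then have "dist y (of_wo v) \<le> r" using dist_of_wo[of "to_wo y" v] by simp
    then show "s \<le> g (of_wo v)" by (rule s)
  qed
  also have "\<dots> \<le> volume_integral g"
    unfolding volume_integral_def by (rule integral_subset_le[OF _ intB intU]) (use g(4) in auto)
  finally show ?thesis .
qed

section \<open>Recurrence of power bounded orbits\<close>

lemma bounded_smooth_subset:
  assumes "bounded_smooth n U K f" "\<And>i. U' i \<subseteq> U i" "\<And>i. K' i \<subseteq> K i"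
  shows "bounded_smooth n U' K' f"
  using assms unfolding bounded_smooth_def by (meson subsetD)

lemma lipschitz_if_partial_derivs_bounded:
  fixes f :: "real^'d::finite \<Rightarrow> 'b::real_normed_vector" and C :: real
  assumes f: "smooth_on UNIV f" and bd: "\<And>i x. norm (partial_deriv i f x) \<le> C"
  shows "norm (f x - f y) \<le> (CARD('d) * C) * norm (x - y)"
proof (rule differentiable_bound[OF convex_UNIV, of f "\<lambda>x. frechet_derivative f (at x)"])
  fix z
  have d: "f differentiable at z" using smooth_on_imp_differentiable[OF f] by simp
  then show "(f has_derivative frechet_derivative f (at z)) (at z within UNIV)"
    by (simp add: frechet_derivative_works)
  show "onorm (frechet_derivative f (at z)) \<le> CARD('d) * C"
  proof (rule onorm_le)
    fix v
    have "norm (frechet_derivative f (at z) v) \<le> (\<Sum>i\<in>UNIV. norm ((v $ i) *\<^sub>R partial_deriv i f z))"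
      unfolding frechet_derivative_eq_sum_partial_deriv[OF d] by (rule norm_sum)
    also have "\<dots> \<le> (\<Sum>i\<in>(UNIV :: 'd set). norm v * C)"
      using component_le_norm_cart[of v] bd by (intro sum_mono) (simp add: mult_mono)
    finally show "norm (frechet_derivative f (at z) v) \<le> (CARD('d) * C) * norm v" by (simp add: mult_ac)
  qed
qed auto

context diffeo
begin

lemma T_in: "\<phi> \<in> test_functions X \<Longrightarrow> T \<phi> \<in> test_functions X"
  by (rule continuous_test_map_in[OF T_continuous])

lemma T_pow_in: "\<phi> \<in> test_functions X \<Longrightarrow> (T ^^ m) \<phi> \<in> test_functions X"
  by (rule continuous_test_map_funpow_in[OF T_continuous])

text \<open>
  The factor \<open>1 / \<bar>det J\<psi>\<bar>\<close> makes \<open>T\<close> an isometry for the \<open>L\<^sup>1\<close> norm.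
\<close>

lemma T_preserves_volume_integral:
  assumes "\<phi> \<in> test_functions X"
  shows "volume_integral (\<lambda>y. cmod (T \<phi> y)) = volume_integral (\<lambda>x. cmod (\<phi> x))"
proof -
  obtain K where K: "compact K" "K \<subseteq> X" "\<phi> \<in> test_functions_in K" using assms by (rule test_functionsE)
  note T\<phi> = T_test_function[OF K]
  show ?thesis
  proof (rule volume_integral_change_of_variables[OF K(1), of \<psi>])
    show "\<psi> differentiable (at x)" if "x \<in> K" for x
      using that K(2) smooth_on_imp_differentiable[OF smooth_psi] by auto
    show "inj_on \<psi> K" using bij K(2) by (meson bij_betw_imp_inj_on inj_on_subset)
    show "continuous_on UNIV (\<lambda>y. cmod (T \<phi> y))" "continuous_on UNIV (\<lambda>x. cmod (\<phi> x))"
      by (intro continuous_on_norm smooth_on_imp_continuous_on test_functions_in_smooth[OF T\<phi>] test_functions_in_smooth[OF K(3)])+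
    show "cmod (T \<phi> y) = 0" if "y \<notin> \<psi> ` K" for y using test_functions_in_eq_0[OF T\<phi> that] by simp
    show "cmod (\<phi> x) = 0" if "x \<notin> K" for x using test_functions_in_eq_0[OF K(3) that] by simp
    show "\<bar>det (jacobian \<psi> (at x))\<bar> * cmod (T \<phi> (\<psi> x)) = cmod (\<phi> x)" if "x \<in> K" for x
    proof -
      have x: "x \<in> X" using that K(2) by auto
      then have "cmod (T \<phi> (\<psi> x)) = cmod (\<phi> x) * weight x"
        using weight_pos[OF x] by (simp add: T_psi norm_mult)
      then show ?thesis using det_nz[OF x] by (simp add: weight_def)
    qed
  qed
qed

lemma T_pow_preserves_volume_integral:
  "\<phi> \<in> test_functions X \<Longrightarrow> volume_integral (\<lambda>y. cmod ((T ^^ m) \<phi> y)) = volume_integral (\<lambda>x. cmod (\<phi> x))"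
  by (induction m) (simp_all add: T_preserves_volume_integral T_pow_in)

lemma T_pow_diff: "\<phi> \<in> test_functions X \<Longrightarrow> \<eta> \<in> test_functions X \<Longrightarrow>
    (T ^^ m) (\<lambda>x. \<phi> x - \<eta> x) = (\<lambda>x. (T ^^ m) \<phi> x - (T ^^ m) \<eta> x)"
proof (induction m)
  case (Suc m)
  have "T (\<lambda>x. f x - g x) = (\<lambda>x. T f x - T g x)" for f g
    using T_add[of f "\<lambda>x. (-1) * g x"] T_scale[of "-1" g] by simp
  with Suc show ?case by simp
qed simp

text \<open>
  In the applications the factor \<open>f\<close> is \<open>1\<close> or a coordinate function.
\<close>

lemma exists_test_cutoff:
  assumes "compact K" "K \<subseteq> X"
  obtains b where "smooth_on UNIV b" "\<And>x. b x \<ge> 0" "\<And>x. x \<in> K \<Longrightarrow> b x \<ge> 1" "{x. b x \<noteq> 0} \<subseteq> X"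
    "\<And>f. smooth_on UNIV f \<Longrightarrow> (\<lambda>x. complex_of_real (b x * f x)) \<in> test_functions X"
proof -
  obtain b :: "real^'d \<Rightarrow> real" where b: "smooth_on UNIV b" "\<And>x. b x \<ge> 0" "\<And>x. x \<in> K \<Longrightarrow> b x \<ge> 1"
    "compact (closure {x. b x \<noteq> 0})" "closure {x. b x \<noteq> 0} \<subseteq> X"
    by (rule exists_cutoff[OF open_X assms]) (rule that)
  have cut: "(\<lambda>x. complex_of_real (b x * f x)) \<in> test_functions X" if f: "smooth_on UNIV f" for f :: "real^'d \<Rightarrow> real"
  proof (rule test_functionsI[OF b(4,5)], rule test_functions_inI[OF _ b(4)])
    show "smooth_on UNIV (\<lambda>x. complex_of_real (b x * f x))"
      by (intro smooth_on_linear[OF open_UNIV bounded_linear_of_real] smooth_on_mult b(1) f) simp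
    fix x assume "x \<notin> closure {x. b x \<noteq> 0}"
    then have "b x = 0" using closure_subset[of "{x. b x \<noteq> 0}"] by blast
    then show "complex_of_real (b x * f x) = 0" by simp
  qed
  have sub: "{x. b x \<noteq> 0} \<subseteq> X" by (rule order_trans[OF closure_subset b(5)])
  show thesis by (rule that[of b, OF b(1) b(2) b(3) sub cut])
qed

end

text \<open>
  Condition (i) in the form in which it is used: it is tested on cutoff functions and their products
  with coordinates, so orbits of single functions suffice.
\<close>

locale diffeo_bounded_orbits = diffeo X \<psi>
  for X :: "(real^'d::finite) set" and \<psi> +
  assumes orbit_bounded: "\<And>\<phi>. \<phi> \<in> test_functions X \<Longrightarrow>
    bounded_tests X (\<Union>m\<in>{1..}. (T ^^ m) ` {\<phi>})"
begin

lemma orbit_support: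
  assumes "\<phi> \<in> test_functions X"
  obtains L where "compact L" "L \<subseteq> X" "\<And>m. m \<ge> 1 \<Longrightarrow> (T ^^ m) \<phi> \<in> test_functions_in L"
    "\<And>n. \<exists>C. \<forall>m\<ge>1. \<forall>\<alpha> x. length \<alpha> \<le> n \<longrightarrow> cmod (iter_partial \<alpha> ((T ^^ m) \<phi>) x) \<le> C"
proof -
  obtain L where L: "compact L" "L \<subseteq> X" "(\<Union>m\<in>{1..}. (T ^^ m) ` {\<phi>}) \<subseteq> test_functions_in L"
    and bd: "\<forall>n. \<exists>C. \<forall>\<eta>\<in>(\<Union>m\<in>{1..}. (T ^^ m) ` {\<phi>}). Cn_norm n L \<eta> \<le> C"
    using orbit_bounded[OF assms] unfolding von_Neumann_bounded_test_iff[OF open_X] by blast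
  have in_L: "(T ^^ m) \<phi> \<in> test_functions_in L" if "m \<ge> 1" for m using L(3) that by auto
  have "\<exists>C. \<forall>m\<ge>1. \<forall>\<alpha> x. length \<alpha> \<le> n \<longrightarrow> cmod (iter_partial \<alpha> ((T ^^ m) \<phi>) x) \<le> C" for n
  proof -
    obtain C where C: "\<forall>\<eta>\<in>(\<Union>m\<in>{1..}. (T ^^ m) ` {\<phi>}). Cn_norm n L \<eta> \<le> C" using bd by blast
    have "cmod (iter_partial \<alpha> ((T ^^ m) \<phi>) x) \<le> C" if "m \<ge> 1" "length \<alpha> \<le> n" for m \<alpha> x
    proof -
      have "Cn_norm n L ((T ^^ m) \<phi>) \<le> C" using C that(1) by auto
      with iter_partial_le_Cn_norm[OF in_L[OF that(1)] L(1) that(2), of x] show ?thesis by simp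
    qed
    then show ?thesis by blast
  qed
  note bounds = this
  show thesis by (rule that[OF L(1) L(2) in_L bounds])
qed

text \<open>
  If \<open>b \<ge> 1\<close> on \<open>K\<close> then \<open>T\<^sup>m b \<ge> cocycle m > 0\<close> along the orbit of a point of \<open>K\<close>. So the common support of the
  functions \<open>T\<^sup>m b\<close> contains these orbits, and their common upper bound is one for \<open>cocycle m\<close>.
\<close>

lemma cutoff_orbit:
  assumes K: "compact K" "K \<subseteq> X"
  obtains L C where "compact L" "L \<subseteq> X" "C > 0"
    "\<And>m x. m \<ge> 1 \<Longrightarrow> x \<in> K \<Longrightarrow> (\<psi> ^^ m) x \<in> L \<and> cocycle m x \<le> C"
proof -
  obtain b where b: "smooth_on UNIV b" "\<And>x. b x \<ge> 0" "\<And>x. x \<in> K \<Longrightarrow> b x \<ge> 1" "{x. b x \<noteq> 0} \<subseteq> X"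
    "\<And>f. smooth_on UNIV f \<Longrightarrow> (\<lambda>x. complex_of_real (b x * f x)) \<in> test_functions X"
    by (rule exists_test_cutoff[OF K]) (rule that)
  let ?\<phi> = "\<lambda>x. complex_of_real (b x * 1)"
  have \<phi>: "?\<phi> \<in> test_functions X" by (rule b(5)[OF smooth_on_const[OF open_UNIV]])
  obtain L where L: "compact L" "L \<subseteq> X" "\<And>m. m \<ge> 1 \<Longrightarrow> (T ^^ m) ?\<phi> \<in> test_functions_in L"
    and bd: "\<And>n. \<exists>C. \<forall>m\<ge>1. \<forall>\<alpha> x. length \<alpha> \<le> n \<longrightarrow> cmod (iter_partial \<alpha> ((T ^^ m) ?\<phi>) x) \<le> C"
    by (rule orbit_support[OF \<phi>]) (rule that)
  obtain C where C: "\<forall>m\<ge>1. \<forall>\<alpha> x. length \<alpha> \<le> 0 \<longrightarrow> cmod (iter_partial \<alpha> ((T ^^ m) ?\<phi>) x) \<le> C"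
    using bd[of 0] by blast
  have "(\<psi> ^^ m) x \<in> L \<and> cocycle m x \<le> max C 1" if m: "m \<ge> 1" and xK: "x \<in> K" for m x
  proof -
    have x: "x \<in> X" using xK K by blast
    have "cocycle m x \<le> b x * cocycle m x"
      using b(3)[OF xK] cocycle_pos[OF x, of m] by simp
    also have "\<dots> = cmod ((T ^^ m) ?\<phi> ((\<psi> ^^ m) x))"
      using b(3)[OF xK] cocycle_pos[OF x, of m] by (simp add: T_pow_psi_pow[OF x] norm_mult)
    finally have le: "cocycle m x \<le> cmod ((T ^^ m) ?\<phi> ((\<psi> ^^ m) x))" .
    have "(\<psi> ^^ m) x \<in> L"
      using le cocycle_pos[OF x, of m] test_functions_in_eq_0[OF L(3)[OF m]] by force
    moreover have "cmod ((T ^^ m) ?\<phi> ((\<psi> ^^ m) x)) \<le> C" using C[rule_format, OF m, of "[]"] by simp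
    ultimately show ?thesis using le by simp
  qed
  then show thesis by (intro that[OF L(1,2), of "max C 1"]) simp_all
qed

lemma stable_orbits_psi: "stable_orbits X \<psi>"
  unfolding stable_orbits_def
proof (intro allI impI)
  fix K assume K: "compact K \<and> K \<subseteq> X"
  obtain L C where L: "compact L" "L \<subseteq> X" "C > 0" "\<And>m x. m \<ge> 1 \<Longrightarrow> x \<in> K \<Longrightarrow> (\<psi> ^^ m) x \<in> L \<and> cocycle m x \<le> C"
    by (rule cutoff_orbit[OF conjunct1[OF K] conjunct2[OF K]]) (rule that)
  then show "\<exists>L. compact L \<and> L \<subseteq> X \<and> (\<forall>m\<ge>1. (\<psi> ^^ m) ` K \<subseteq> L)" by blast
qed

text \<open>
  A function of small \<open>L\<^sup>1\<close> norm with a given Lipschitz constant is uniformly small. The orbit of \<open>\<phi>\<close> is relatively compact for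
  uniform convergence, which provides \<open>a\<close> and \<open>r\<close> such that \<open>T\<^sup>a (\<phi> - T\<^sup>r \<phi>)\<close> is small, first uniformly and, as
  the supports lie in \<open>L\<close>, in \<open>L\<^sup>1\<close>. Invariance of the \<open>L\<^sup>1\<close> norm removes \<open>T\<^sup>a\<close>.
\<close>

lemma recurrence:
  assumes \<phi>: "\<phi> \<in> test_functions X" and \<delta>: "\<delta> > 0"
  shows "\<exists>r\<ge>N. \<forall>y. cmod (\<phi> y - (T ^^ r) \<phi> y) < \<delta>"
proof -
  obtain K0 where K0: "compact K0" "\<phi> \<in> test_functions_in K0" using \<phi> by (rule test_functionsE)
  obtain L where L: "compact L" "L \<subseteq> X" and in_L: "\<And>m. m \<ge> 1 \<Longrightarrow> (T ^^ m) \<phi> \<in> test_functions_in L"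
    and bd: "\<And>n. \<exists>C. \<forall>m\<ge>1. \<forall>\<alpha> x. length \<alpha> \<le> n \<longrightarrow> cmod (iter_partial \<alpha> ((T ^^ m) \<phi>) x) \<le> C"
    by (rule orbit_support[OF \<phi>]) (rule that)
  obtain C where C: "\<And>m \<alpha> x. m \<ge> 1 \<Longrightarrow> length \<alpha> \<le> 1 \<Longrightarrow> cmod (iter_partial \<alpha> ((T ^^ m) \<phi>) x) \<le> C"
    using bd[of 1] by blast
  define M where "M = CARD('d) * max C (Cn_norm 1 K0 \<phi>) + 1"
  have "Cn_norm 1 K0 \<phi> \<ge> 0" by (rule Cn_norm_nonneg[OF K0(2,1)])
  then have M: "M > 0" by (simp add: M_def add_nonneg_pos)
  have lip: "cmod ((T ^^ m) \<phi> x - (T ^^ m) \<phi> y) \<le> M * norm (x - y)" for m x y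
  proof -
    have "cmod (partial_deriv i ((T ^^ m) \<phi>) x) \<le> max C (Cn_norm 1 K0 \<phi>)" for i x
    proof (cases "m = 0")
      case True
      then show ?thesis using iter_partial_le_Cn_norm[OF K0(2,1), of "[i]" 1 x] by simp
    next
      case False
      then show ?thesis using C[of m "[i]" x] by simp
    qed
    from lipschitz_if_partial_derivs_bounded[OF test_functions_smooth[OF T_pow_in[OF \<phi>]] this]
    have "cmod ((T ^^ m) \<phi> x - (T ^^ m) \<phi> y) \<le> (CARD('d) * max C (Cn_norm 1 K0 \<phi>)) * norm (x - y)" .
    also have "\<dots> \<le> M * norm (x - y)" by (intro mult_right_mono) (auto simp: M_def)
    finally show ?thesis .
  qed
  define V where "V = measure lebesgue (to_wo ` L)"
  define c where "c = measure lborel (cball (0 :: real^'d wo) (\<delta> / (4 * M)))"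
  have rad: "\<delta> / (4 * M) > 0" using \<delta> M by simp
  have V: "V \<ge> 0" by (simp add: V_def)
  have c: "c > 0" unfolding c_def by (rule content_cball_pos[OF rad])
  \<comment> \<open>If \<open>\<bar>w\<bar> \<ge> \<delta>\<close> somewhere, then \<open>\<bar>w\<bar> \<ge> \<delta> / 2\<close> on a ball of volume \<open>c\<close>, as \<open>w\<close> is the difference of two
    \<open>M\<close>-Lipschitz functions; a uniform bound \<open>e\<close> of \<open>T\<^sup>a w\<close> on \<open>L\<close> with \<open>e V < c \<delta> / 2\<close> excludes this.\<close>
  define e where "e = \<delta> / 2 * c / (V + 1)"
  have e: "e > 0" "e * V < \<delta> / 2 * c"
    using \<delta> c V by (simp_all add: e_def divide_less_eq field_simps)
  obtain g k where "strict_mono (k :: nat \<Rightarrow> nat)"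
    and k: "\<And>e. 0 < e \<Longrightarrow> \<exists>N. \<forall>n x. n \<ge> N \<and> x \<in> L \<longrightarrow> cmod ((T ^^ Suc (k n)) \<phi> x - g x) < e"
  proof (rule Arzela_Ascoli[OF L(1), of "\<lambda>n. (T ^^ Suc n) \<phi>" C])
    show "cmod ((T ^^ Suc n) \<phi> x) \<le> C" for n x using C[of "Suc n" "[]" x] by simp
    show "\<exists>d>0. \<forall>n y. y \<in> L \<and> norm (x - y) < d \<longrightarrow> cmod ((T ^^ Suc n) \<phi> x - (T ^^ Suc n) \<phi> y) < e"
      if "e > 0" for x e
    proof (intro exI[of _ "e / M"] conjI allI impI)
      show "e / M > 0" using that M by simp
      fix n y assume "y \<in> L \<and> norm (x - y) < e / M"
      then have "M * norm (x - y) < e" using M by (simp add: field_simps)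
      with lip[of "Suc n" x y] show "cmod ((T ^^ Suc n) \<phi> x - (T ^^ Suc n) \<phi> y) < e" by linarith
    qed
  qed blast
  obtain n0 where n0: "\<And>n x. n \<ge> n0 \<Longrightarrow> x \<in> L \<Longrightarrow> cmod ((T ^^ Suc (k n)) \<phi> x - g x) < e / 2"
    using k[of "e / 2"] e(1) by auto
  define a where "a = Suc (k n0)"
  define r where "r = k (n0 + N) - k n0"
  have mono: "k n0 + N \<le> k (n0 + N)"
  proof (induction N)
    case (Suc N)
    have "k (n0 + N) < k (n0 + Suc N)" using \<open>strict_mono k\<close> by (simp add: strict_mono_def)
    with Suc show ?case by simp
  qed simp
  have r: "r \<ge> N" "Suc (k (n0 + N)) = a + r" using mono by (auto simp: r_def a_def)
  let ?w = "\<lambda>x. \<phi> x - (T ^^ r) \<phi> x"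
  have w: "?w \<in> test_functions X"
    by (rule function_space_diff[OF test_function_space \<phi> T_pow_in[OF \<phi>]])
  then obtain K where K: "compact K" "?w \<in> test_functions_in K" by (rule test_functionsE)
  have "(T ^^ a) ((T ^^ r) \<phi>) = (T ^^ (a + r)) \<phi>" by (simp add: funpow_add)
  then have Tw: "(T ^^ a) ?w = (\<lambda>x. (T ^^ a) \<phi> x - (T ^^ (a + r)) \<phi> x)"
    using T_pow_diff[OF \<phi> T_pow_in[OF \<phi>], of a r] by simp
  have Tw0: "(T ^^ a) ?w x = 0" if "x \<notin> L" for x
  proof -
    have "a \<ge> 1" "a + r \<ge> 1" by (simp_all add: a_def)
    then show ?thesis
      unfolding Tw using test_functions_in_eq_0[OF in_L that] by simp
  qed
  have Tw_le: "cmod ((T ^^ a) ?w x) \<le> e" for x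
  proof (cases "x \<in> L")
    case True
    have "cmod ((T ^^ a) \<phi> x - g x) < e / 2" "cmod ((T ^^ (a + r)) \<phi> x - g x) < e / 2"
      using n0[OF _ True, of n0] n0[OF _ True, of "n0 + N"] unfolding r(2)[symmetric] by (simp_all add: a_def)
    then show ?thesis
      unfolding Tw using norm_triangle_ineq4[of "(T ^^ a) \<phi> x - g x" "(T ^^ (a + r)) \<phi> x - g x"] by simp
  qed (use Tw0 e(1) in simp)
  have "volume_integral (\<lambda>x. cmod ((T ^^ a) ?w x)) \<le> e * V"
    unfolding V_def
    by (rule volume_integral_upper[OF continuous_on_norm[OF smooth_on_imp_continuous_on[OF
            test_functions_smooth[OF T_pow_in[OF w]]]] _ Tw_le L(1)])
      (simp add: Tw0)
  then have upper: "volume_integral (\<lambda>x. cmod (?w x)) \<le> e * V"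
    unfolding T_pow_preserves_volume_integral[OF w] .
  have "cmod (?w y) < \<delta>" for y
  proof (rule ccontr)
    assume "\<not> cmod (?w y) < \<delta>"
    then have y: "cmod (?w y) \<ge> \<delta>" by simp
    have "\<delta> / 2 * c \<le> volume_integral (\<lambda>x. cmod (?w x))"
      unfolding c_def
    proof (rule volume_integral_lower[OF _ K(1) _ _ _ rad])
      show "continuous_on UNIV (\<lambda>x. cmod (?w x))"
        by (intro continuous_on_norm smooth_on_imp_continuous_on[OF test_functions_smooth[OF w]])
      show "cmod (?w x) = 0" if "x \<notin> K" for x using test_functions_in_eq_0[OF K(2) that] by simp
      fix x assume "dist y x \<le> \<delta> / (4 * M)"
      then have d: "M * norm (y - x) \<le> \<delta> / 4" using M by (simp add: dist_norm field_simps)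
      have "cmod (?w y - ?w x) \<le> cmod (\<phi> y - \<phi> x) + cmod ((T ^^ r) \<phi> y - (T ^^ r) \<phi> x)"
        using norm_triangle_ineq4[of "\<phi> y - \<phi> x" "(T ^^ r) \<phi> y - (T ^^ r) \<phi> x"] by (simp add: algebra_simps)
      also have "\<dots> \<le> \<delta> / 2" using lip[of 0 y x] lip[of r y x] d by simp
      finally show "\<delta> / 2 \<le> cmod (?w x)"
        using y norm_triangle_ineq2[of "?w y" "?w x"] by linarith
    qed simp
    with upper e(2) show False by simp
  qed
  with r(1) show ?thesis by blast
qed

text \<open>
  If \<open>b \<ge> 1\<close> on a compact set containing all \<open>\<psi>\<^sup>m(K)\<close>, then \<open>T\<^sup>r b \<ge> 1/2\<close> on \<open>\<psi>\<^sup>r(K)\<close> for arbitrarily large \<open>r\<close>, by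
  recurrence; thus \<open>cocycle r\<close> is bounded below on \<open>K\<close>. As \<open>cocycle (r - m)\<close> is bounded above along the orbit,
  \<open>cocycle m\<close> cannot be much smaller than \<open>cocycle r\<close> for \<open>m < r\<close>.
\<close>

lemma cocycle_lower:
  assumes K: "compact K" "K \<subseteq> X"
  obtains c where "c > 0" "\<And>m x. m \<ge> 1 \<Longrightarrow> x \<in> K \<Longrightarrow> c \<le> cocycle m x"
proof -
  obtain L C0 where L: "compact L" "L \<subseteq> X" "C0 > 0" "\<And>m x. m \<ge> 1 \<Longrightarrow> x \<in> K \<Longrightarrow> (\<psi> ^^ m) x \<in> L \<and> cocycle m x \<le> C0"
    by (rule cutoff_orbit[OF K]) (rule that)
  obtain L' C where C: "compact L'" "L' \<subseteq> X" "C > 0" "\<And>m x. m \<ge> 1 \<Longrightarrow> x \<in> L \<Longrightarrow> (\<psi> ^^ m) x \<in> L' \<and> cocycle m x \<le> C"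
    by (rule cutoff_orbit[OF L(1,2)]) (rule that)
  obtain b where b: "smooth_on UNIV b" "\<And>x. b x \<ge> 0" "\<And>x. x \<in> L \<Longrightarrow> b x \<ge> 1" "{x. b x \<noteq> 0} \<subseteq> X"
    "\<And>f. smooth_on UNIV f \<Longrightarrow> (\<lambda>x. complex_of_real (b x * f x)) \<in> test_functions X"
    by (rule exists_test_cutoff[OF L(1,2)]) (rule that)
  let ?\<phi> = "\<lambda>x. complex_of_real (b x * 1)"
  have \<phi>: "?\<phi> \<in> test_functions X" by (rule b(5)[OF smooth_on_const[OF open_UNIV]])
  have "compact (b ` K)"
    by (rule compact_continuous_image[OF continuous_on_subset[OF smooth_on_imp_continuous_on[OF b(1)]] K(1)]) simp
  from compact_imp_bounded[OF this] obtain B where B: "B > 0" "\<And>x. x \<in> K \<Longrightarrow> b x \<le> B"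
    unfolding bounded_pos by (force simp: abs_le_iff)
  have "1 / (2 * B * C) \<le> cocycle m x" if m: "m \<ge> 1" and x: "x \<in> K" for m x
  proof -
    have xX: "x \<in> X" using x K(2) by blast
    obtain r where r: "r \<ge> Suc m" "\<And>y. cmod (?\<phi> y - (T ^^ r) ?\<phi> y) < 1 / 2"
      using recurrence[OF \<phi>, of "1 / 2" "Suc m"] by auto
    let ?y = "(\<psi> ^^ r) x"
    have "r \<ge> 1" using r(1) by simp
    then have y: "?y \<in> L" using L(4) x by blast
    have "cmod (?\<phi> ?y) \<le> cmod ((T ^^ r) ?\<phi> ?y) + cmod (?\<phi> ?y - (T ^^ r) ?\<phi> ?y)"
      using norm_triangle_ineq[of "(T ^^ r) ?\<phi> ?y" "?\<phi> ?y - (T ^^ r) ?\<phi> ?y"] by simp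
    moreover have "cmod (?\<phi> ?y) \<ge> 1" using b(3)[OF y] by simp
    moreover have "cmod ((T ^^ r) ?\<phi> ?y) = b x * cocycle r x"
      using b(2)[of x] cocycle_pos[OF xX, of r] by (simp add: T_pow_psi_pow[OF xX] norm_mult)
    ultimately have "1 / 2 \<le> b x * cocycle r x" using r(2)[of ?y] by linarith
    also have "\<dots> \<le> B * cocycle r x"
      using B(2)[OF x] cocycle_pos[OF xX, of r] by (simp add: mult_right_mono)
    also have "cocycle r x = cocycle m x * cocycle (r - m) ((\<psi> ^^ m) x)"
      using cocycle_add[of m "r - m" x] r(1) by simp
    also have "\<dots> \<le> cocycle m x * C"
    proof -
      have "(\<psi> ^^ m) x \<in> L" using L(4)[OF m x] by blast
      then have "cocycle (r - m) ((\<psi> ^^ m) x) \<le> C" using C(4)[of "r - m"] r(1) by simp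
      then show ?thesis using cocycle_pos[OF xX, of m] by (simp add: mult_left_mono)
    qed
    finally have "1 / 2 \<le> B * (cocycle m x * C)" using B(1) by (simp add: mult_left_mono)
    then show ?thesis using B(1) C(3) by (simp add: field_simps)
  qed
  moreover have "1 / (2 * B * C) > 0" using B(1) C(3) by simp
  ultimately show thesis using that by blast
qed

text \<open>
  With a cutoff \<open>b\<close> for \<open>K\<close>, the component \<open>(\<psi>\<^sup>-\<^sup>m)\<^sub>c\<close> is the quotient of \<open>T\<^sup>m(b x\<^sub>c)\<close> by \<open>T\<^sup>m b\<close> near \<open>\<psi>\<^sup>m(K)\<close>, and
  \<open>cocycle_lower\<close> keeps the denominator away from \<open>0\<close>.
\<close>

lemma inverse_iterates_bounded:
  assumes K: "compact K" "K \<subseteq> X"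
  shows "bdd_above ((\<lambda>m. Cn_norm n ((\<psi> ^^ m) ` K) (\<lambda>x. (\<iota> ^^ m) x $ c)) ` {1..})"
proof -
  obtain b where b: "smooth_on UNIV b" "\<And>x. b x \<ge> 0" "\<And>x. x \<in> K \<Longrightarrow> b x \<ge> 1" "{x. b x \<noteq> 0} \<subseteq> X"
    "\<And>f. smooth_on UNIV f \<Longrightarrow> (\<lambda>x. complex_of_real (b x * f x)) \<in> test_functions X"
    by (rule exists_test_cutoff[OF K]) (rule that)
  obtain e where e: "e > 0" "\<And>m x. m \<ge> 1 \<Longrightarrow> x \<in> K \<Longrightarrow> e \<le> cocycle m x"
    by (rule cocycle_lower[OF K]) (rule that)
  let ?\<phi> = "\<lambda>x. complex_of_real (b x * 1)" and ?\<eta> = "\<lambda>x. complex_of_real (b x * x $ c)"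
  let ?V = "{x. b x \<noteq> 0}"
  have \<phi>: "?\<phi> \<in> test_functions X" by (rule b(5)[OF smooth_on_const[OF open_UNIV]])
  have \<eta>: "?\<eta> \<in> test_functions X"
    by (rule b(5)[OF smooth_on_linear[OF open_UNIV bounded_linear_vec_nth smooth_on_ident[OF open_UNIV]]])
  define U where "U = (\<lambda>m. (\<psi> ^^ Suc m) ` ?V)"
  define K' where "K' = (\<lambda>m. (\<psi> ^^ Suc m) ` K)"
  have "open ?V"
    using open_vimage[OF open_Compl[OF closed_singleton] smooth_on_imp_continuous_on[OF b(1)], of 0]
    by (simp add: vimage_def)
  then have U: "open (U m)" for m unfolding U_def using open_image b(4) by blast
  have KV: "K \<subseteq> ?V" using b(3) by fastforce
  have K'U: "K' m \<subseteq> U m" for m unfolding U_def K'_def using KV by (rule image_mono)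
  have bs: "bounded_smooth n U K' (\<lambda>m. (T ^^ Suc m) f)" if f: "f \<in> test_functions X" for f
  proof -
    obtain L where L: "compact L" "L \<subseteq> X" "\<And>m. m \<ge> 1 \<Longrightarrow> (T ^^ m) f \<in> test_functions_in L"
      and bd: "\<And>n. \<exists>C. \<forall>m\<ge>1. \<forall>\<alpha> x. length \<alpha> \<le> n \<longrightarrow> cmod (iter_partial \<alpha> ((T ^^ m) f) x) \<le> C"
      by (rule orbit_support[OF f]) (rule that)
    obtain C where C: "\<forall>m\<ge>1. \<forall>\<alpha> x. length \<alpha> \<le> n \<longrightarrow> cmod (iter_partial \<alpha> ((T ^^ m) f) x) \<le> C"
      using bd[of n] by blast
    have "bounded_smooth n (\<lambda>_. UNIV) (\<lambda>_. UNIV) (\<lambda>m. (T ^^ Suc m) f)"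
      unfolding bounded_smooth_def
    proof (intro allI impI conjI ballI)
      show "iter_partial \<alpha> ((T ^^ Suc m) f) differentiable at x" for \<alpha> m x
        using test_functions_smooth[OF T_pow_in[OF f, of "Suc m"]] unfolding smooth_on_def by blast
      show "\<exists>C. \<forall>m. \<forall>x\<in>UNIV. cmod (iter_partial \<alpha> ((T ^^ Suc m) f) x) \<le> C" if "length \<alpha> \<le> n" for \<alpha>
      proof (intro exI[of _ C] allI ballI)
        show "cmod (iter_partial \<alpha> ((T ^^ Suc m) f) x) \<le> C" for m x
          by (rule C[rule_format, OF _ that]) simp
      qed
    qed
    then show ?thesis by (rule bounded_smooth_subset) auto
  qed
  have val: "(T ^^ Suc m) ?\<phi> ((\<psi> ^^ Suc m) x) = of_real (b x * cocycle (Suc m) x)"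
    "(T ^^ Suc m) ?\<eta> ((\<psi> ^^ Suc m) x) = of_real (b x * x $ c * cocycle (Suc m) x)" if "x \<in> X" for m x
    unfolding T_pow_psi_pow[OF that] by simp_all
  have inv: "bounded_smooth n U K' (\<lambda>m y. inverse ((T ^^ Suc m) ?\<phi> y))"
  proof (rule bounded_smooth_inverse[OF U K'U bs[OF \<phi>] _ e(1)])
    fix m y assume "y \<in> U m"
    then obtain x where x: "b x \<noteq> 0" "y = (\<psi> ^^ Suc m) x" by (auto simp: U_def)
    then have "x \<in> X" using b(4) by blast
    show "(T ^^ Suc m) ?\<phi> y \<noteq> 0"
      unfolding x(2) val[OF \<open>x \<in> X\<close>] using x(1) cocycle_pos[OF \<open>x \<in> X\<close>, of "Suc m"] by simp
  next
    fix m y assume "y \<in> K' m"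
    then obtain x where x: "x \<in> K" "y = (\<psi> ^^ Suc m) x" by (auto simp: K'_def)
    then have "x \<in> X" using K(2) by blast
    have "e \<le> cocycle (Suc m) x" using e(2)[OF _ x(1)] by simp
    also have "\<dots> \<le> b x * cocycle (Suc m) x"
      using b(3)[OF x(1)] cocycle_pos[OF \<open>x \<in> X\<close>, of "Suc m"] by simp
    finally show "e \<le> cmod ((T ^^ Suc m) ?\<phi> y)"
      unfolding x(2) val[OF \<open>x \<in> X\<close>] norm_of_real by (rule order_trans[OF _ abs_ge_self])
  qed
  have "bounded_smooth n U K' (\<lambda>m y. Re ((T ^^ Suc m) ?\<eta> y * inverse ((T ^^ Suc m) ?\<phi> y)))"
    by (rule bounded_smooth_linear[OF U K'U bounded_linear_Re bounded_smooth_mult[OF U K'U bs[OF \<eta>] inv]])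
  moreover have "Re ((T ^^ Suc m) ?\<eta> y * inverse ((T ^^ Suc m) ?\<phi> y)) = (\<iota> ^^ Suc m) y $ c" if "y \<in> U m" for m y
  proof -
    from that obtain x where x: "b x \<noteq> 0" "y = (\<psi> ^^ Suc m) x" by (auto simp: U_def)
    then have xX: "x \<in> X" using b(4) by blast
    have quot: "Re (of_real p * inverse (of_real q)) = p / q" for p q
      unfolding of_real_inverse[symmetric] of_real_mult[symmetric] by (simp only: Re_complex_of_real divide_inverse)
    show ?thesis
      unfolding x(2) val[OF xX] inv_pow_psi_pow[OF xX] quot using x(1) cocycle_pos[OF xX, of "Suc m"] by simp
  qed
  ultimately have "bounded_smooth n U K' (\<lambda>m y. (\<iota> ^^ Suc m) y $ c)"
    by (subst (asm) bounded_smooth_cong[OF U K'U])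
  then obtain C where C: "\<And>m. Cn_norm n (K' m) (\<lambda>y. (\<iota> ^^ Suc m) y $ c) \<le> C"
    by (rule bounded_smooth_imp_Cn_norm_bounded) (rule that)
  have "Cn_norm n ((\<psi> ^^ m) ` K) (\<lambda>x. (\<iota> ^^ m) x $ c) \<le> C" if "m \<ge> 1" for m
  proof -
    have "Suc (m - 1) = m" using that by simp
    with C[of "m - 1"] show ?thesis unfolding K'_def by (simp only:)
  qed
  then show ?thesis by (intro bdd_aboveI2[of _ _ C]) simp
qed

end

theorem corollary2p13:
  fixes X :: "(real^'d) set" and \<psi> :: "real^'d \<Rightarrow> real^'d"
  assumes "open X"
    and "smooth_on X \<psi>"
    and "bij_betw \<psi> X X"
    and "\<And>x. x \<in> X \<Longrightarrow> det (jacobian \<psi> (at x)) \<noteq> 0"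
  shows "power_bounded (strong_dual_topology X) (composition_operator X \<psi>) \<longleftrightarrow>
    stable_orbits X \<psi> \<and>
    (\<forall>K n. compact K \<and> K \<subseteq> X \<longrightarrow>
      (\<forall>c. bdd_above
        ((\<lambda>m. Cn_norm n ((\<psi> ^^ m) ` K) (\<lambda>x. (inv_into X \<psi> ^^ m) x $ c)) ` {1..})))"
proof -
  interpret diffeo X \<psi>
    using assms by unfold_locales
  note power_bounded_iff = power_bounded_transpose_on_iff[OF open_X T_continuous, folded composition_operator_eq]
  show ?thesis
  proof (intro iffI conjI allI impI)
    assume "power_bounded (strong_dual_topology X) (composition_operator X \<psi>)"
    note orbits = this[unfolded power_bounded_iff, rule_format]
    interpret diffeo_bounded_orbits X \<psi>
      by unfold_locales (rule orbits[OF von_Neumann_bounded_test_singleton])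
    show "stable_orbits X \<psi>" by (rule stable_orbits_psi)
    show "bdd_above ((\<lambda>m. Cn_norm n ((\<psi> ^^ m) ` K) (\<lambda>x. (\<iota> ^^ m) x $ c)) ` {1..})"
      if "compact K \<and> K \<subseteq> X" for K n c
      by (rule inverse_iterates_bounded) (use that in simp_all)
  next
    assume ii: "stable_orbits X \<psi> \<and> (\<forall>K n. compact K \<and> K \<subseteq> X \<longrightarrow>
      (\<forall>c. bdd_above ((\<lambda>m. Cn_norm n ((\<psi> ^^ m) ` K) (\<lambda>x. (\<iota> ^^ m) x $ c)) ` {1..})))"
    show "power_bounded (strong_dual_topology X) (composition_operator X \<psi>)"
      unfolding power_bounded_iff
    proof (intro allI impI)
      fix B assume "bounded_tests X B"
      then show "bounded_tests X (\<Union>m\<in>{1..}. (T ^^ m) ` B)"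
        by (rule orbit_bounded_if_inverse_iterates_bounded[rotated 3, of _ 1])
          (use ii in \<open>simp_all add: stable_orbits_def Ball_def\<close>)
    qed
  qed
qed

end
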